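(* Let $\mathcal{N}_{A\rightarrow BE}$ be a quantum channel (an isometric extension of a channel $A\to B$, with $E$ the environment/eavesdropper). Fix $\epsilon\in(0,1)$, $\epsilon'\in(0,1)$, $\delta\in(0,\epsilon)$ and $\delta'\in(0,\epsilon')$. Suppose there exist a probability distribution $p_{X,Y}$ on finite alphabets $\mathcal{X}\times\mathcal{Y}$ and input states $\{\rho_A^{x,y}\}$, giving the state $\rho_{XYBE}=\sum_{x,y}p_{X,Y}(x,y)|x\rangle\langle x|_X\otimes|y\rangle\langle y|_Y\otimes\mathcal{N}_{A\to BE}(\rho_A^{x,y})$, such that the pair $(r,R)$ satisfies $$r\leq I_{H}^{\epsilon-\delta}(X;B)_\rho-\log_{2}\Big(\frac{4\epsilon}{\delta^{2}}\Big),$$ $$R\leq I_{H}^{\epsilon-\delta}(Y;B|X)_\rho-\tilde{I}_{max}^{\sqrt{\epsilon'}-\delta'}(Y;E|X)_\rho-\log_{2}\Big(\frac{4\epsilon}{\delta^{2}}\Big)-2\log_{2}\Big(\frac{1}{\delta'}\Big).$$ Then there exists a one-shot $(r,R,\,3\epsilon+2\sqrt{\epsilon}+\sqrt{\epsilon'},\,2(\epsilon+\sqrt{\epsilon})+\sqrt{\epsilon'})$ simultaneous public-private code for $\mathcal{N}_{A\rightarrow BE}$.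
   Context: All systems are finite-dimensional and $\log=\log_2$. For states $\rho,\sigma$: fidelity $F(\rho,\sigma)=\|\sqrt{\rho}\sqrt{\sigma}\|_1$; purified distance $P(\rho,\sigma)=\sqrt{1-F(\rho,\sigma)^2}$; $\mathcal{B}^\eta(\rho)=\{\rho' \text{ state}: P(\rho',\rho)\le\eta\}$. Hypothesis testing relative entropy: $D_H^\eta(\rho\|\sigma)=-\log_2\inf\{\mathrm{Tr}(T\sigma): 0\le T\le \mathbb{1},\ \mathrm{Tr}((\mathbb{1}-T)\rho)\le\eta\}$, and $I_H^\eta(A;B)_\rho=D_H^\eta(\rho_{AB}\|\rho_A\otimes\rho_B)$. Max-relative entropy: $D_{max}(\rho\|\sigma)=\inf\{\lambda\in\mathbb{R}:\rho\le 2^\lambda\sigma\}$. For a classical-quantum state $\rho_{XYE}=\sum_x p_X(x)|x\rangle\langle x|\otimes\rho^x_{YE}$ (similarly $\rho_{XYB}$): $I_H^\eta(Y;B|X)_\rho=\max_{\rho'_X}\min_{x\in\mathrm{supp}(\rho'_X)} I_H^\eta(Y;B)_{\rho^x_{YB}}$, the maximum over classical states $\rho'_X=\sum_x p'(x)|x\rangle\langle x|$ with $P(\rho'_X,\rho_X)\le\eta$; and $\tilde{I}_{max}^\eta(Y;E|X)_\rho=\min_{\rho'_X}\max_{x\in\mathrm{supp}(\rho'_X)}\inf_{\tilde\rho_{YE}\in\mathcal{B}^\eta(\rho^x_{YE})}D_{max}(\tilde\rho_{YE}\|\rho^x_Y\otimes\tilde\rho_E)$, the minimum over classical $\rho'_X$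 with $P(\rho'_X,\rho_X)\le\eta$. A one-shot $(r,R,\epsilon_1,\epsilon_2)$ simultaneous public-private code for $\mathcal{N}_{A\to BE}$, with message sets $\mathcal{M},\mathcal{L}$ of sizes $|\mathcal{M}|=2^r$, $|\mathcal{L}|=2^R$ and public message $M$ and private message $L$ independent and uniformly distributed, consists of an encoding $\mathcal{E}:\mathcal{M}\times\mathcal{L}\to\mathcal{D}(\mathcal{H}_A)$ and a decoding measurement $\mathcal{D}$ on $B$ outputting $(\hat M,\hat L)$ such that $\Pr((\hat M,\hat L)\ne(M,L))\le\epsilon_1$ and, for every $m\in\mathcal{M}$, $\frac12\|\rho^m_{LE}-\rho_L\otimes\tilde\rho^m_E\|_1\le\epsilon_2$ for some state $\tilde\rho^m_E$, where $\rho^m_{LBE}=\frac{1}{|\mathcal{L}|}\sum_{\ell}|\ell\rangle\langle\ell|_L\otimes\mathcal{N}_{A\to BE}(\mathcal{E}(m,\ell))$. *)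

theory Defs
  imports "HOL-Analysis.Analysis" "HOL-Library.Extended_Real" "Jordan_Normal_Form.Matrix"
begin

definition mtrace :: "complex mat \<Rightarrow> complex" where
  "mtrace M = (\<Sum>i<dim_row M. M $$ (i,i))"

definition adj :: "complex mat \<Rightarrow> complex mat" where
  "adj M = mat (dim_col M) (dim_row M) (\<lambda>(i,j). cnj (M $$ (j,i)))"

definition psd :: "complex mat \<Rightarrow> bool" where
  "psd M \<longleftrightarrow> square_mat M \<and>
     (\<forall>v \<in> carrier_vec (dim_row M). \<exists>r::real. r \<ge> 0 \<and>
        (\<Sum>i<dim_row M. cnj (v $ i) * (M *\<^sub>v v) $ i) = complex_of_real r)"

definition mle :: "complex mat \<Rightarrow> complex mat \<Rightarrow> bool" where
  "mle A B \<longleftrightarrow> dim_row A = dim_row B \<and> dim_col A = dim_col B \<and> psd (B - A)"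

definition is_state :: "nat \<Rightarrow> complex mat \<Rightarrow> bool" where
  "is_state d \<rho> \<longleftrightarrow> \<rho> \<in> carrier_mat d d \<and> psd \<rho> \<and> mtrace \<rho> = 1"

definition msqrt :: "complex mat \<Rightarrow> complex mat" where
  "msqrt A = (THE B. psd B \<and> dim_row B = dim_row A \<and> B * B = A)"

definition tnorm :: "complex mat \<Rightarrow> real" where
  "tnorm M = Re (mtrace (msqrt (adj M * M)))"

definition fidelity :: "complex mat \<Rightarrow> complex mat \<Rightarrow> real" where
  "fidelity \<rho> \<sigma> = tnorm (msqrt \<rho> * msqrt \<sigma>)"

definition pdist :: "complex mat \<Rightarrow> complex mat \<Rightarrow> real" where
  "pdist \<rho> \<sigma> = sqrt (1 - (fidelity \<rho> \<sigma>)\<^sup>2)"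

definition pball :: "nat \<Rightarrow> real \<Rightarrow> complex mat \<Rightarrow> complex mat set" where
  "pball d \<eta> \<rho> = {\<rho>'. is_state d \<rho>' \<and> pdist \<rho>' \<rho> \<le> \<eta>}"

text \<open>Kronecker (tensor) product, ordering (i1,i2) \<mapsto> i1 * d2 + i2.\<close>
definition kron :: "complex mat \<Rightarrow> complex mat \<Rightarrow> complex mat" where
  "kron A B = mat (dim_row A * dim_row B) (dim_col A * dim_col B)
     (\<lambda>(i,j). A $$ (i div dim_row B, j div dim_col B) * B $$ (i mod dim_row B, j mod dim_col B))"

definition ptr2 :: "nat \<Rightarrow> nat \<Rightarrow> complex mat \<Rightarrow> complex mat" where
  "ptr2 d1 d2 M = mat d1 d1 (\<lambda>(i,j). \<Sum>k<d2. M $$ (i*d2+k, j*d2+k))"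

definition ptr1 :: "nat \<Rightarrow> nat \<Rightarrow> complex mat \<Rightarrow> complex mat" where
  "ptr1 d1 d2 M = mat d2 d2 (\<lambda>(i,j). \<Sum>k<d1. M $$ (k*d2+i, k*d2+j))"

definition proj :: "nat \<Rightarrow> nat \<Rightarrow> complex mat" where
  "proj n x = mat n n (\<lambda>(i,j). if i = x \<and> j = x then 1 else 0)"

definition diagm :: "nat \<Rightarrow> (nat \<Rightarrow> real) \<Rightarrow> complex mat" where
  "diagm n f = mat n n (\<lambda>(i,j). if i = j then complex_of_real (f i) else 0)"

definition msum :: "nat \<Rightarrow> nat \<Rightarrow> 'a set \<Rightarrow> ('a \<Rightarrow> complex mat) \<Rightarrow> complex mat" where
  "msum n m S f = mat n m (\<lambda>ij. \<Sum>a\<in>S. f a $$ ij)"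

definition rsmult :: "real \<Rightarrow> complex mat \<Rightarrow> complex mat" where
  "rsmult c M = complex_of_real c \<cdot>\<^sub>m M"

definition DH :: "real \<Rightarrow> complex mat \<Rightarrow> complex mat \<Rightarrow> real" where
  "DH \<eta> \<rho> \<sigma> = - log 2 (Inf {Re (mtrace (T * \<sigma>)) | T.
      T \<in> carrier_mat (dim_row \<rho>) (dim_row \<rho>) \<and>
      mle (0\<^sub>m (dim_row \<rho>) (dim_row \<rho>)) T \<and> mle T (1\<^sub>m (dim_row \<rho>)) \<and>
      Re (mtrace ((1\<^sub>m (dim_row \<rho>) - T) * \<rho>)) \<le> \<eta>})"

definition IH :: "real \<Rightarrow> nat \<Rightarrow> nat \<Rightarrow> complex mat \<Rightarrow> real" where
  "IH \<eta> d1 d2 \<rho> = DH \<eta> \<rho> (kron (ptr2 d1 d2 \<rho>) (ptr1 d1 d2 \<rho>))"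

text \<open>Max-relative entropy (value +infinity if the set is empty).\<close>
definition Dmax :: "complex mat \<Rightarrow> complex mat \<Rightarrow> ereal" where
  "Dmax \<rho> \<sigma> = Inf {ereal t | t. mle \<rho> (rsmult (2 powr t) \<sigma>)}"

text \<open>Isometric extension N_{A->BE}(rho) = V rho V*, output ordered B (x) E.\<close>
definition isometry :: "nat \<Rightarrow> nat \<Rightarrow> complex mat \<Rightarrow> bool" where
  "isometry dIn dOut V \<longleftrightarrow> V \<in> carrier_mat dOut dIn \<and> adj V * V = 1\<^sub>m dIn"

definition chan :: "complex mat \<Rightarrow> complex mat \<Rightarrow> complex mat" where
  "chan V \<rho> = V * \<rho> * adj V"

definition margX :: "nat \<Rightarrow> (nat \<Rightarrow> nat \<Rightarrow> real) \<Rightarrow> nat \<Rightarrow> real" where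
  "margX nY p x = (\<Sum>y<nY. p x y)"

definition stXB :: "nat \<Rightarrow> nat \<Rightarrow> nat \<Rightarrow> nat \<Rightarrow> (nat \<Rightarrow> nat \<Rightarrow> real) \<Rightarrow> complex mat
    \<Rightarrow> (nat \<Rightarrow> nat \<Rightarrow> complex mat) \<Rightarrow> complex mat" where
  "stXB nX nY dB dE p V \<rho>in = msum (nX*dB) (nX*dB) ({..<nX} \<times> {..<nY})
      (\<lambda>(x,y). rsmult (p x y) (kron (proj nX x) (ptr2 dB dE (chan V (\<rho>in x y)))))"

definition stYB :: "nat \<Rightarrow> nat \<Rightarrow> nat \<Rightarrow> (nat \<Rightarrow> nat \<Rightarrow> real) \<Rightarrow> complex mat
    \<Rightarrow> (nat \<Rightarrow> nat \<Rightarrow> complex mat) \<Rightarrow> nat \<Rightarrow> complex mat" where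
  "stYB nY dB dE p V \<rho>in x = msum (nY*dB) (nY*dB) {..<nY}
      (\<lambda>y. rsmult (p x y / margX nY p x) (kron (proj nY y) (ptr2 dB dE (chan V (\<rho>in x y)))))"

definition stYE :: "nat \<Rightarrow> nat \<Rightarrow> nat \<Rightarrow> (nat \<Rightarrow> nat \<Rightarrow> real) \<Rightarrow> complex mat
    \<Rightarrow> (nat \<Rightarrow> nat \<Rightarrow> complex mat) \<Rightarrow> nat \<Rightarrow> complex mat" where
  "stYE nY dB dE p V \<rho>in x = msum (nY*dE) (nY*dE) {..<nY}
      (\<lambda>y. rsmult (p x y / margX nY p x) (kron (proj nY y) (ptr1 dB dE (chan V (\<rho>in x y)))))"

definition is_dist :: "nat \<Rightarrow> (nat \<Rightarrow> real) \<Rightarrow> bool" where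
  "is_dist n q \<longleftrightarrow> (\<forall>x<n. q x \<ge> 0) \<and> (\<Sum>x<n. q x) = 1"

definition IH_cond :: "real \<Rightarrow> nat \<Rightarrow> nat \<Rightarrow> nat \<Rightarrow> nat \<Rightarrow> (nat \<Rightarrow> nat \<Rightarrow> real) \<Rightarrow> complex mat
    \<Rightarrow> (nat \<Rightarrow> nat \<Rightarrow> complex mat) \<Rightarrow> real" where
  "IH_cond \<eta> nX nY dB dE p V \<rho>in =
     Sup {Min {IH \<eta> nY dB (stYB nY dB dE p V \<rho>in x) | x. x < nX \<and> q x > 0} | q.
            is_dist nX q \<and> pdist (diagm nX q) (diagm nX (margX nY p)) \<le> \<eta>}"

definition Imax_cond :: "real \<Rightarrow> nat \<Rightarrow> nat \<Rightarrow> nat \<Rightarrow> nat \<Rightarrow> (nat \<Rightarrow> nat \<Rightarrow> real) \<Rightarrow> complex mat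
    \<Rightarrow> (nat \<Rightarrow> nat \<Rightarrow> complex mat) \<Rightarrow> ereal" where
  "Imax_cond \<eta> nX nY dB dE p V \<rho>in =
     Inf {Max {Inf {Dmax \<rho>' (kron (ptr2 nY dE (stYE nY dB dE p V \<rho>in x)) (ptr1 nY dE \<rho>')) | \<rho>'.
                      \<rho>' \<in> pball (nY*dE) \<eta> (stYE nY dB dE p V \<rho>in x)}
               | x. x < nX \<and> q x > 0} | q.
            is_dist nX q \<and> pdist (diagm nX q) (diagm nX (margX nY p)) \<le> \<eta>}"

text \<open>An (r,R,eps1,eps2) code with |M| = nM = 2^r and |L| = nL = 2^R for the isometric
  channel V : A -> B (x) E.  Encoding enc m l (states on A); decoding POVM dec m l on B.\<close>
definition sim_pub_priv_code :: "nat \<Rightarrow> nat \<Rightarrow> nat \<Rightarrow> complex mat \<Rightarrow> nat \<Rightarrow> nat \<Rightarrow> real \<Rightarrow> real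
    \<Rightarrow> (nat \<Rightarrow> nat \<Rightarrow> complex mat) \<Rightarrow> (nat \<Rightarrow> nat \<Rightarrow> complex mat) \<Rightarrow> bool" where
  "sim_pub_priv_code dA dB dE V nM nL \<epsilon>1 \<epsilon>2 enc dec \<longleftrightarrow>
     (\<forall>m<nM. \<forall>l<nL. is_state dA (enc m l)) \<and>
     (\<forall>m<nM. \<forall>l<nL. dec m l \<in> carrier_mat dB dB \<and> psd (dec m l)) \<and>
     msum dB dB ({..<nM} \<times> {..<nL}) (\<lambda>(m,l). dec m l) = 1\<^sub>m dB \<and>
     1 - (\<Sum>(m,l)\<in>{..<nM} \<times> {..<nL}.
            Re (mtrace (dec m l * ptr2 dB dE (chan V (enc m l))))) / (real nM * real nL) \<le> \<epsilon>1 \<and>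
     (\<forall>m<nM. \<exists>\<sigma>. is_state dE \<sigma> \<and>
        tnorm (msum (nL*dE) (nL*dE) {..<nL}
                  (\<lambda>l. rsmult (1 / real nL) (kron (proj nL l) (ptr1 dB dE (chan V (enc m l)))))
               - kron (rsmult (1 / real nL) (1\<^sub>m nL)) \<sigma>) / 2 \<le> \<epsilon>2)"

end

theory Submission
  imports Defs "HOL-Library.FuncSet" "Jordan_Normal_Form.Spectral_Radius"
begin

text \<open>Public messages select independent \<open>x\<close>-codewords, decoded by a pretty good measurement built from an almost optimal
  hypothesis test; the Hayashi--Nagaoka inequality bounds the expected error by \<open>\<epsilon>\<close>. Given its codeword \<open>x\<close>, each public message
  carries its own codebook of \<open>y\<close>-codewords indexed by the private message and a uniform randomizer, decoded in the same way inside
  the public effect. Averaging over the randomizer hides the private message from \<open>E\<close> by convex splitting.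

  Two distributions close to \<open>p\<^sub>X\<close> in purified distance certify the two conditional rates; outside their common support, which has
  small \<open>p\<^sub>X\<close>-mass, the private message is ignored, at the cost of an error. Privacy is required for every public message, so
  for each \<open>x\<close>-codeword the private codebook is derandomized on its own: its leakage depends on that codebook alone and its decoding
  error is linear in the public failure probability. The sum of all contributions stays below the claimed error whenever that
  error is less than 1.\<close>

text \<open>The number of public messages is fixed, so bad ones cannot be expurgated, yet each must
  be private on its own. The claimed leakage exceeds the expected leakage
  \<open>s = sqrt \<epsilon>'\<close> of a private codebook by
  \<open>t = 2 * (\<epsilon> + sqrt \<epsilon>)\<close>. This margin pays for fixing one codebook
  below the threshold \<open>s + t\<close>; the price is a factor
  \<open>\<kappa> = (s + t) / t\<close> on its decoding error. That error is at most three times the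
  public failure plus twice the private one, each of expectation at most \<epsilon>, so the total is
  (\<epsilon> - \<delta>)^2 + (s - \<delta>')^2 + 5 \<kappa> \<epsilon>, the squares bounding the
  mass outside the common support. In trace norm the expected leakage 2 s consists of 2 (s -
  \<delta>') from smoothing and 2 \<delta>' from convex splitting. A public effect depends on the
  whole public codebook. The private code is therefore built inside an arbitrary effect
  \<open>E\<close>, with an error bound affine in the failure of \<open>E\<close> and a leakage
  bound independent of \<open>E\<close>.\<close>

text \<open>Finitely supported infinite matrices form a ring in which all dimensions live together, so products need no
  carrier side conditions; \<open>n \<times> n\<close> matrices are the corner cut out by the projection \<open>idn n\<close>, and column vectors are
  operators with a single nonzero column.\<close>
typedef fop = "{f :: nat \<Rightarrow> nat \<Rightarrow> complex. \<exists>n. \<forall>i j. n \<le> i \<or> n \<le> j \<longrightarrow> f i j = 0}"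
  morphisms ent Fop
  by auto

setup_lifting type_definition_fop

lemma fop_eqI: "(\<And>i j. ent A i j = ent B i j) \<Longrightarrow> A = B"
  by transfer auto

lemma ent_bound: "\<exists>n. \<forall>i j. n \<le> i \<or> n \<le> j \<longrightarrow> ent A i j = 0"
  using ent[of A] by simp

lemma ent_bound2: "\<exists>N. (\<forall>i j. N \<le> i \<or> N \<le> j \<longrightarrow> ent A i j = 0) \<and> (\<forall>i j. N \<le> i \<or> N \<le> j \<longrightarrow> ent B i j = 0)"
proof -
  obtain n m where *: "\<forall>i j. n \<le> i \<or> n \<le> j \<longrightarrow> ent A i j = 0" "\<forall>i j. m \<le> i \<or> m \<le> j \<longrightarrow> ent B i j = 0"
    using ent_bound by metis
  show ?thesis
    by (rule exI[of _ "max n m"]) (use * in auto)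
qed

instantiation fop :: real_vector
begin
lift_definition zero_fop :: fop is "\<lambda>_ _. 0" by auto
lift_definition plus_fop :: "fop \<Rightarrow> fop \<Rightarrow> fop" is "\<lambda>f g i j. f i j + g i j"
proof -
  fix f g :: "nat \<Rightarrow> nat \<Rightarrow> complex"
  assume "\<exists>n. \<forall>i j. n \<le> i \<or> n \<le> j \<longrightarrow> f i j = 0" "\<exists>n. \<forall>i j. n \<le> i \<or> n \<le> j \<longrightarrow> g i j = 0"
  then obtain n m where "\<forall>i j. n \<le> i \<or> n \<le> j \<longrightarrow> f i j = 0" "\<forall>i j. m \<le> i \<or> m \<le> j \<longrightarrow> g i j = 0" by auto
  then show "\<exists>n. \<forall>i j. n \<le> i \<or> n \<le> j \<longrightarrow> f i j + g i j = 0"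
    by (intro exI[of _ "max n m"]) auto
qed
lift_definition uminus_fop :: "fop \<Rightarrow> fop" is "\<lambda>f i j. - f i j" by auto
lift_definition scaleR_fop :: "real \<Rightarrow> fop \<Rightarrow> fop" is "\<lambda>c f i j. complex_of_real c * f i j"
  by (metis mult_zero_right)
definition minus_fop :: "fop \<Rightarrow> fop \<Rightarrow> fop" where "minus_fop A B = A + - B"
lemma ent_linear:
  "ent 0 i j = 0" "ent (A + B) i j = ent A i j + ent B i j" "ent (- A) i j = - ent A i j"
  "ent (A - B) i j = ent A i j - ent B i j" "ent (c *\<^sub>R A) i j = complex_of_real c * ent A i j"
  by (simp_all add: minus_fop_def zero_fop.rep_eq plus_fop.rep_eq uminus_fop.rep_eq scaleR_fop.rep_eq)
instance
  by standard (rule fop_eqI, simp add: ent_linear algebra_simps)+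
end

lemmas ent_simps [simp] = ent_linear

lemma ent_sum [simp]: "ent (sum f S) i j = (\<Sum>s\<in>S. ent (f s) i j)"
  by (induction S rule: infinite_finite_induct) auto

text \<open>Summing over the indices of nonzero terms avoids choosing a bound on the support; finite
  support makes this index set finite.\<close>

lift_definition mul :: "fop \<Rightarrow> fop \<Rightarrow> fop" is
  "\<lambda>f g i j. \<Sum>k | f i k * g k j \<noteq> 0. f i k * g k j"
proof -
  fix f g :: "nat \<Rightarrow> nat \<Rightarrow> complex"
  assume "\<exists>n. \<forall>i j. n \<le> i \<or> n \<le> j \<longrightarrow> f i j = 0" "\<exists>n. \<forall>i j. n \<le> i \<or> n \<le> j \<longrightarrow> g i j = 0"
  then obtain n m where "\<forall>i j. n \<le> i \<or> n \<le> j \<longrightarrow> f i j = 0" "\<forall>i j. m \<le> i \<or> m \<le> j \<longrightarrow> g i j = 0" by auto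
  then show "\<exists>n. \<forall>i j. n \<le> i \<or> n \<le> j \<longrightarrow> (\<Sum>k | f i k * g k j \<noteq> 0. f i k * g k j) = 0"
    by (intro exI[of _ "max n m"] allI impI sum.neutral) (metis max.boundedE mult_zero_left mult_zero_right)
qed

lemma ent_mul:
  assumes "\<And>k. N \<le> k \<Longrightarrow> ent A i k * ent B k j = 0"
  shows "ent (mul A B) i j = (\<Sum>k<N. ent A i k * ent B k j)"
proof -
  have *: "{k. ent A i k * ent B k j \<noteq> 0} \<subseteq> {..<N}" 
  proof
    fix k assume "k \<in> {k. ent A i k * ent B k j \<noteq> 0}"
    then show "k \<in> {..<N}" using assms[of k] by (cases "k < N") auto
  qed
  have "ent (mul A B) i j = (\<Sum>k | ent A i k * ent B k j \<noteq> 0. ent A i k * ent B k j)"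
    by (simp add: mul.rep_eq)
  also have "\<dots> = (\<Sum>k<N. ent A i k * ent B k j)"
    by (rule sum.mono_neutral_left) (use * in auto)
  finally show ?thesis .
qed

text \<open>Only a ring without unit, because the infinite identity matrix is not finitely
  supported. \<open>idn n\<close> acts as the unit of its corner, so complements of effects are
  written \<open>idn n - T\<close>.\<close>

instantiation fop :: real_algebra
begin
definition times_fop :: "fop \<Rightarrow> fop \<Rightarrow> fop" where "times_fop = mul"
instance
proof
  fix A B C :: fop and c :: real
  obtain N where N: "\<forall>i j. N \<le> i \<or> N \<le> j \<longrightarrow> ent A i j = 0" "\<forall>i j. N \<le> i \<or> N \<le> j \<longrightarrow> ent B i j = 0"
    using ent_bound2[of A B] by blast
  obtain M where M: "\<forall>i j. M \<le> i \<or> M \<le> j \<longrightarrow> ent B i j = 0" "\<forall>i j. M \<le> i \<or> M \<le> j \<longrightarrow> ent C i j = 0"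
    using ent_bound2[of B C] by blast
  show "A * B * C = A * (B * C)"
  proof (rule fop_eqI)
    fix i j
    have "ent (A * B * C) i j = (\<Sum>k<M. (\<Sum>l<N. ent A i l * ent B l k) * ent C k j)"
      unfolding times_fop_def by (subst ent_mul[of M]; (subst ent_mul[of N])?; simp add: N M)
    also have "\<dots> = (\<Sum>l<N. ent A i l * (\<Sum>k<M. ent B l k * ent C k j))"
      by (simp add: sum_distrib_left sum_distrib_right mult.assoc) (rule sum.swap)
    also have "\<dots> = ent (A * (B * C)) i j"
      unfolding times_fop_def by (subst ent_mul[of N]; (subst ent_mul[of M])?; simp add: N M)
    finally show "ent (A * B * C) i j = ent (A * (B * C)) i j" .
  qed
  show "(A + B) * C = A * C + B * C"
    by (rule fop_eqI) (simp add: times_fop_def ent_mul[of M] M sum.distrib algebra_simps)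
  show "A * (B + C) = A * B + A * C"
    by (rule fop_eqI) (simp add: times_fop_def ent_mul[of N] N sum.distrib algebra_simps)
  show "(c *\<^sub>R A) * B = c *\<^sub>R (A * B)" "A * (c *\<^sub>R B) = c *\<^sub>R (A * B)"
    by (rule fop_eqI, simp add: times_fop_def ent_mul[of N] N sum_distrib_left algebra_simps)+
qed
end

lemma ent_times:
  assumes "\<And>k. N \<le> k \<Longrightarrow> ent A i k * ent B k j = 0"
  shows "ent (A * B) i j = (\<Sum>k<N. ent A i k * ent B k j)"
  using ent_mul[OF assms] by (simp add: times_fop_def)

subsection \<open>Adjoint, trace and the Hilbert-Schmidt inner product\<close>

lift_definition dag :: "fop \<Rightarrow> fop" is "\<lambda>f i j. cnj (f j i)"
  by auto

lemma ent_dag [simp]: "ent (dag A) i j = cnj (ent A j i)"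
  by (simp add: dag.rep_eq)

lemma dag_simps [simp]:
  "dag (dag A) = A" "dag 0 = 0" "dag (A + B) = dag A + dag B" "dag (A - B) = dag A - dag B"
  "dag (- A) = - dag A" "dag (c *\<^sub>R A) = c *\<^sub>R dag A"
  by (rule fop_eqI, simp)+

lemma dag_mult [simp]: "dag (A * B) = dag B * dag A"
proof -
  obtain N where N: "\<forall>i j. N \<le> i \<or> N \<le> j \<longrightarrow> ent A i j = 0" "\<forall>i j. N \<le> i \<or> N \<le> j \<longrightarrow> ent B i j = 0"
    using ent_bound2[of A B] by blast
  show ?thesis
    by (rule fop_eqI) (simp add: ent_times[of N] N mult.commute)
qed

lemma dag_sum [simp]: "dag (sum f S) = (\<Sum>s\<in>S. dag (f s))"
  by (rule fop_eqI) simp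

text \<open>The real part of the trace. It makes all expectations real without side conditions, and
  on positive operators it is the trace itself.\<close>

definition tr :: "fop \<Rightarrow> real" where
  "tr A = (\<Sum>i | ent A i i \<noteq> 0. Re (ent A i i))"

lemma tr_eq:
  assumes "\<And>i. N \<le> i \<Longrightarrow> ent A i i = 0"
  shows "tr A = (\<Sum>i<N. Re (ent A i i))"
proof -
  have *: "{i. ent A i i \<noteq> 0} \<subseteq> {..<N}"
  proof
    fix k assume "k \<in> {i. ent A i i \<noteq> 0}"
    then show "k \<in> {..<N}" using assms[of k] by (cases "k < N") auto
  qed
  show ?thesis unfolding tr_def
    by (rule sum.mono_neutral_left) (use * in auto)
qed

lemma tr_0 [simp]: "tr 0 = 0"
  by (simp add: tr_def)

lemma tr_add [simp]: "tr (A + B) = tr A + tr B"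
proof -
  obtain N where N: "\<forall>i j. N \<le> i \<or> N \<le> j \<longrightarrow> ent A i j = 0" "\<forall>i j. N \<le> i \<or> N \<le> j \<longrightarrow> ent B i j = 0"
    using ent_bound2[of A B] by blast
  show ?thesis by (simp add: tr_eq[of N] N sum.distrib)
qed

lemma tr_scaleR [simp]: "tr (c *\<^sub>R A) = c * tr A"
proof -
  obtain N where N: "\<forall>i j. N \<le> i \<or> N \<le> j \<longrightarrow> ent A i j = 0"
    using ent_bound[of A] by blast
  show ?thesis by (simp add: tr_eq[of N] N sum_distrib_left)
qed

lemma tr_uminus [simp]: "tr (- A) = - tr A"
  using tr_scaleR[of "-1" A] by simp

lemma tr_diff [simp]: "tr (A - B) = tr A - tr B"
  using tr_add[of A "- B"] by simp

lemma tr_sum [simp]: "tr (sum f S) = (\<Sum>s\<in>S. tr (f s))"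
  by (induction S rule: infinite_finite_induct) auto

lemma tr_comm: "tr (A * B) = tr (B * A)"
proof -
  obtain N where N: "\<forall>i j. N \<le> i \<or> N \<le> j \<longrightarrow> ent A i j = 0" "\<forall>i j. N \<le> i \<or> N \<le> j \<longrightarrow> ent B i j = 0"
    using ent_bound2[of A B] by blast
  show ?thesis
    by (simp add: tr_eq[of N] ent_times[of N] N, subst sum.swap) (simp add: algebra_simps)
qed

lemma tr_dag [simp]: "tr (dag A) = tr A"
  by (simp add: tr_def)

text \<open>The real part of the Hilbert-Schmidt product, which makes the library's Cauchy-Schwarz
  inequality and norm laws available for operators.\<close>

instantiation fop :: real_inner
begin
definition inner_fop :: "fop \<Rightarrow> fop \<Rightarrow> real" where "inner_fop A B = tr (dag A * B)"
definition norm_fop :: "fop \<Rightarrow> real" where "norm_fop A = sqrt (inner A A)"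
definition sgn_fop :: "fop \<Rightarrow> fop" where "sgn_fop A = A /\<^sub>R norm A"
definition dist_fop :: "fop \<Rightarrow> fop \<Rightarrow> real" where "dist_fop A B = norm (A - B)"
definition uniformity_fop :: "(fop \<times> fop) filter" where
  "uniformity_fop = (INF e\<in>{0 <..}. principal {(x, y). dist x y < e})"
definition open_fop :: "fop set \<Rightarrow> bool" where
  "open_fop S \<longleftrightarrow> (\<forall>x\<in>S. \<forall>\<^sub>F (x', y) in uniformity. x' = x \<longrightarrow> y \<in> S)"
instance
proof
  fix A B C :: fop and c :: real and S :: "fop set"
  show "dist A B = norm (A - B)" by (rule dist_fop_def)
  show "sgn A = A /\<^sub>R norm A" by (rule sgn_fop_def)
  show "uniformity = (INF e\<in>{0 <..}. principal {(x::fop, y). dist x y < e})" by (rule uniformity_fop_def)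
  show "open S \<longleftrightarrow> (\<forall>x\<in>S. \<forall>\<^sub>F (x', y) in uniformity. x' = x \<longrightarrow> y \<in> S)" by (rule open_fop_def)
  show "norm A = sqrt (inner A A)" by (rule norm_fop_def)
  show "inner A B = inner B A"
    using tr_dag[of "dag A * B"] by (simp add: inner_fop_def)
  show "inner (A + B) C = inner A C + inner B C" by (simp add: inner_fop_def algebra_simps)
  show "inner (c *\<^sub>R A) B = c * inner A B" by (simp add: inner_fop_def)
  obtain N where N: "\<forall>i j. N \<le> i \<or> N \<le> j \<longrightarrow> ent A i j = 0"
    using ent_bound[of A] by blast
  have *: "inner A A = (\<Sum>j<N. \<Sum>i<N. (cmod (ent A i j))\<^sup>2)"
    unfolding inner_fop_def
    by (simp add: tr_eq[of N] ent_times[of N] N) (simp add: cmod_power2 sum.distrib, simp add: power2_eq_square)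
  show "0 \<le> inner A A" unfolding * by (intro sum_nonneg) auto
  show "inner A A = 0 \<longleftrightarrow> A = 0"
  proof
    assume "inner A A = 0"
    then have "\<forall>j<N. \<forall>i<N. ent A i j = 0"
      unfolding * by (subst (asm) sum_nonneg_eq_0_iff; (auto intro!: sum_nonneg)?) (subst (asm) sum_nonneg_eq_0_iff; auto)
    then show "A = 0" by (intro fop_eqI) (metis N ent_simps(1) not_le)
  qed (simp add: inner_fop_def)
qed
end

lemma inner_mult_left: "inner A (B * C) = inner (dag B * A) C" for A B C :: fop
  by (simp add: inner_fop_def mult.assoc)

lemma norm_sq_fop: "(norm A)\<^sup>2 = tr (dag A * A)" for A :: fop
  by (metis inner_fop_def power2_norm_eq_inner)

lift_definition idn :: "nat \<Rightarrow> fop" is "\<lambda>n i j. if i = j \<and> i < n then 1 else 0"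
  by (metis not_le)

lemma ent_idn [simp]: "ent (idn n) i j = (if i = j \<and> i < n then 1 else 0)"
  by (simp add: idn.rep_eq)

lemma ent_idn_mult [simp]: "ent (idn n * A) i j = (if i < n then ent A i j else 0)"
  by (subst ent_times[of "Suc i"]) (auto simp: if_distrib[of "\<lambda>x. x * _"] cong: if_cong)

lemma ent_mult_idn [simp]: "ent (A * idn n) i j = (if j < n then ent A i j else 0)"
  by (subst ent_times[of "Suc j"]) (auto simp: if_distrib[of "\<lambda>x. _ * x"] cong: if_cong)

lemma dag_idn [simp]: "dag (idn n) = idn n"
  by (rule fop_eqI) auto

lemma idn_mult_idn [simp]: "idn n * idn n = idn n"
  by (rule fop_eqI) auto

lemma tr_idn [simp]: "tr (idn n) = real n"
  by (subst tr_eq[of n]) auto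

text \<open>Support in an \<open>n\<close> by \<open>m\<close> corner, phrased as invariance under
  corner projections so that it works as a rewrite rule inside products.\<close>

definition rect :: "nat \<Rightarrow> nat \<Rightarrow> fop \<Rightarrow> bool" where
  "rect n m A \<longleftrightarrow> idn n * A = A \<and> A * idn m = A"

abbreviation car :: "nat \<Rightarrow> fop \<Rightarrow> bool" where "car n \<equiv> rect n n"

lemma rect_iff: "rect n m A \<longleftrightarrow> (\<forall>i j. n \<le> i \<or> m \<le> j \<longrightarrow> ent A i j = 0)"
proof
  assume "rect n m A"
  then show "\<forall>i j. n \<le> i \<or> m \<le> j \<longrightarrow> ent A i j = 0"
    unfolding rect_def by (metis ent_idn_mult ent_mult_idn not_le)
next
  assume "\<forall>i j. n \<le> i \<or> m \<le> j \<longrightarrow> ent A i j = 0"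
  then show "rect n m A" unfolding rect_def by (auto intro!: fop_eqI simp: not_less)
qed

lemma rectD: "rect n m A \<Longrightarrow> idn n * A = A" "rect n m A \<Longrightarrow> A * idn m = A"
  "rect n m A \<Longrightarrow> idn n * (A * B) = A * B" "rect n m A \<Longrightarrow> A * (idn m * B) = A * B"
  by (simp_all add: rect_def mult.assoc[symmetric])

lemma rect_intros [simp, intro]:
  "rect n m 0" "car n (idn n)"
  "rect n m A \<Longrightarrow> rect n m B \<Longrightarrow> rect n m (A + B)"
  "rect n m A \<Longrightarrow> rect n m B \<Longrightarrow> rect n m (A - B)"
  "rect n m A \<Longrightarrow> rect n m (c *\<^sub>R A)"
  "rect n m A \<Longrightarrow> rect m n (dag A)"
  by (auto simp: rect_iff)

lemma rect_mult: "rect n k A \<Longrightarrow> rect k' m B \<Longrightarrow> rect n m (A * B)"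
  unfolding rect_def by (metis mult.assoc)

lemma car_mult [simp, intro]: "car n A \<Longrightarrow> car n B \<Longrightarrow> car n (A * B)"
  by (rule rect_mult)

lemma rect_sum [intro]: "(\<And>s. s \<in> S \<Longrightarrow> rect n m (f s)) \<Longrightarrow> rect n m (sum f S)"
  by (induction S rule: infinite_finite_induct) auto

subsection \<open>Positive operators\<close>

text \<open>Here \<open>v\<close> is an operator, so the form is a sum of quadratic forms over its
  columns. Self-adjointness is a separate conjunct because \<open>inner\<close> sees only the real
  part of the form.\<close>

definition pos :: "fop \<Rightarrow> bool" where
  "pos A \<longleftrightarrow> dag A = A \<and> (\<forall>v. 0 \<le> inner v (A * v))"

lemma pos_dag: "pos A \<Longrightarrow> dag A = A" by (simp add: pos_def)

lemma pos_inner: "pos A \<Longrightarrow> 0 \<le> inner v (A * v)" by (simp add: pos_def)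

lemma pos_0 [simp, intro]: "pos 0" by (simp add: pos_def)

lemma pos_add [intro]: "pos A \<Longrightarrow> pos B \<Longrightarrow> pos (A + B)"
  by (simp add: pos_def distrib_right inner_add_right)

lemma pos_scaleR [intro]: "pos A \<Longrightarrow> 0 \<le> c \<Longrightarrow> pos (c *\<^sub>R A)"
  by (simp add: pos_def)

lemma pos_sum [intro]: "(\<And>s. s \<in> S \<Longrightarrow> pos (f s)) \<Longrightarrow> pos (sum f S)"
  by (induction S rule: infinite_finite_induct) auto

lemma pos_conj: "pos A \<Longrightarrow> pos (dag B * A * B)"
  unfolding pos_def by (auto simp: mult.assoc inner_mult_left[of _ "dag B"])

lemma pos_conj': "pos A \<Longrightarrow> dag B = B \<Longrightarrow> pos (B * A * B)"
  using pos_conj[of A B] by simp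

lemma pos_dag_mult: "pos (dag B * B)"
  unfolding pos_def by (auto simp: mult.assoc inner_mult_left[of _ "dag B"])

lemma pos_idn [simp, intro]: "pos (idn n)"
  using pos_dag_mult[of "idn n"] by simp

text \<open>The quadratic form of \<open>A\<close> vanishes identically. Evaluating it at
  \<open>A * v + v\<close> leaves twice the squared norm of \<open>A * v\<close>, so
  \<open>A * v = 0\<close> for every \<open>v\<close>; then take \<open>v = dag A\<close>.\<close>

lemma pos_antisym:
  assumes "pos A" "pos (- A)" shows "A = 0"
proof -
  have q: "inner v (A * v) = 0" for v
    using assms pos_inner[of A v] pos_inner[of "-A" v] by simp
  have d: "dag A = A" using assms by (simp add: pos_def)
  have "inner (A * v) (A * v) = 0" for v
  proof -
    have "inner v (A * (A * v)) = inner (A * v) (A * v)"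
      by (subst inner_mult_left) (simp add: d)
    then show ?thesis
      using q[of "A * v + v"] q[of v] q[of "A * v"] by (simp add: distrib_left inner_add_left inner_add_right)
  qed
  then have "A * dag A = 0" by auto
  then have "norm (dag A) = 0" by (simp add: norm_fop_def inner_fop_def)
  then show ?thesis using d by simp
qed

lift_definition mko :: "nat \<Rightarrow> nat \<Rightarrow> (nat \<Rightarrow> nat \<Rightarrow> complex) \<Rightarrow> fop" is
  "\<lambda>n m f i j. if i < n \<and> j < m then f i j else 0"
proof -
  fix n m :: nat and f :: "nat \<Rightarrow> nat \<Rightarrow> complex"
  show "\<exists>N. \<forall>i j. N \<le> i \<or> N \<le> j \<longrightarrow> (if i < n \<and> j < m then f i j else 0) = 0"
    by (intro exI[of _ "max n m"]) auto
qed

lemma ent_mko [simp]: "ent (mko n m f) i j = (if i < n \<and> j < m then f i j else 0)"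
  by (simp add: mko.rep_eq)

lemma rect_mko [simp]: "rect n m (mko n m f)"
  by (auto simp: rect_iff)

lemma ent_times_rect: "rect n m A \<Longrightarrow> ent (A * B) i j = (\<Sum>k<m. ent A i k * ent B k j)"
  by (rule ent_times) (auto simp: rect_iff)

lemma ent_times_rect2: "rect m n B \<Longrightarrow> ent (A * B) i j = (\<Sum>k<m. ent A i k * ent B k j)"
  by (rule ent_times) (auto simp: rect_iff)

lemma tr_car: "car n A \<Longrightarrow> tr A = (\<Sum>i<n. Re (ent A i i))"
  by (rule tr_eq) (auto simp: rect_iff)

lemma ex_car: "\<exists>n. car n A"
  using ent_bound[of A] by (auto simp: rect_iff)

lemma ex_car2: "\<exists>n. car n A \<and> car n B"
  using ent_bound2[of A B] by (auto simp: rect_iff)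

text \<open>The Loewner order; as a class instance it admits calculational chains and the library's
  monotonicity rules for sums and scaling.\<close>

instantiation fop :: ordered_real_vector
begin
definition less_eq_fop :: "fop \<Rightarrow> fop \<Rightarrow> bool" where "A \<le> B \<longleftrightarrow> pos (B - A)"
definition less_fop :: "fop \<Rightarrow> fop \<Rightarrow> bool" where "(A::fop) < B \<longleftrightarrow> A \<le> B \<and> \<not> B \<le> A"
instance
proof
  fix A B C :: fop and a b :: real
  show "A < B \<longleftrightarrow> A \<le> B \<and> \<not> B \<le> A" by (rule less_fop_def)
  show "A \<le> A" by (simp add: less_eq_fop_def)
  show "A \<le> B \<Longrightarrow> B \<le> C \<Longrightarrow> A \<le> C"
    unfolding less_eq_fop_def using pos_add[of "C - B" "B - A"] by simp
  show "A \<le> B \<Longrightarrow> B \<le> A \<Longrightarrow> A = B"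
    unfolding less_eq_fop_def using pos_antisym[of "B - A"] by simp
  show "A \<le> B \<Longrightarrow> C + A \<le> C + B" by (simp add: less_eq_fop_def)
  show "A \<le> B \<Longrightarrow> 0 \<le> a \<Longrightarrow> a *\<^sub>R A \<le> a *\<^sub>R B"
    unfolding less_eq_fop_def using pos_scaleR[of "B - A" a] by (simp add: scaleR_diff_right)
  show "a \<le> b \<Longrightarrow> 0 \<le> A \<Longrightarrow> a *\<^sub>R A \<le> b *\<^sub>R A"
    unfolding less_eq_fop_def using pos_scaleR[of A "b - a"] by (simp add: scaleR_diff_left)
qed
end

lemma nonneg_iff_pos [simp]: "0 \<le> A \<longleftrightarrow> pos A" for A :: fop
  by (simp add: less_eq_fop_def)

lemma conj_mono: "A \<le> B \<Longrightarrow> dag C * A * C \<le> dag C * B * C" for A B :: fop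
  unfolding less_eq_fop_def using pos_conj[of "B - A" C] by (simp add: algebra_simps)

lemma conj_mono': "A \<le> B \<Longrightarrow> dag C = C \<Longrightarrow> C * A * C \<le> C * B * C" for A B :: fop
  using conj_mono[of A B C] by simp

lemma tr_pos: assumes "pos A" shows "0 \<le> tr A"
proof -
  obtain n where n: "car n A" using ex_car by blast
  have "0 \<le> inner (idn n) (A * idn n)" using assms by (rule pos_inner)
  also have "inner (idn n) (A * idn n) = tr A" using n by (simp add: inner_fop_def rect_def)
  finally show ?thesis .
qed

lemma tr_mono: "A \<le> B \<Longrightarrow> tr A \<le> tr B"
  using tr_pos[of "B - A"] by (simp add: less_eq_fop_def)

subsection \<open>The spectral theorem\<close>

text \<open>Scalars appear as elements of the 1 by 1 corner, for instance \<open>dag V * V\<close>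
  for a column \<open>V\<close>; being self-adjoint makes such a scalar real.\<close>

lemma herm_one_dim:
  assumes "car 1 X" "dag X = X"
  shows "X = tr X *\<^sub>R idn 1"
proof (rule fop_eqI)
  fix i j
  have "ent X 0 0 = cnj (ent X 0 0)" using assms(2) by (metis ent_dag)
  then have "ent X 0 0 = complex_of_real (Re (ent X 0 0))" by (simp add: complex_eq_iff)
  moreover have "tr X = Re (ent X 0 0)" using assms(1) by (simp add: tr_car)
  ultimately show "ent X i j = ent (tr X *\<^sub>R idn 1) i j"
    using assms(1) by (cases "i = 0"; cases "j = 0") (auto simp: rect_iff Suc_le_eq)
qed

text \<open>The characteristic polynomial of the matrix has a complex root \<open>l\<close>. It is
  real since \<open>l * x\<close> is self-conjugate, where \<open>x\<close> is the positive squared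
  norm of the eigenvector.\<close>

lemma ex_eigenvector:
  assumes A: "car n A" "dag A = A" and n: "0 < n"
  shows "\<exists>V r. rect n 1 V \<and> V \<noteq> 0 \<and> A * V = r *\<^sub>R V"
proof -
  define M where "M = mat n n (\<lambda>(i,j). ent A i j)"
  have M: "M \<in> carrier_mat n n" by (simp add: M_def)
  obtain l where "eigenvalue M l"
    using spectrum_non_empty[OF M n] by (auto simp: spectrum_def)
  then obtain v where v: "v \<in> carrier_vec n" "v \<noteq> 0\<^sub>v n" "M *\<^sub>v v = l \<cdot>\<^sub>v v"
    using M by (auto simp: eigenvalue_def eigenvector_def)
  define V where "V = mko n 1 (\<lambda>i j. v $ i)"
  have V: "rect n 1 V" by (simp add: V_def)
  obtain k where k: "k < n" "v $ k \<noteq> 0"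
    using v by (metis carrier_vecD eq_vecI index_zero_vec(1) index_zero_vec(2))
  have V0: "V \<noteq> 0"
  proof
    assume "V = 0"
    then have "ent V k 0 = 0" by simp
    then show False using k by (simp add: V_def)
  qed
  have AV: "ent (A * V) i j = l * ent V i j" for i j
  proof (cases "i < n \<and> j < 1")
    case True
    have "(M *\<^sub>v v) $ i = (\<Sum>k<n. ent A i k * v $ k)"
      using True v(1) by (simp add: M_def scalar_prod_def lessThan_atLeast0)
    moreover have "ent (A * V) i j = (\<Sum>k<n. ent A i k * v $ k)"
      using True by (simp add: ent_times_rect[OF A(1)] V_def)
    ultimately show ?thesis using True v by (simp add: V_def)
  next
    case False
    moreover have "rect n 1 (A * V)" using A V by (blast intro: rect_mult)
    ultimately show ?thesis using V unfolding rect_iff by (metis mult_zero_right not_less)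
  qed
  define x where "x = ent (dag V * V) 0 0"
  have x: "x = (\<Sum>k<n. complex_of_real ((cmod (ent V k 0))\<^sup>2))"
    unfolding x_def using V
    by (subst ent_times_rect2[of n 1]) (auto simp: mult.commute simp flip: complex_norm_square)
  have lx: "ent (dag V * (A * V)) 0 0 = l * x"
    unfolding x_def using V A
    by (simp add: ent_times_rect2[of n 1] rect_mult AV sum_distrib_left mult.left_commute)
  have "dag (dag V * (A * V)) = dag V * (A * V)" using A by (simp add: mult.assoc)
  then have "cnj (l * x) = l * x" using lx by (metis ent_dag)
  moreover have "cnj x = x" unfolding x by simp
  moreover have "x \<noteq> 0"
  proof -
    have "0 < (cmod (ent V k 0))\<^sup>2" using k by (simp add: V_def)
    also have "\<dots> \<le> (\<Sum>k<n. (cmod (ent V k 0))\<^sup>2)" using k by (intro member_le_sum) auto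
    finally show ?thesis unfolding x by (metis of_real_eq_0_iff of_real_sum order_less_irrefl)
  qed
  ultimately have "cnj l = l" by simp
  then have l: "l = complex_of_real (Re l)" by (simp add: complex_eq_iff)
  have "A * V = Re l *\<^sub>R V" by (rule fop_eqI) (simp add: AV l[symmetric])
  then show ?thesis using V V0 by blast
qed

lemma ex_unit_eigenvector:
  assumes A: "car (Suc n) A" "dag A = A"
  shows "\<exists>V r a. rect (Suc n) 1 V \<and> dag V * V = idn 1 \<and> A * V = r *\<^sub>R V \<and> ent V n 0 = complex_of_real a \<and> a \<le> 0"
proof -
  obtain V r where V: "rect (Suc n) 1 V" "V \<noteq> 0" "A * V = r *\<^sub>R V"
    using ex_eigenvector[OF A] by auto
  define w where "w = ent V n 0"
  \<comment> \<open>A phase (with a positive factor removed by the later normalization) that makes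
    the last entry real and nonpositive, as the Householder construction requires.\<close>
  define c where "c = (if w = 0 then 1 else - cnj w)"
  have c0: "c \<noteq> 0" by (simp add: c_def)
  have cw: "c * w = complex_of_real (- (cmod w)\<^sup>2)"
    by (auto simp: c_def mult.commute simp flip: complex_norm_square)
  define U where "U = mko (Suc n) 1 (\<lambda>i j. c * ent V i j)"
  have U_ent: "ent U i j = c * ent V i j" for i j
    using V(1) by (auto simp: U_def rect_iff)
  have U: "rect (Suc n) 1 U" by (simp add: U_def)
  have U0: "U \<noteq> 0"
  proof
    assume "U = 0"
    then have "c * ent V i j = 0" for i j by (metis U_ent ent_simps(1))
    then have "V = 0" using c0 by (intro fop_eqI) auto
    then show False using V by simp
  qed
  have AU: "A * U = r *\<^sub>R U"
  proof (rule fop_eqI)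
    fix i j
    have "ent (A * U) i j = c * ent (A * V) i j"
      using A by (simp add: ent_times_rect U_ent sum_distrib_left algebra_simps)
    then show "ent (A * U) i j = ent (r *\<^sub>R U) i j" by (simp add: V U_ent)
  qed
  define X where "X = (1 / norm U) *\<^sub>R U"
  have X: "rect (Suc n) 1 X" using U by (simp add: X_def)
  have nX: "norm X = 1" using U0 by (simp add: X_def)
  have "car 1 (dag X * X)" using X by (blast intro: rect_mult)
  then have XX: "dag X * X = tr (dag X * X) *\<^sub>R idn 1" by (rule herm_one_dim) simp
  have "tr (dag X * X) = 1" using nX norm_sq_fop[of X] by simp
  then have "dag X * X = idn 1" using XX by simp
  moreover have "A * X = r *\<^sub>R X" using AU by (simp add: X_def mult.commute)
  moreover have "ent X n 0 = complex_of_real (- (cmod w)\<^sup>2 / norm U)"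
    using cw by (simp add: X_def U_ent w_def)
  moreover have "- (cmod w)\<^sup>2 / norm U \<le> 0" by simp
  ultimately show ?thesis using X by blast
qed

text \<open>The isometry is the restriction of a Householder reflection that maps the last basis vector to \<open>V\<close>;
  the sign condition on the last entry keeps the reflection vector away from zero.\<close>
lemma ex_complement_isometry:
  assumes V: "rect (Suc n) 1 V" "dag V * V = idn 1" "ent V n 0 = complex_of_real a" "a \<le> 0"
  shows "\<exists>J. rect (Suc n) n J \<and> dag J * J = idn n \<and> J * dag J = idn (Suc n) - V * dag V"
proof -
  define e where "e = mko (Suc n) 1 (\<lambda>i j. if i = n then 1 else 0)"
  have e: "rect (Suc n) 1 e" by (simp add: e_def)
  have ee: "dag e * e = idn 1"
    by (intro fop_eqI) (subst ent_times_rect2[OF e], auto simp: e_def)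
  have eed: "idn n = idn (Suc n) - e * dag e"
    by (intro fop_eqI) (subst ent_simps, subst ent_times_rect[OF e], auto simp: e_def)
  have Ve: "dag V * e = a *\<^sub>R idn 1"
    using V by (intro fop_eqI) (subst ent_times_rect2[OF e], auto simp: e_def rect_iff)
  have eV: "dag e * V = a *\<^sub>R idn 1" using Ve by (metis dag_idn dag_mult dag_simps(1) dag_simps(6))
  define W where "W = V - e"
  \<comment> \<open>The squared norm of \<open>W = V - e\<close>, which is \<open>2 - 2 * a\<close>
    and hence positive because \<open>a \<le> 0\<close>.\<close>
  define z where "z = (1 - a) + (1 - a)"
  have z: "z > 0" using V by (simp add: z_def)
  have WW: "dag W * W = z *\<^sub>R idn 1"
  proof -
    have "dag W * W = (dag V * V - dag V * e) - (dag e * V - dag e * e)" by (simp add: W_def algebra_simps)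
    then show ?thesis unfolding V(2) Ve eV ee by (intro fop_eqI) (auto simp: z_def)
  qed
  have We: "dag W * e = (a - 1) *\<^sub>R idn 1"
    by (simp add: W_def algebra_simps Ve ee)
  have W: "rect (Suc n) 1 W" using V e by (simp add: W_def)
  define H where "H = idn (Suc n) - (2 / z) *\<^sub>R (W * dag W)"
  have HdH: "dag H = H" by (simp add: H_def)
  have carWW: "car (Suc n) (W * dag W)" using W by (blast intro: rect_mult)
  have H: "car (Suc n) H" unfolding H_def using carWW by simp
  have WWWW: "(W * dag W) * (W * dag W) = z *\<^sub>R (W * dag W)"
  proof -
    have "(W * dag W) * (W * dag W) = W * (dag W * W) * dag W" by (simp add: mult.assoc)
    then show ?thesis using WW W by (simp add: mult.assoc rectD)
  qed
  have HH: "H * H = idn (Suc n)"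
    unfolding H_def using z rectD(1,2)[OF carWW]
    by (simp add: algebra_simps WWWW[unfolded mult.assoc]) (simp add: scaleR_add_left[symmetric])
  have He: "H * e = V"
  proof -
    have "H * e = e - (2 / z) *\<^sub>R (W * (dag W * e))"
      using e by (simp add: H_def algebra_simps rectD)
    also have "\<dots> = e - ((2 / z) * (a - 1)) *\<^sub>R W" using W by (simp add: We rectD)
    also have "(2 / z) * (a - 1) = -1" using z by (simp add: z_def field_simps)
    finally show ?thesis by (simp add: W_def)
  qed
  have eH: "dag e * H = dag V" using He HdH by (metis dag_mult)
  define J where "J = H * idn n"
  have "idn (Suc n) * idn n = idn n" "idn n * idn (Suc n) = idn n" by (auto intro!: fop_eqI)
  then have J: "rect (Suc n) n J" unfolding J_def rect_def using H by (metis idn_mult_idn mult.assoc rect_def)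
  have "dag J * J = idn n * (H * H) * idn n" by (simp add: J_def HdH mult.assoc)
  also have "\<dots> = idn n" unfolding HH by (auto intro!: fop_eqI)
  finally have JJ: "dag J * J = idn n" .
  have "J * dag J = H * (idn n * idn n) * H" unfolding J_def by (simp add: HdH mult.assoc del: idn_mult_idn)
  also have "\<dots> = H * idn (Suc n) * H - (H * e) * (dag e * H)"
    unfolding idn_mult_idn unfolding eed by (simp add: algebra_simps)
  also have "\<dots> = idn (Suc n) - V * dag V"
    using HH H He eH by (simp add: rectD)
  finally show ?thesis using J JJ by blast
qed

text \<open>There are \<open>n\<close> nonzero orthogonal projections in dimension \<open>n\<close>,
  so each has rank one. Nonzeroness allows the sign of an eigenvalue to be read off from
  positivity.\<close>

definition pvm :: "nat \<Rightarrow> (nat \<Rightarrow> fop) \<Rightarrow> bool" where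
  "pvm n P \<longleftrightarrow> (\<forall>i<n. dag (P i) = P i \<and> car n (P i) \<and> P i \<noteq> 0 \<and> P i * P i = P i) \<and>
     (\<forall>i<n. \<forall>j<n. i \<noteq> j \<longrightarrow> P i * P j = 0) \<and> (\<Sum>i<n. P i) = idn n"

text \<open>Eigenvalues are indexed by the projections and may repeat. Applying a function to an
  operator means composing it with \<open>f\<close>, so sums, products and order become
  pointwise.\<close>

definition fc :: "nat \<Rightarrow> (nat \<Rightarrow> fop) \<Rightarrow> (nat \<Rightarrow> real) \<Rightarrow> fop" where
  "fc n P f = (\<Sum>i<n. f i *\<^sub>R P i)"

text \<open>Split off a unit eigenvector \<open>V\<close> and compress \<open>A\<close> by an
  isometry \<open>J\<close> onto the complement of \<open>V\<close>. The compression lives in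
  dimension \<open>n\<close>, and its spectral projections are carried back by
  \<open>J\<close>.\<close>

theorem spectral_theorem:
  assumes "car n A" "dag A = A"
  shows "\<exists>P f. pvm n P \<and> A = fc n P f"
  using assms
proof (induction n arbitrary: A)
  case 0
  then have "A = 0" by (intro fop_eqI) (simp add: rect_iff)
  moreover have "idn 0 = 0" by (rule fop_eqI) simp
  ultimately show ?case by (simp add: pvm_def fc_def)
next
  case (Suc n)
  obtain V r a where V: "rect (Suc n) 1 V" "dag V * V = idn 1" "A * V = r *\<^sub>R V"
    "ent V n 0 = complex_of_real a" "a \<le> 0"
    using ex_unit_eigenvector[OF Suc.prems] by blast
  obtain J where J: "rect (Suc n) n J" "dag J * J = idn n" "J * dag J = idn (Suc n) - V * dag V"
    using ex_complement_isometry[OF V(1,2,4,5)] by blast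
  have VA: "dag V * A = r *\<^sub>R dag V" using V(3) Suc.prems(2) by (metis dag_mult dag_simps(6))
  have Jd: "rect n (Suc n) (dag J)" using J by simp
  have "car n (dag J * A * J)" using rect_mult[OF rect_mult[OF Jd Suc.prems(1)] J(1)] .
  moreover have "dag (dag J * A * J) = dag J * A * J" using Suc.prems by (simp add: mult.assoc)
  ultimately obtain P f where P: "pvm n P" and f: "dag J * A * J = fc n P f"
    using Suc.IH by blast
  have VVV: "V * (dag V * X) = 0" if "dag V * X = 0" for X using that by simp
  have VJ: "dag V * J = 0"
  proof -
    have "J * dag J * J = J" by (simp add: mult.assoc J(2) rectD[OF J(1)])
    then have "dag V * J = dag V * (J * dag J) * J" by (simp add: mult.assoc)
    also have "dag V * (J * dag J) = dag V * idn (Suc n) - (dag V * V) * dag V"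
      unfolding J(3) by (simp add: right_diff_distrib mult.assoc)
    also have "\<dots> = 0" unfolding V(2) using V(1) rect_intros(6)[OF V(1)] by (simp add: rect_def)
    finally show ?thesis by simp
  qed
  have JV: "dag J * V = 0" using VJ by (metis dag_mult dag_simps(1) dag_simps(2))
  have VV: "car (Suc n) (V * dag V)" using V by (blast intro: rect_mult)
  have VVVV: "V * dag V * (V * dag V) = V * dag V"
  proof -
    have "V * dag V * (V * dag V) = V * (dag V * V) * dag V" by (simp add: mult.assoc)
    then show ?thesis using V by (simp add: rectD mult.assoc)
  qed
  define Q where "Q i = (if i < n then J * P i * dag J else V * dag V)" for i
  define g where "g i = (if i < n then f i else r)" for i
  have pP: "dag (P i) = P i" "car n (P i)" "P i \<noteq> 0" "P i * P i = P i" if "i < n" for i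
    using P that unfolding pvm_def by auto
  have JPJ: "J * P i * dag J * (J * P j * dag J) = J * (P i * P j) * dag J" if "i < n" for i j
  proof -
    have "J * P i * dag J * (J * P j * dag J) = J * (P i * (dag J * J)) * P j * dag J" by (simp add: mult.assoc)
    then show ?thesis unfolding J using pP[OF that] by (simp add: rectD mult.assoc)
  qed
  have JQJ: "dag J * (J * P i * dag J) * J = P i" if "i < n" for i
  proof -
    have "dag J * (J * P i * dag J) * J = (dag J * J) * P i * (dag J * J)" by (simp add: mult.assoc)
    then show ?thesis unfolding J using pP[OF that] by (simp add: rectD)
  qed
  have "pvm (Suc n) Q"
    unfolding pvm_def
  proof (intro conjI allI impI)
    fix i assume i: "i < Suc n"
    show "dag (Q i) = Q i" using pP by (simp add: Q_def mult.assoc)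
    show "car (Suc n) (Q i)"
      using rect_mult[OF rect_mult[OF J(1) pP(2)] Jd] VV by (simp add: Q_def)
    show "Q i \<noteq> 0"
    proof (cases "i < n")
      case True
      then show ?thesis using JQJ[OF True] pP[OF True] by (auto simp: Q_def)
    next
      case False
      have "dag V * (V * dag V) * V = (dag V * V) * (dag V * V)" by (simp add: mult.assoc)
      then have "dag V * (V * dag V) * V = idn 1" unfolding V(2) by simp
      moreover have "idn 1 \<noteq> 0" using tr_idn[of 1] by (metis tr_0 of_nat_1 zero_neq_one)
      ultimately show ?thesis using False by (auto simp: Q_def)
    qed
    show "Q i * Q i = Q i" using JPJ[of i i] pP[of i] VVVV by (simp add: Q_def)
  next
    fix i j assume ij: "i < Suc n" "j < Suc n" "i \<noteq> j"
    have *: "J * P k * dag J * (V * dag V) = 0" "V * dag V * (J * P k * dag J) = 0" for k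
    proof -
      have "J * P k * dag J * (V * dag V) = J * P k * (dag J * V) * dag V" by (simp add: mult.assoc)
      then show "J * P k * dag J * (V * dag V) = 0" using JV by simp
      have "V * dag V * (J * P k * dag J) = V * (dag V * J) * P k * dag J" by (simp add: mult.assoc)
      then show "V * dag V * (J * P k * dag J) = 0" using VJ by simp
    qed
    have "P i * P j = 0" if "i < n" "j < n" using P ij that by (simp add: pvm_def)
    then show "Q i * Q j = 0" using ij * JPJ[of i j] by (auto simp: Q_def less_Suc_eq)
  next
    have "(\<Sum>i<Suc n. Q i) = J * (\<Sum>i<n. P i) * dag J + V * dag V"
      by (simp add: Q_def sum_distrib_left sum_distrib_right)
    also have "(\<Sum>i<n. P i) = idn n" using P by (simp add: pvm_def)
    finally show "(\<Sum>i<Suc n. Q i) = idn (Suc n)" using J by (simp add: rectD)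
  qed
  moreover have "A = fc (Suc n) Q g"
  proof -
    have "fc (Suc n) Q g = J * fc n P f * dag J + r *\<^sub>R (V * dag V)"
      by (simp add: fc_def Q_def g_def sum_distrib_left sum_distrib_right)
    also have "J * fc n P f * dag J = (J * dag J) * A * (J * dag J)"
      unfolding f[symmetric] by (simp add: mult.assoc)
    also have "\<dots> = A - V * (dag V * A) - (A * V) * dag V + (V * (dag V * A)) * (V * dag V)"
      unfolding J using Suc.prems VV by (simp add: algebra_simps rectD)
    also have "\<dots> = A - r *\<^sub>R (V * dag V)"
      unfolding VA V(3) using VVVV by simp
    finally show ?thesis by simp
  qed
  ultimately show ?case by blast
qed

section \<open>Functional calculus\<close>

abbreviation qstate :: "nat \<Rightarrow> fop \<Rightarrow> bool" where
  "qstate d X \<equiv> pos X \<and> car d X \<and> tr X = 1"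

abbreviation subpovm :: "nat \<Rightarrow> 'i set \<Rightarrow> ('i \<Rightarrow> fop) \<Rightarrow> bool" where
  "subpovm d I D \<equiv> (\<forall>i\<in>I. pos (D i) \<and> car d (D i)) \<and> (\<Sum>i\<in>I. D i) \<le> idn d"

lemma fc_mult: assumes "pvm n P" shows "fc n P f * fc n P g = fc n P (\<lambda>i. f i * g i)"
proof -
  have "fc n P f * fc n P g = (\<Sum>i<n. \<Sum>j<n. (f i * g j) *\<^sub>R (P i * P j))"
    by (simp add: fc_def sum_product mult.commute)
  also have "\<dots> = (\<Sum>i<n. \<Sum>j<n. if j = i then (f i * g i) *\<^sub>R P i else 0)"
    by (intro sum.cong refl) (use assms in \<open>auto simp: pvm_def\<close>)
  also have "\<dots> = fc n P (\<lambda>i. f i * g i)" by (simp add: fc_def)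
  finally show ?thesis .
qed

lemma fc_dag: "pvm n P \<Longrightarrow> dag (fc n P f) = fc n P f"
  by (simp add: fc_def pvm_def)

lemma fc_car: "pvm n P \<Longrightarrow> car n (fc n P f)"
  unfolding fc_def by (intro rect_sum rect_intros) (simp add: pvm_def)

lemma fc_pos: assumes "pvm n P" "\<And>i. i < n \<Longrightarrow> 0 \<le> f i" shows "pos (fc n P f)"
proof -
  have "pos (P i)" if "i < n" for i
    using assms(1) that pos_dag_mult[of "P i"] by (simp add: pvm_def)
  then show ?thesis unfolding fc_def using assms(2) by (intro pos_sum pos_scaleR) auto
qed

lemma fc_one: "pvm n P \<Longrightarrow> fc n P (\<lambda>_. 1) = idn n"
  by (simp add: fc_def pvm_def)

lemma fc_diff: "fc n P f - fc n P g = fc n P (\<lambda>i. f i - g i)"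
  by (simp add: fc_def sum_subtractf scaleR_diff_left)

lemma fc_add: "fc n P f + fc n P g = fc n P (\<lambda>i. f i + g i)"
  by (simp add: fc_def sum.distrib scaleR_add_left)

lemma fc_cong: "(\<And>i. i < n \<Longrightarrow> f i = g i) \<Longrightarrow> fc n P f = fc n P g"
  by (simp add: fc_def)

lemma fc_mult_proj: assumes "pvm n P" "i < n" shows "fc n P f * P i = f i *\<^sub>R P i"
proof -
  have "fc n P f * P i = (\<Sum>j<n. if j = i then f i *\<^sub>R P i else 0)"
    unfolding fc_def sum_distrib_right by (intro sum.cong refl) (use assms in \<open>auto simp: pvm_def\<close>)
  then show ?thesis using assms(2) by simp
qed

lemma pos_fcD: assumes "pvm n P" "pos (fc n P f)" "i < n" shows "0 \<le> f i"
proof -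
  have "0 \<le> inner (P i) (fc n P f * P i)" using assms(2) by (rule pos_inner)
  also have "\<dots> = f i * (norm (P i))\<^sup>2"
    using fc_mult_proj[OF assms(1,3)] by (simp add: power2_norm_eq_inner)
  finally show ?thesis using assms(1,3) by (simp add: pvm_def zero_le_mult_iff)
qed

lemma ex_sqrt:
  assumes "pos A" "car n A" shows "\<exists>B. pos B \<and> car n B \<and> B * B = A"
proof -
  obtain P f where P: "pvm n P" "A = fc n P f" using spectral_theorem[OF assms(2) pos_dag[OF assms(1)]] by blast
  then have "0 \<le> f i" if "i < n" for i using pos_fcD assms(1) that by blast
  then have "fc n P (\<lambda>i. sqrt (f i)) * fc n P (\<lambda>i. sqrt (f i)) = A"
    unfolding fc_mult[OF P(1)] P(2) by (intro fc_cong) simp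
  moreover have "pos (fc n P (\<lambda>i. sqrt (f i)))"
    using \<open>\<And>i. i < n \<Longrightarrow> 0 \<le> f i\<close> by (intro fc_pos P(1)) simp
  ultimately show ?thesis using fc_car[OF P(1)] by blast
qed

lemma ex_sqrt_dag: "pos A \<Longrightarrow> \<exists>B. dag B = B \<and> B * B = A"
  using ex_car[of A] ex_sqrt pos_dag by blast

text \<open>With \<open>C * C = B\<close> the trace becomes the quadratic form of \<open>A\<close>
  at \<open>C\<close>.\<close>

lemma tr_mult_pos: assumes "pos A" "pos B" shows "0 \<le> tr (A * B)"
proof -
  obtain C where C: "dag C = C" "C * C = B" using ex_sqrt_dag[OF assms(2)] by blast
  have "tr (A * B) = inner C (A * C)"
    unfolding inner_fop_def C(1) C(2)[symmetric] by (metis mult.assoc tr_comm)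
  then show ?thesis using pos_inner[OF assms(1)] by simp
qed

lemma tr_mult_mono: "pos C \<Longrightarrow> A \<le> B \<Longrightarrow> tr (C * A) \<le> tr (C * B)"
  using tr_mult_pos[of C "B - A"] by (simp add: less_eq_fop_def right_diff_distrib)

lemma tr_mult_mono2: "pos C \<Longrightarrow> A \<le> B \<Longrightarrow> tr (A * C) \<le> tr (B * C)"
  using tr_mult_mono[of C A B] by (simp add: tr_comm)

lemma pos_kernel: assumes "pos A" "inner v (A * v) = 0" shows "A * v = 0"
proof -
  obtain C where C: "dag C = C" "C * C = A" using ex_sqrt_dag[OF assms(1)] by blast
  have "inner (C * v) (C * v) = 0"
    using assms(2) C by (metis inner_mult_left mult.assoc)
  then have "C * v = 0" by simp
  then show ?thesis unfolding C(2)[symmetric] by (simp add: mult.assoc)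
qed

text \<open>If \<open>B - A\<close> had an eigenvector \<open>v\<close> with eigenvalue
  \<open>f i < 0\<close>, then \<open>inner v ((B * B - A * A) * v)\<close> would equal
  \<open>f i\<close> times the sum of the forms of \<open>A\<close> and \<open>B\<close> at
  \<open>v\<close>. Its nonnegativity forces both forms to vanish, so \<open>B - A\<close> has form
  0 at \<open>v\<close>, contradicting \<open>f i < 0\<close>.\<close>

lemma sqrt_mono:
  assumes A: "pos A" and B: "pos B" and le: "A * A \<le> B * B"
  shows "A \<le> B"
proof -
  obtain n where n: "car n (B - A)" using ex_car by blast
  have "dag (B - A) = B - A" using A B by (simp add: pos_dag)
  then obtain P f where P: "pvm n P" "B - A = fc n P f" using spectral_theorem[OF n] by blast
  have "0 \<le> f i" if i: "i < n" for i
  proof (rule ccontr)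
    assume "\<not> 0 \<le> f i"
    then have neg: "f i < 0" by simp
    define v where "v = P i"
    have v0: "v \<noteq> 0" using P(1) i by (simp add: v_def pvm_def)
    have Bv: "B * v = A * v + f i *\<^sub>R v"
      using fc_mult_proj[OF P(1) i, of f] unfolding P(2)[symmetric] v_def by (simp add: algebra_simps)
    have sq: "inner v (C * C * v) = inner (C * v) (C * v)" if "pos C" for C
      using that by (metis inner_mult_left mult.assoc pos_dag)
    have "0 \<le> inner v ((B * B - A * A) * v)"
      using le unfolding less_eq_fop_def by (rule pos_inner)
    also have "\<dots> = inner (B * v) (B * v) - inner (A * v) (A * v)"
      by (simp add: left_diff_distrib inner_diff_right sq[OF A] sq[OF B])
    also have "\<dots> = f i * (inner v (A * v) + inner v (B * v))"
      by (simp add: Bv inner_add_left inner_add_right inner_commute[of "A * v" v] algebra_simps)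
    finally have "inner v (A * v) + inner v (B * v) \<le> 0"
      using neg by (metis mult_neg_pos not_le)
    moreover have "0 \<le> inner v (A * v)" "0 \<le> inner v (B * v)" using A B pos_inner by auto
    ultimately have "inner v (A * v) = 0" "inner v (B * v) = 0" by auto
    then have "f i * inner v v = 0" by (simp add: Bv inner_add_right)
    then show False using neg v0 by simp
  qed
  then show ?thesis unfolding less_eq_fop_def P(2) by (intro fc_pos P(1)) auto
qed

lemma sqrt_unique: "pos A \<Longrightarrow> pos B \<Longrightarrow> A * A = B * B \<Longrightarrow> A = B"
  using sqrt_mono[of A B] sqrt_mono[of B A] by (intro antisym) auto

text \<open>\<open>R\<close> is the square root of \<open>S\<close>, \<open>W\<close> the
  pseudoinverse of \<open>R\<close> and \<open>p\<close> the support projection, so singular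
  \<open>S\<close> is covered.\<close>

lemma ex_ginv_sqrt:
  assumes "pos S" "car n S"
  shows "\<exists>R W p. pos R \<and> pos W \<and> pos p \<and> car n R \<and> car n W \<and> car n p \<and> R * R = S \<and> W * R = p \<and> R * W = p \<and>
     p * p = p \<and> p \<le> idn n \<and> p * R = R \<and> R * p = R \<and> p * W = W \<and> W * p = W"
proof -
  obtain P f where P: "pvm n P" "S = fc n P f" using spectral_theorem[OF assms(2) pos_dag[OF assms(1)]] by blast
  then have f: "0 \<le> f i" if "i < n" for i using pos_fcD assms(1) that by blast
  define R where "R = fc n P (\<lambda>i. sqrt (f i))"
  define W where "W = fc n P (\<lambda>i. if f i = 0 then 0 else 1 / sqrt (f i))"
  define p where "p = fc n P (\<lambda>i. if f i = 0 then 0 else 1)"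
  have "pos R" "pos W" "pos p"
    unfolding R_def W_def p_def using f by (auto intro!: fc_pos P(1))
  moreover have "car n R" "car n W" "car n p"
    unfolding R_def W_def p_def by (auto intro!: fc_car P(1))
  moreover have "R * R = S" unfolding R_def P(2) fc_mult[OF P(1)] using f by (intro fc_cong) auto
  moreover have "W * R = p" "R * W = p" "p * p = p" "p * R = R" "R * p = R" "p * W = W" "W * p = W"
    unfolding R_def W_def p_def fc_mult[OF P(1)] by (auto intro!: fc_cong)
  moreover have "p \<le> idn n" unfolding less_eq_fop_def fc_one[OF P(1), symmetric] p_def fc_diff
    by (intro fc_pos P(1)) auto
  ultimately show ?thesis by blast
qed

text \<open>\<open>H\<close> is the sign of \<open>A\<close>, zero on the kernel, and
  \<open>G\<close> its absolute value; \<open>H\<close> is the test that attains the trace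
  norm.\<close>

lemma ex_sign:
  assumes "dag A = A" "car n A"
  shows "\<exists>H G. dag H = H \<and> car n H \<and> H \<le> idn n \<and> - idn n \<le> H \<and> H * H \<le> idn n \<and> pos G \<and> car n G \<and> G * G = A * A \<and> H * A = G"
proof -
  obtain P f where P: "pvm n P" "A = fc n P f" using spectral_theorem[OF assms(2,1)] by blast
  define H where "H = fc n P (\<lambda>i. sgn (f i))"
  define G where "G = fc n P (\<lambda>i. \<bar>f i\<bar>)"
  have "H \<le> idn n" "H * H \<le> idn n"
    unfolding less_eq_fop_def H_def fc_one[OF P(1), symmetric] fc_mult[OF P(1)] fc_diff
    by (intro fc_pos P(1), simp add: sgn_if)+
  moreover have "- idn n \<le> H"
  proof -
    have "pos (idn n + H)"
      unfolding H_def fc_one[OF P(1), symmetric] fc_add by (intro fc_pos P(1)) (simp add: sgn_if)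
    then show ?thesis by (simp add: less_eq_fop_def add.commute)
  qed
  moreover have "pos G" unfolding G_def by (intro fc_pos P(1)) auto
  moreover have "G * G = A * A" "H * A = G"
    unfolding G_def P(2) H_def fc_mult[OF P(1)] by (auto intro!: fc_cong simp: sgn_if)
  ultimately show ?thesis using fc_car[OF P(1)] fc_dag[OF P(1)] unfolding H_def G_def by blast
qed

text \<open>\<open>X\<close> is the pseudoinverse of the absolute value \<open>R\<close> of
  \<open>M\<close> times \<open>dag M\<close>. It is only a partial isometry, so \<open>M\<close>
  may be singular.\<close>

lemma ex_polar:
  assumes "car n M"
  shows "\<exists>X R. car n X \<and> X * dag X \<le> idn n \<and> pos R \<and> car n R \<and> R * R = dag M * M \<and> X * M = R"
proof -
  have "car n (dag M * M)" using assms by simp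
  then obtain R W p where *: "pos R" "pos W" "car n R" "car n W" "R * R = dag M * M" "W * R = p" "R * W = p"
     "p \<le> idn n" "p * R = R" "p * p = p"
    using ex_ginv_sqrt[OF pos_dag_mult] by blast
  define X where "X = W * dag M"
  have "X * M = W * (R * R)" by (simp add: X_def *(5) mult.assoc)
  also have "\<dots> = (W * R) * R" by (simp add: mult.assoc)
  also have "\<dots> = R" using * by simp
  finally have XM: "X * M = R" .
  have "X * dag X = (W * (dag M * M)) * W" using * by (simp add: X_def mult.assoc pos_dag)
  also have "\<dots> = (W * R) * (R * W)" by (simp add: *(5)[symmetric] mult.assoc)
  also have "\<dots> = p" by (simp add: * )
  finally have "X * dag X \<le> idn n" using * by simp
  moreover have "car n X" using * assms by (simp add: X_def)
  ultimately show ?thesis using XM * by blast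
qed

section \<open>Operator inequalities for effects\<close>

lemma sq_le_self:
  assumes "pos T" "T \<le> idn n" "car n T"
  shows "T * T \<le> T"
proof -
  obtain P f where P: "pvm n P" "T = fc n P f" using spectral_theorem[OF assms(3) pos_dag[OF assms(1)]] by blast
  have f: "0 \<le> f i" if "i < n" for i using pos_fcD assms(1) P that by blast
  have "pos (fc n P (\<lambda>i. 1 - f i))"
    using assms(2) unfolding less_eq_fop_def fc_one[OF P(1), symmetric] P(2) fc_diff .
  then have f': "f i \<le> 1" if "i < n" for i using pos_fcD[OF P(1)] that by force
  show ?thesis unfolding less_eq_fop_def P(2) fc_mult[OF P(1)] fc_diff
    using f f' by (intro fc_pos P(1)) (simp add: mult_left_le)
qed

lemma ex_sqrt_effect:
  assumes "pos E" "E \<le> idn n" "car n E"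
  shows "\<exists>R. pos R \<and> car n R \<and> R * R = E \<and> R \<le> idn n \<and> E \<le> R"
proof -
  obtain R where R: "pos R" "car n R" "R * R = E" using ex_sqrt assms by blast
  have "R \<le> idn n" by (rule sqrt_mono) (use R assms in auto)
  moreover have "E \<le> R" by (rule sqrt_mono) (use R assms sq_le_self in auto)
  ultimately show ?thesis using R by blast
qed

text \<open>The difference of the two sides is the conjugate of \<open>M\<close> by
  \<open>sqrt c *\<^sub>R A - (1 / sqrt c) *\<^sub>R B\<close>.\<close>

lemma par_ineq:
  fixes A B M :: fop
  assumes "pos M" "0 < c"
  shows "dag (A + B) * M * (A + B) \<le> (1 + c) *\<^sub>R (dag A * M * A) + (1 + 1 / c) *\<^sub>R (dag B * M * B)"
proof -
  define C where "C = sqrt c *\<^sub>R A - (1 / sqrt c) *\<^sub>R B"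
  have c: "sqrt c * sqrt c = c" using assms by simp
  have "pos (dag C * M * C)" using assms(1) by (rule pos_conj)
  also have "dag C * M * C = c *\<^sub>R (dag A * M * A) + (1/c) *\<^sub>R (dag B * M * B) - dag A * M * B - dag B * M * A"
    using assms(2) by (simp add: C_def algebra_simps)
  also have "\<dots> = (1 + c) *\<^sub>R (dag A * M * A) + (1 + 1 / c) *\<^sub>R (dag B * M * B) - dag (A + B) * M * (A + B)"
    by (simp add: algebra_simps)
  finally show ?thesis by (simp add: less_eq_fop_def)
qed

text \<open>As \<open>W * (T + Q) * W = p\<close>, the failure operator is
  \<open>(idn n - p) + W * Q * W\<close>. Writing \<open>W = (W - I) + I\<close> and using
  \<open>par_ineq\<close> separates a multiple of \<open>Q\<close> from a term that involves only
  \<open>p\<close> and \<open>R\<close>; that term is controlled by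
  \<open>T \<le> R\<close>.\<close>

lemma hayashi_nagaoka:
  assumes T: "pos T" "T \<le> idn n" "car n T" and Q: "pos Q" "car n Q" and c: "0 < c"
  and W: "pos R" "pos W" "car n R" "car n W" "R * R = T + Q" "W * R = p" "R * W = p" "p \<le> idn n" "p * R = R" "R * p = R" "p * p = p"
  shows "idn n - W * T * W \<le> (1 + c) *\<^sub>R (idn n - T) + (2 + c + 1 / c) *\<^sub>R Q"
proof -
  define S where "S = T + Q"
  have carW: "car n p" using W by (metis car_mult)
  have WSW: "W * S * W = p" 
  proof -
    have "W * S * W = (W * R) * (R * W)" unfolding S_def W(5)[symmetric] by (simp add: mult.assoc)
    then show ?thesis using W by simp
  qed
  \<comment> \<open>Operator monotonicity of the square root:
    \<open>T * T \<le> T \<le> T + Q = R * R\<close>.\<close>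
  have TR: "T \<le> R"
  proof (rule sqrt_mono[OF T(1) W(1)])
    have "T * T \<le> T" using T by (rule sq_le_self)
    also have "T \<le> R * R" unfolding W(5) using Q by (simp add: less_eq_fop_def)
    finally show "T * T \<le> R * R" .
  qed
  define I where "I = idn n"
  have dag: "dag W = W" "dag R = R" "dag I = I" using W pos_dag by (auto simp: I_def)
  have I: "I * W = W" "W * I = W" "I * R = R" "R * I = R" "I * Q = Q" "Q * I = Q" "I * T = T" "T * I = T" "I * p = p" "p * I = p" "I * I = I"
    using W Q T carW by (auto simp: I_def rect_def)
  have "W * Q * W = dag ((W - I) + I) * Q * ((W - I) + I)" by (simp add: dag)
  also have "\<dots> \<le> (1 + c) *\<^sub>R (dag (W - I) * Q * (W - I)) + (1 + 1 / c) *\<^sub>R (dag I * Q * I)"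
    using Q(1) c by (rule par_ineq)
  also have "dag I * Q * I = Q" by (simp add: dag I)
  \<comment> \<open>Enlarging \<open>Q\<close> to the full sum \<open>S\<close> makes the sandwich
    explicit, since \<open>W\<close> inverts the square root of \<open>S\<close> on its
    support.\<close>
  also have "dag (W - I) * Q * (W - I) \<le> dag (W - I) * S * (W - I)"
    by (rule conj_mono) (use T in \<open>simp add: S_def less_eq_fop_def\<close>)
  also have "dag (W - I) * S * (W - I) = p - R - R + R * R"
  proof -
    have WS: "W * S = R" "S * W = R"
    proof -
      have "W * S = (W * R) * R" "S * W = R * (R * W)" unfolding S_def W(5)[symmetric] by (simp_all add: mult.assoc)
      then show "W * S = R" "S * W = R" using W by simp_all
    qed
    have "dag (W - I) * S * (W - I) = W * S * W - W * S * I - I * (S * W) + I * S * I"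
      by (simp add: dag algebra_simps)
    also have "I * S * I = R * R" unfolding W(5) S_def by (simp add: I algebra_simps)
    finally show ?thesis by (simp add: WS I W(7))
  qed
  finally have 1: "W * Q * W \<le> (1 + c) *\<^sub>R (p - R - R + R * R) + (1 + 1 / c) *\<^sub>R Q"
    using c by (simp add: scaleR_left_mono add_right_mono)
  have "idn n - W * T * W = I - p + W * Q * W"
    using WSW by (simp add: S_def I_def algebra_simps)
  also have "\<dots> \<le> (I - p) + ((1 + c) *\<^sub>R (p - R - R + R * R) + (1 + 1 / c) *\<^sub>R Q)"
    using 1 by (rule add_left_mono)
  also have "\<dots> \<le> (1 + c) *\<^sub>R (I - p) + ((1 + c) *\<^sub>R (p - R - R + R * R) + (1 + 1 / c) *\<^sub>R Q)"
  proof -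
    have "1 *\<^sub>R (I - p) \<le> (1 + c) *\<^sub>R (I - p)"
      using W(8) c by (intro scaleR_right_mono) (simp_all add: I_def less_eq_fop_def)
    then show ?thesis by simp
  qed
  also have "\<dots> = (1 + c) *\<^sub>R (I - R - R + R * R) + (1 + 1 / c) *\<^sub>R Q"
    by (simp add: algebra_simps)
  also have "\<dots> \<le> (1 + c) *\<^sub>R (I - T - T + (T + Q)) + (1 + 1 / c) *\<^sub>R Q"
  proof -
    have "I - R - R + R * R \<le> I - T - T + (T + Q)"
      unfolding W(5)[symmetric] by (intro add_right_mono diff_mono TR order_refl)
    then show ?thesis using c by (intro add_right_mono scaleR_left_mono) auto
  qed
  also have "\<dots> = (1 + c) *\<^sub>R (idn n - T) + (2 + c + 1 / c) *\<^sub>R Q"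
    by (simp add: I_def algebra_simps scaleR_2)
  finally show ?thesis .
qed

text \<open>Bounds the failure of "first \<open>E\<close>, then \<open>D\<close>" linearly in the two failures, without the square root of the gentle
  measurement lemma: split \<open>R = 1 + (R - 1)\<close> and use \<open>(1 - R)\<^sup>2 \<le> 1 - R \<le> 1 - E\<close>.\<close>
lemma sequential_effect_ineq:
  assumes E: "pos R" "R * R = E" "R \<le> idn n" "E \<le> R" "car n R" and D: "D \<le> idn n" "pos D" "car n D"
  shows "idn n - R * D * R \<le> 3 *\<^sub>R (idn n - E) + 2 *\<^sub>R (idn n - D)"
proof -
  define I where "I = idn n"
  have I: "I * I = I" "I * R = R" "R * I = R" "I * D = D" "D * I = D" "dag I = I"
    using E D by (auto simp: I_def rect_def)
  have R: "dag R = R" using E pos_dag by blast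
  have ID: "pos (I - D)" using D by (simp add: I_def less_eq_fop_def)
  have IR: "pos (I - R)" "I - R \<le> I" "car n (I - R)" using E by (simp_all add: I_def less_eq_fop_def)
  have "R * (I - D) * R = dag (I + (R - I)) * (I - D) * (I + (R - I))" by (simp add: R)
  also have "\<dots> \<le> (1 + 1) *\<^sub>R (dag I * (I - D) * I) + (1 + 1 / 1) *\<^sub>R (dag (R - I) * (I - D) * (R - I))"
    using ID by (intro par_ineq) auto
  also have "\<dots> = 2 *\<^sub>R (I - D) + 2 *\<^sub>R ((I - R) * (I - D) * (I - R))"
    by (simp add: I R algebra_simps)
  also have "(I - R) * (I - D) * (I - R) \<le> (I - R) * I * (I - R)"
    by (rule conj_mono') (use D in \<open>simp_all add: I R less_eq_fop_def\<close>)
  also have "(I - R) * I * (I - R) = (I - R) * (I - R)" by (simp add: I algebra_simps)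
  also have "\<dots> \<le> I - R" using IR unfolding I_def by (intro sq_le_self) auto
  also have "\<dots> \<le> I - E" using E by (simp add: diff_left_mono)
  finally have "R * (I - D) * R \<le> 2 *\<^sub>R (I - D) + 2 *\<^sub>R (I - E)"
    by (simp add: scaleR_left_mono)
  then have h1: "(I - E) + R * (I - D) * R \<le> (I - E) + (2 *\<^sub>R (I - D) + 2 *\<^sub>R (I - E))" by (rule add_left_mono)
  have h2: "(I - E) + R * (I - D) * R = I - R * D * R" by (simp add: algebra_simps I E(2)[symmetric])
  have h3: "(I - E) + (2 *\<^sub>R (I - D) + 2 *\<^sub>R (I - E)) = 3 *\<^sub>R (I - E) + 2 *\<^sub>R (I - D)"
  proof -
    have "3 *\<^sub>R (I - E) = (1 + 2) *\<^sub>R (I - E)" by simp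
    then show ?thesis by (simp only: scaleR_add_left scaleR_one) (simp add: algebra_simps)
  qed
  show ?thesis using h1 unfolding h2 h3 unfolding I_def .
qed

subsection \<open>Random codebooks\<close>

text \<open>Expectation over codebooks with entries drawn independently from \<open>w\<close>, as a
  finite sum over extensional functions.\<close>

definition expect :: "'i set \<Rightarrow> 'a set \<Rightarrow> ('a \<Rightarrow> real) \<Rightarrow> (('i \<Rightarrow> 'a) \<Rightarrow> real) \<Rightarrow> real" where
  "expect I A w F = (\<Sum>c\<in>PiE I (\<lambda>_. A). (\<Prod>i\<in>I. w (c i)) * F c)"

definition pdf :: "'a set \<Rightarrow> ('a \<Rightarrow> real) \<Rightarrow> bool" where
  "pdf A w \<longleftrightarrow> finite A \<and> (\<forall>a\<in>A. 0 \<le> w a) \<and> (\<Sum>a\<in>A. w a) = 1"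

lemma expect_prod:
  assumes "finite I" "finite A"
  shows "expect I A w (\<lambda>c. \<Prod>i\<in>I. g i (c i)) = (\<Prod>i\<in>I. \<Sum>a\<in>A. w a * g i a)"
  using assms by (simp add: expect_def prod_sum_PiE prod.distrib)

lemma expect_add: "expect I A w (\<lambda>c. F c + G c) = expect I A w F + expect I A w G"
  by (simp add: expect_def distrib_left sum.distrib)

lemma expect_cmult: "expect I A w (\<lambda>c. k * F c) = k * expect I A w F"
  by (simp add: expect_def sum_distrib_left mult.left_commute)

lemma expect_sum: "expect I A w (\<lambda>c. \<Sum>s\<in>S. F s c) = (\<Sum>s\<in>S. expect I A w (F s))"
  unfolding expect_def sum_distrib_left by (rule sum.swap)

lemma expect_cong: "(\<And>c. c \<in> PiE I (\<lambda>_. A) \<Longrightarrow> F c = G c) \<Longrightarrow> expect I A w F = expect I A w G"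
  unfolding expect_def by (intro sum.cong) auto

lemma expect_mono:
  assumes "pdf A w" "\<And>c. c \<in> PiE I (\<lambda>_. A) \<Longrightarrow> F c \<le> G c"
  shows "expect I A w F \<le> expect I A w G"
  unfolding expect_def using assms
  by (intro sum_mono mult_left_mono prod_nonneg) (auto simp: pdf_def PiE_def Pi_def)

lemma expect_const: "finite I \<Longrightarrow> pdf A w \<Longrightarrow> expect I A w (\<lambda>_. k) = k"
  using expect_prod[of I A w "\<lambda>_ _. 1"] expect_cmult[of I A w k "\<lambda>_. 1"] by (simp add: pdf_def)

lemma expect_single:
  assumes "finite I" "pdf A w" "i \<in> I"
  shows "expect I A w (\<lambda>c. h (c i)) = (\<Sum>a\<in>A. w a * h a)"
proof -
  have "expect I A w (\<lambda>c. h (c i)) = expect I A w (\<lambda>c. \<Prod>k\<in>I. if k = i then h (c k) else 1)"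
    using assms by (intro expect_cong) simp
  also have "\<dots> = (\<Prod>k\<in>I. \<Sum>a\<in>A. w a * (if k = i then h a else 1))"
    using assms by (subst expect_prod) (auto simp: pdf_def)
  also have "\<dots> = (\<Prod>k\<in>I. if k = i then \<Sum>a\<in>A. w a * h a else 1)"
    using assms by (intro prod.cong) (auto simp: pdf_def)
  finally show ?thesis using assms by simp
qed

text \<open>Expanding over the value of \<open>c i\<close> by indicators turns the integrand into
  sums of products over \<open>I\<close>, which \<open>expect_prod\<close> factorizes.\<close>

lemma expect_pair:
  assumes "finite I" "pdf A w" "i \<in> I" "j \<in> I" "i \<noteq> j"
  shows "expect I A w (\<lambda>c. h (c i) (c j)) = (\<Sum>a\<in>A. \<Sum>b\<in>A. w a * w b * h a b)"
proof -
  have fin: "finite A" using assms by (simp add: pdf_def)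
  have one: "expect I A w (\<lambda>c. (if c i = a then 1 else 0) * h a (c j)) = w a * (\<Sum>b\<in>A. w b * h a b)" if a: "a \<in> A" for a
  proof -
    have "expect I A w (\<lambda>c. (if c i = a then 1 else 0) * h a (c j))
        = expect I A w (\<lambda>c. \<Prod>k\<in>I. (if k = i then (if c k = a then 1 else 0) else 1) * (if k = j then h a (c k) else 1))"
      using assms by (intro expect_cong) (simp add: prod.distrib)
    also have "\<dots> = (\<Prod>k\<in>I. \<Sum>b\<in>A. w b * ((if k = i then (if b = a then 1 else 0) else 1) * (if k = j then h a b else 1)))"
      using assms fin by (subst expect_prod) auto
    also have "\<dots> = (\<Prod>k\<in>I. (if k = i then w a else 1) * (if k = j then (\<Sum>b\<in>A. w b * h a b) else 1))"
      using assms a fin by (intro prod.cong refl) (auto simp: pdf_def if_distrib[of "\<lambda>x. _ * x"] cong: if_cong)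
    also have "\<dots> = w a * (\<Sum>b\<in>A. w b * h a b)" using assms by (simp add: prod.distrib)
    finally show ?thesis .
  qed
  have "expect I A w (\<lambda>c. h (c i) (c j)) = expect I A w (\<lambda>c. \<Sum>a\<in>A. (if c i = a then 1 else 0) * h a (c j))"
  proof (rule expect_cong)
    fix c assume "c \<in> PiE I (\<lambda>_. A)"
    then have "c i \<in> A" using assms by auto
    then show "h (c i) (c j) = (\<Sum>a\<in>A. (if c i = a then 1 else 0) * h a (c j))"
      using fin by (simp add: if_distrib[of "\<lambda>x. x * _"] cong: if_cong)
  qed
  also have "\<dots> = (\<Sum>a\<in>A. w a * (\<Sum>b\<in>A. w b * h a b))"
    unfolding expect_sum by (intro sum.cong refl one)
  finally show ?thesis by (simp add: sum_distrib_left mult.assoc)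
qed

text \<open>Codebooks may have weight zero. If \<open>F\<close> exceeded \<open>k\<close>
  everywhere, a nonnegative sum would be at most 0, so all weights would vanish, against their total
  being 1.\<close>

lemma expect_exists:
  assumes "finite I" "pdf A w" "expect I A w F \<le> k"
  shows "\<exists>c\<in>PiE I (\<lambda>_. A). F c \<le> k"
proof (rule ccontr)
  assume "\<not> ?thesis"
  then have less: "k < F c" if "c \<in> PiE I (\<lambda>_. A)" for c using that by force
  have fin: "finite (PiE I (\<lambda>_. A))" using assms by (auto simp: pdf_def intro: finite_PiE)
  have wn: "0 \<le> (\<Prod>i\<in>I. w (c i))" if "c \<in> PiE I (\<lambda>_. A)" for c
    using that assms by (intro prod_nonneg) (auto simp: pdf_def)
  have one: "expect I A w (\<lambda>_. 1) = 1" using expect_const assms by blast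
  have "expect I A w (\<lambda>c. F c + (- k) * 1) \<le> 0"
    unfolding expect_add expect_cmult one using assms by simp
  moreover have "0 \<le> (\<Prod>i\<in>I. w (c i)) * (F c + (- k) * 1)" if "c \<in> PiE I (\<lambda>_. A)" for c
    using wn[OF that] less[OF that] by simp
  ultimately have "\<forall>c\<in>PiE I (\<lambda>_. A). (\<Prod>i\<in>I. w (c i)) * (F c + (- k) * 1) = 0"
    unfolding expect_def using fin by (metis (no_types, lifting) order_antisym sum_nonneg sum_nonneg_eq_0_iff)
  then have "\<forall>c\<in>PiE I (\<lambda>_. A). (\<Prod>i\<in>I. w (c i)) = 0" using less by force
  then have "expect I A w (\<lambda>_. 1) = 0" by (simp add: expect_def)
  then show False using one by simp
qed

lemma expect_le_sqrt:
  assumes "finite I" "pdf A w"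
  shows "expect I A w F \<le> sqrt (expect I A w (\<lambda>c. (F c)\<^sup>2))"
proof -
  define m where "m = expect I A w F"
  have "expect I A w (\<lambda>_. 0) \<le> expect I A w (\<lambda>c. (F c - m)\<^sup>2)" by (rule expect_mono[OF assms(2)]) simp
  moreover have "expect I A w (\<lambda>c. (F c - m)\<^sup>2) = expect I A w (\<lambda>c. (F c)\<^sup>2 + ((- 2 * m) * F c + m\<^sup>2))"
    by (intro expect_cong) (simp add: power2_eq_square algebra_simps)
  moreover have "\<dots> = expect I A w (\<lambda>c. (F c)\<^sup>2) - m\<^sup>2"
    unfolding expect_add expect_cmult expect_const[OF assms] m_def[symmetric] by (simp add: power2_eq_square)
  ultimately have "m\<^sup>2 \<le> expect I A w (\<lambda>c. (F c)\<^sup>2)" using expect_const[OF assms, of 0] by simp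
  then show ?thesis unfolding m_def by (rule real_le_rsqrt)
qed

text \<open>The effects \<open>W * T i * W\<close> add up to the support projection only, hence a
  sub-POVM; the deficit is assigned to a message when the code is assembled. The measurement does
  not depend on \<open>k\<close>.\<close>

lemma ex_pretty_good:
  assumes I: "finite I" and T: "\<And>i. i \<in> I \<Longrightarrow> pos (T i)" "\<And>i. i \<in> I \<Longrightarrow> T i \<le> idn d" "\<And>i. i \<in> I \<Longrightarrow> car d (T i)"
  shows "\<exists>D. subpovm d I D \<and>
    (\<forall>i\<in>I. \<forall>k>0. idn d - D i \<le> (1 + k) *\<^sub>R (idn d - T i) + (2 + k + 1 / k) *\<^sub>R (\<Sum>j\<in>I - {i}. T j))"
proof -
  define S where "S = (\<Sum>i\<in>I. T i)"
  have S: "pos S" "car d S" unfolding S_def using T by (auto intro!: pos_sum rect_sum)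
  obtain R W p where W: "pos R" "pos W" "pos p" "car d R" "car d W" "car d p" "R * R = S" "W * R = p" "R * W = p"
     "p * p = p" "p \<le> idn d" "p * R = R" "R * p = R"
    using ex_ginv_sqrt[OF S] by blast
  define D where "D i = W * T i * W" for i
  have "pos (D i)" "car d (D i)" if "i \<in> I" for i
    using T that W by (auto simp: D_def intro!: pos_conj' simp: pos_dag)
  moreover have "(\<Sum>i\<in>I. D i) \<le> idn d"
  proof -
    have "(\<Sum>i\<in>I. D i) = W * S * W" by (simp add: D_def S_def sum_distrib_left sum_distrib_right)
    also have "\<dots> = (W * R) * (R * W)" by (simp add: W(7)[symmetric] mult.assoc)
    finally show ?thesis using W by simp
  qed
  moreover have "idn d - D i \<le> (1 + k) *\<^sub>R (idn d - T i) + (2 + k + 1 / k) *\<^sub>R (\<Sum>j\<in>I - {i}. T j)"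
    if i: "i \<in> I" and k: "k > 0" for i k
    unfolding D_def
  proof (rule hayashi_nagaoka[OF T(1,2,3)[OF i] _ _ k W(1,2,4,5)])
    show "pos (\<Sum>j\<in>I - {i}. T j)" "car d (\<Sum>j\<in>I - {i}. T j)" using T by (auto intro!: pos_sum rect_sum)
    show "R * R = T i + (\<Sum>j\<in>I - {i}. T j)" using W(7) i I by (simp add: S_def sum.remove)
  qed (use W in auto)
  ultimately show ?thesis by blast
qed

text \<open>A competing codeword is independent of the transmitted one, so its test meets the
  average state and contributes at most \<tau>. There are \<open>card I - 1\<close>
  competitors.\<close>

lemma random_coding:
  fixes \<omega> T :: "'a \<Rightarrow> fop" and I :: "'i set"
  assumes I: "finite I" and w: "pdf A w"
    and T: "\<And>a. a \<in> A \<Longrightarrow> pos (T a)" "\<And>a. a \<in> A \<Longrightarrow> T a \<le> idn d" "\<And>a. a \<in> A \<Longrightarrow> car d (T a)"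
    and \<omega>: "\<And>a. a \<in> A \<Longrightarrow> pos (\<omega> a)"
    and miss: "(\<Sum>a\<in>A. w a * tr ((idn d - T a) * \<omega> a)) \<le> \<eta>"
    and cross: "(\<Sum>a\<in>A. w a * tr (T a * (\<Sum>b\<in>A. w b *\<^sub>R \<omega> b))) \<le> \<tau>"
    and k: "0 < k"
  shows "\<exists>D. (\<forall>c\<in>PiE I (\<lambda>_. A). subpovm d I (D c)) \<and>
     (\<forall>i\<in>I. expect I A w (\<lambda>c. tr ((idn d - D c i) * \<omega> (c i))) \<le> (1 + k) * \<eta> + (2 + k + 1 / k) * (real (card I - 1) * \<tau>))"
proof -
  have "\<forall>c\<in>PiE I (\<lambda>_. A). \<exists>D. subpovm d I D \<and>
    (\<forall>i\<in>I. \<forall>k>0. idn d - D i \<le> (1 + k) *\<^sub>R (idn d - T (c i)) + (2 + k + 1 / k) *\<^sub>R (\<Sum>j\<in>I - {i}. T (c j)))"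
    using T by (intro ballI ex_pretty_good[OF I]) (auto simp: PiE_def Pi_def)
  then obtain D where D: "\<forall>c\<in>PiE I (\<lambda>_. A). subpovm d I (D c) \<and>
    (\<forall>i\<in>I. \<forall>k>0. idn d - D c i \<le> (1 + k) *\<^sub>R (idn d - T (c i)) + (2 + k + 1 / k) *\<^sub>R (\<Sum>j\<in>I - {i}. T (c j)))"
    unfolding bchoice_iff by blast
  have fin: "finite A" and w0: "\<And>a. a \<in> A \<Longrightarrow> 0 \<le> w a" using w by (auto simp: pdf_def)
  have "expect I A w (\<lambda>c. tr ((idn d - D c i) * \<omega> (c i))) \<le> (1 + k) * \<eta> + (2 + k + 1 / k) * (real (card I - 1) * \<tau>)"
    if i: "i \<in> I" for i
  proof -
    have pt: "tr ((idn d - D c i) * \<omega> (c i)) \<le> (1 + k) * tr ((idn d - T (c i)) * \<omega> (c i)) +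
        (2 + k + 1 / k) * (\<Sum>j\<in>I - {i}. tr (T (c j) * \<omega> (c i)))" if c: "c \<in> PiE I (\<lambda>_. A)" for c
    proof -
      have "c i \<in> A" using c i by auto
      moreover have "idn d - D c i \<le> (1 + k) *\<^sub>R (idn d - T (c i)) + (2 + k + 1 / k) *\<^sub>R (\<Sum>j\<in>I - {i}. T (c j))"
        using D c i k by blast
      ultimately have "tr ((idn d - D c i) * \<omega> (c i)) \<le> tr (((1 + k) *\<^sub>R (idn d - T (c i)) + (2 + k + 1 / k) *\<^sub>R (\<Sum>j\<in>I - {i}. T (c j))) * \<omega> (c i))"
        by (intro tr_mult_mono2 \<omega>)
      then show ?thesis by (simp add: distrib_right sum_distrib_right)
    qed
    have pair: "expect I A w (\<lambda>c. tr (T (c j) * \<omega> (c i))) \<le> \<tau>" if j: "j \<in> I - {i}" for j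
    proof -
      have "expect I A w (\<lambda>c. tr (T (c j) * \<omega> (c i))) = (\<Sum>a\<in>A. \<Sum>b\<in>A. w a * w b * tr (T a * \<omega> b))"
        using i j expect_pair[OF I w, of j i "\<lambda>a b. tr (T a * \<omega> b)"] by auto
      also have "\<dots> = (\<Sum>a\<in>A. w a * tr (T a * (\<Sum>b\<in>A. w b *\<^sub>R \<omega> b)))"
        by (simp add: sum_distrib_left mult.assoc)
      finally show ?thesis using cross by simp
    qed
    have "expect I A w (\<lambda>c. tr ((idn d - D c i) * \<omega> (c i))) \<le> expect I A w (\<lambda>c. (1 + k) * tr ((idn d - T (c i)) * \<omega> (c i)) +
        (2 + k + 1 / k) * (\<Sum>j\<in>I - {i}. tr (T (c j) * \<omega> (c i))))"
      using pt by (rule expect_mono[OF w])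
    also have "\<dots> = (1 + k) * (\<Sum>a\<in>A. w a * tr ((idn d - T a) * \<omega> a)) +
        (2 + k + 1 / k) * (\<Sum>j\<in>I - {i}. expect I A w (\<lambda>c. tr (T (c j) * \<omega> (c i))))"
      unfolding expect_add expect_cmult expect_sum using expect_single[OF I w i, of "\<lambda>a. tr ((idn d - T a) * \<omega> a)"] by simp
    also have "\<dots> \<le> (1 + k) * \<eta> + (2 + k + 1 / k) * (real (card I - 1) * \<tau>)"
    proof -
      have "(\<Sum>j\<in>I - {i}. expect I A w (\<lambda>c. tr (T (c j) * \<omega> (c i)))) \<le> real (card (I - {i})) * \<tau>"
        using pair by (intro sum_bounded_above)
      also have "card (I - {i}) = card I - 1" using i I by simp
      finally show ?thesis using k miss by (intro add_mono mult_left_mono) auto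
    qed
    finally show ?thesis .
  qed
  then show ?thesis using D by (intro exI[of _ D]) blast
qed

subsection \<open>Trace norm\<close>

text \<open>The trace of the absolute value; the choice is determined because positive square roots
  are unique.\<close>

definition tn :: "fop \<Rightarrow> real" where
  "tn A = tr (SOME R. pos R \<and> R * R = dag A * A)"

lemma tn_eq: assumes "pos R" "R * R = dag A * A" shows "tn A = tr R"
proof -
  have "(SOME R. pos R \<and> R * R = dag A * A) = R"
    by (rule some_equality) (use assms sqrt_unique in auto)
  then show ?thesis by (simp add: tn_def)
qed

lemma tn_sign:
  assumes "dag A = A" "car n A"
  shows "\<exists>H. dag H = H \<and> car n H \<and> H \<le> idn n \<and> - idn n \<le> H \<and> H * H \<le> idn n \<and> tn A = tr (H * A)"
  using ex_sign[OF assms] tn_eq assms(1) by metis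

text \<open>On a spectral projection \<open>P i\<close> the test satisfies
  \<open>\<bar>tr (H * P i)\<bar> \<le> tr (P i)\<close>. Together with \<open>tn_sign\<close> this
  makes the trace norm of a self-adjoint operator a maximum of linear functionals, which yields the
  triangle inequality.\<close>

lemma tn_ge:
  assumes "dag A = A" "car n A" "H \<le> idn n" "- idn n \<le> H"
  shows "tr (H * A) \<le> tn A"
proof -
  obtain P f where P: "pvm n P" "A = fc n P f" using spectral_theorem[OF assms(2,1)] by blast
  have pP: "pos (P i)" "car n (P i)" if "i < n" for i
    using P(1) that pos_dag_mult[of "P i"] by (simp_all add: pvm_def)
  have "tn A = tr (fc n P (\<lambda>i. \<bar>f i\<bar>))"
    by (rule tn_eq) (auto intro!: fc_pos[OF P(1)] fc_cong simp: fc_mult[OF P(1)] assms(1) P(2)[symmetric], simp add: P(2) fc_mult[OF P(1)])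
  also have "\<dots> = (\<Sum>i<n. \<bar>f i\<bar> * tr (P i))" by (simp add: fc_def)
  finally have 1: "tn A = (\<Sum>i<n. \<bar>f i\<bar> * tr (P i))" .
  have "f i * tr (H * P i) \<le> \<bar>f i\<bar> * tr (P i)" if i: "i < n" for i
  proof -
    have "tr (H * P i) \<le> tr (P i)" "- tr (P i) \<le> tr (H * P i)"
      using tr_mult_mono2[OF pP(1)[OF i] assms(3)] tr_mult_mono2[OF pP(1)[OF i] assms(4)] pP(2)[OF i]
      by (simp_all add: rect_def)
    then have "\<bar>tr (H * P i)\<bar> \<le> tr (P i)" by simp
    then have "\<bar>f i\<bar> * \<bar>tr (H * P i)\<bar> \<le> \<bar>f i\<bar> * tr (P i)" by (rule mult_left_mono) simp
    moreover have "f i * tr (H * P i) \<le> \<bar>f i * tr (H * P i)\<bar>" by (rule abs_ge_self)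
    ultimately show ?thesis unfolding abs_mult by linarith
  qed
  then have "(\<Sum>i<n. f i * tr (H * P i)) \<le> tn A" unfolding 1 by (intro sum_mono) auto
  then show ?thesis by (simp add: P(2) fc_def sum_distrib_left)
qed

lemma tn_nonneg: "0 \<le> tn A"
proof -
  obtain n where "car n A" using ex_car by blast
  then have "car n (dag A * A)" by simp
  then obtain R where "pos R" "R * R = dag A * A" using ex_sqrt[OF pos_dag_mult] by blast
  then show ?thesis using tn_eq tr_pos by metis
qed

lemma tn_0 [simp]: "tn 0 = 0"
  using tn_eq[of 0 0] by simp

lemma tn_triangle:
  assumes "dag A = A" "dag B = B" shows "tn (A + B) \<le> tn A + tn B"
proof -
  obtain n where n: "car n A" "car n B" using ex_car2 by blast
  have "dag (A + B) = A + B" using assms by simp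
  then obtain H where H: "H \<le> idn n" "- idn n \<le> H" "tn (A + B) = tr (H * (A + B))"
    using tn_sign[of "A + B" n] n by auto
  show ?thesis
    unfolding H(3) using tn_ge[OF assms(1) n(1) H(1,2)] tn_ge[OF assms(2) n(2) H(1,2)]
    by (simp add: distrib_left)
qed

lemma tn_scaleR: assumes "0 \<le> k" shows "tn (k *\<^sub>R A) = k * tn A"
proof -
  obtain n where "car n A" using ex_car by blast
  then have "car n (dag A * A)" by simp
  then obtain R where R: "pos R" "R * R = dag A * A" using ex_sqrt[OF pos_dag_mult] by blast
  have "tn (k *\<^sub>R A) = tr (k *\<^sub>R R)"
    by (rule tn_eq) (use R assms in \<open>auto\<close>)
  then show ?thesis using tn_eq[OF R] by simp
qed

lemma tn_sum: "(\<And>s. s \<in> S \<Longrightarrow> dag (f s) = f s) \<Longrightarrow> tn (sum f S) \<le> (\<Sum>s\<in>S. tn (f s))"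
proof (induction S rule: infinite_finite_induct)
  case (insert x F)
  have "tn (f x + sum f F) \<le> tn (f x) + tn (sum f F)"
    using insert by (intro tn_triangle) auto
  then show ?case using insert by force
qed auto

subsection \<open>Fidelity versus trace distance\<close>

text \<open>A polar contraction \<open>X\<close> of \<open>A B\<close> replaces the Uhlmann unitary; the loss \<open>g\<close> of \<open>C = B X\<close> against \<open>B\<close> is absorbed by
  \<open>a b + g \<le> sqrt ((a\<^sup>2 + g) (b\<^sup>2 + g))\<close>.\<close>
lemma fuchs_van_de_graaf:
  assumes A: "dag A = A" "car n A" "tr (A * A) = 1" and B: "dag B = B" "car n B" "tr (B * B) = 1"
    and F: "pos R" "R * R = dag (A * B) * (A * B)"
    and H: "dag H = H" "- idn n \<le> H" "H * H \<le> idn n"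
  shows "tr (H * (A * A - B * B)) \<le> 2 * sqrt (1 - (tr R)\<^sup>2)"
proof -
  have "car n (A * B)" using A B by simp
  then obtain X R' where X: "car n X" "X * dag X \<le> idn n" "pos R'" "R' * R' = dag (A * B) * (A * B)" "X * (A * B) = R'"
    using ex_polar by blast
  have RR: "R' = R" by (rule sqrt_unique) (use X F in auto)
  define C where "C = B * X"
  define g where "g = 1 - (norm C)\<^sup>2"
  have AC: "inner A C = tr R"
    unfolding inner_fop_def C_def A(1) using X(5) RR by (metis mult.assoc tr_comm)
  have CC: "C * dag C \<le> B * B"
  proof -
    have "C * dag C = B * (X * dag X) * B" by (simp add: C_def B mult.assoc)
    also have "\<dots> \<le> B * idn n * B" using X(2) B(1) by (rule conj_mono')
    finally show ?thesis using B by (simp add: rectD)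
  qed
  have nC: "(norm C)\<^sup>2 = tr (C * dag C)" by (simp add: norm_sq_fop tr_comm)
  have nA: "(norm A)\<^sup>2 = 1" by (simp add: norm_sq_fop A)
  define G where "G = B * B - C * dag C"
  have G: "pos G" "car n G" using CC B X by (auto simp: G_def less_eq_fop_def C_def)
  have trG: "tr G = g" by (simp add: G_def g_def nC B(3))
  have g0: "0 \<le> g" using tr_pos[OF G(1)] trG by simp
  have contr: "norm (H * (A - C)) \<le> norm (A - C)"
  proof (rule power2_le_imp_le)
    have "car n (A - C)" using A B X by (simp add: C_def)
    then have id: "idn n * (A - C) = A - C" by (simp add: rect_def)
    have "(norm (H * (A - C)))\<^sup>2 = tr (dag (A - C) * (H * H) * (A - C))"
      unfolding norm_sq_fop dag_mult H(1) by (simp only: mult.assoc)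
    also have "\<dots> \<le> tr (dag (A - C) * idn n * (A - C))" by (rule tr_mono, rule conj_mono, rule H(3))
    also have "\<dots> = (norm (A - C))\<^sup>2"
      unfolding norm_sq_fop by (simp only: mult.assoc id)
    finally show "(norm (H * (A - C)))\<^sup>2 \<le> (norm (A - C))\<^sup>2" .
  qed simp
  have "- g \<le> tr (H * G)"
    using tr_mult_mono2[OF G(1) H(2)] G trG by (simp add: rect_def)
  moreover have "tr (H * (A * A - C * dag C)) \<le> norm (A - C) * norm (A + C)"
  proof -
    \<comment> \<open>\<open>C\<close> is not self-adjoint, but the mixed terms of
      \<open>(A - C) * dag (A + C)\<close> cancel under \<open>tr\<close>, which, as a real part, is
      invariant under the adjoint.\<close>
    have "tr (H * (C * A)) = tr (dag (H * (C * A)))" by (rule tr_dag[symmetric])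
    also have "\<dots> = tr (H * (A * dag C))" by (simp add: A H mult.assoc tr_comm[of H])
    finally have "tr (H * (A * A - C * dag C)) = tr (H * ((A - C) * dag (A + C)))"
      by (simp add: A algebra_simps)
    also have "\<dots> = inner (A + C) (H * (A - C))"
      unfolding inner_fop_def by (metis mult.assoc tr_comm)
    also have "\<dots> \<le> norm (A + C) * norm (H * (A - C))" by (rule norm_cauchy_schwarz)
    also have "\<dots> \<le> norm (A + C) * norm (A - C)" using contr by (rule mult_left_mono) simp
    finally show ?thesis by (simp add: mult.commute)
  qed
  ultimately have 1: "tr (H * (A * A - B * B)) \<le> norm (A - C) * norm (A + C) + g"
    by (simp add: G_def algebra_simps)
  define r where "r = tr R"
  have "(norm (A - C))\<^sup>2 = (norm A)\<^sup>2 + (norm C)\<^sup>2 - 2 * inner A C"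
    by (simp add: power2_norm_eq_inner inner_diff_left inner_diff_right inner_commute)
  then have m: "(norm (A - C))\<^sup>2 = 2 - 2 * r - g" by (simp add: nA AC g_def r_def)
  have "(norm (A + C))\<^sup>2 = (norm A)\<^sup>2 + (norm C)\<^sup>2 + 2 * inner A C"
    by (simp add: power2_norm_eq_inner inner_add_left inner_add_right inner_commute)
  then have p: "(norm (A + C))\<^sup>2 = 2 + 2 * r - g" by (simp add: nA AC g_def r_def)
  define a b where "a = norm (A - C)" and "b = norm (A + C)"
  have "(a * b + g)\<^sup>2 \<le> (a\<^sup>2 + g) * (b\<^sup>2 + g)"
  proof -
    have "0 \<le> g * (a - b)\<^sup>2" using g0 by simp
    then show ?thesis by (simp add: power2_eq_square algebra_simps)
  qed
  \<comment> \<open>The deficit \<open>g\<close> cancels: the two factors are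
    \<open>2 - 2 * r\<close> and \<open>2 + 2 * r\<close>.\<close>
  also have "\<dots> = 4 * (1 - r\<^sup>2)" unfolding a_def b_def m p by (simp add: power2_eq_square algebra_simps)
  finally have "a * b + g \<le> sqrt (4 * (1 - r\<^sup>2))" by (rule real_le_rsqrt)
  also have "sqrt (4 * (1 - r\<^sup>2)) = 2 * sqrt (1 - r\<^sup>2)" by (subst real_sqrt_mult) simp
  finally show ?thesis using 1 unfolding a_def b_def r_def by linarith
qed

subsection \<open>Convex splitting\<close>

lemma tr_mult_sums: "tr (s * (sum f I * sum g J)) = (\<Sum>i\<in>I. \<Sum>j\<in>J. tr (s * (f i * g j)))"
  by (subst sum_product) (simp add: sum_distrib_left)

text \<open>Second-moment form of convex splitting: with \<open>v a = w a R (Z a) R\<close> and \<open>R\<^sup>2 = \<sigma>\<close>, Cauchy--Schwarz bounds the trace norm by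
  the Hilbert--Schmidt norm of \<open>Y R\<close>, whose cross terms vanish in expectation, while \<open>(Z a)\<^sup>2 \<le> k Z a\<close> controls the diagonal.\<close>
lemma convex_split:
  fixes I J :: "'i set" and v :: "'a \<Rightarrow> fop"
  assumes I: "finite I" "J \<subseteq> I" "J \<noteq> {}" and w: "pdf A w"
    and \<sigma>: "pos \<sigma>" "car d \<sigma>" "tr \<sigma> \<le> 1"
    and v: "\<And>a. a \<in> A \<Longrightarrow> pos (v a)" "\<And>a. a \<in> A \<Longrightarrow> v a \<le> (k * w a) *\<^sub>R \<sigma>" "(\<Sum>a\<in>A. v a) = \<sigma>"
    and k: "0 < k"
  shows "expect I A w (\<lambda>c. tn ((1 / real (card J)) *\<^sub>R (\<Sum>i\<in>J. (1 / w (c i)) *\<^sub>R v (c i)) - \<sigma>)) \<le> sqrt (k / real (card J))"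
proof -
  obtain R W p where R: "pos R" "pos W" "pos p" "car d R" "car d W" "car d p" "R * R = \<sigma>" "W * R = p" "R * W = p"
     "p * p = p" "p \<le> idn d" "p * R = R" "R * p = R" "p * W = W" "W * p = W"
    using ex_ginv_sqrt[OF \<sigma>(1,2)] by blast
  have dg: "dag R = R" "dag W = W" "dag p = p" "dag \<sigma> = \<sigma>" using R \<sigma> pos_dag by auto
  have w0: "\<And>a. a \<in> A \<Longrightarrow> 0 \<le> w a" and fin: "finite A" using w by (auto simp: pdf_def)
  define u where "u a = (1 / w a) *\<^sub>R v a" for a
  have J: "finite J" using I by (blast intro: finite_subset)
  define N where "N = real (card J)"
  have N: "N > 0" using J I(3) by (simp add: N_def card_gt_0_iff)
  \<comment> \<open>A letter of weight zero has \<open>0 \<le> v a \<le> 0\<close>, so the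
    convention \<open>1 / 0 = 0\<close> in \<open>u\<close> loses nothing.\<close>
  have v0: "v a = 0" if "a \<in> A" "w a = 0" for a
    using v(1,2)[OF that(1)] that(2) by (intro antisym) auto
  have wu: "w a *\<^sub>R u a = v a" if "a \<in> A" for a
    using v0 that by (cases "w a = 0") (simp_all add: u_def)
  have u_pos: "pos (u a)" if "a \<in> A" for a
    using v(1) w0 that by (auto simp: u_def intro!: pos_scaleR)
  have u_le: "u a \<le> k *\<^sub>R \<sigma>" if a: "a \<in> A" for a
  proof (cases "w a = 0")
    case True
    then show ?thesis using k \<sigma> by (auto simp: u_def less_eq_fop_def intro!: pos_scaleR)
  next
    case False
    have "(1 / w a) *\<^sub>R v a \<le> (1 / w a) *\<^sub>R ((k * w a) *\<^sub>R \<sigma>)"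
      using v(2)[OF a] w0[OF a] by (intro scaleR_left_mono) auto
    then show ?thesis using False by (simp add: u_def)
  qed
  \<comment> \<open>Domination by a multiple of \<sigma> confines \<open>u a\<close> to the support
    of \<sigma>, where \<open>W\<close> inverts \<open>R\<close>; hence conjugating
    \<open>Z a\<close> by \<open>R\<close> recovers \<open>u a\<close>.\<close>
  have u_supp: "u a * p = u a" "p * u a = u a" if a: "a \<in> A" for a
  proof -
    have p\<sigma>: "p * \<sigma> = \<sigma>" "\<sigma> * p = \<sigma>"
      using R(7,12,13) by (metis mult.assoc)+
    obtain m where m: "car m (u a)" "car m p" using ex_car2 by blast
    define q where "q = idn m - p"
    have "u a * q = 0"
    proof (rule pos_kernel[OF u_pos[OF a]])
      have "p * q = 0" using m R by (simp add: q_def right_diff_distrib rectD)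
      then have "\<sigma> * q = 0" using p\<sigma>(2) by (metis mult.assoc mult_zero_right)
      then have "inner q ((k *\<^sub>R \<sigma>) * q) = 0" by simp
      moreover have "inner q (u a * q) \<le> inner q ((k *\<^sub>R \<sigma>) * q)"
        using u_le[OF a] pos_inner[of "k *\<^sub>R \<sigma> - u a" q] by (simp add: less_eq_fop_def left_diff_distrib inner_diff_right)
      ultimately show "inner q (u a * q) = 0" using pos_inner[OF u_pos[OF a], of q] k by auto
    qed
    then show 1: "u a * p = u a" using m by (simp add: q_def right_diff_distrib rectD)
    have "dag (u a * p) = dag (u a)" using 1 by simp
    then show "p * u a = u a" using pos_dag[OF u_pos[OF a]] by (simp add: dg)
  qed
  define Z where "Z a = W * u a * W" for a
  have Z: "pos (Z a)" "Z a \<le> k *\<^sub>R p" if "a \<in> A" for a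
  proof -
    show "pos (Z a)" unfolding Z_def using u_pos[OF that] by (rule pos_conj') (rule dg)
    have "Z a \<le> W * (k *\<^sub>R \<sigma>) * W" unfolding Z_def using u_le[OF that] by (rule conj_mono') (rule dg)
    also have "W * (k *\<^sub>R \<sigma>) * W = k *\<^sub>R ((W * R) * (R * W))" unfolding R(7)[symmetric] by (simp add: mult.assoc)
    finally show "Z a \<le> k *\<^sub>R p" using R by simp
  qed
  have RZR: "R * Z a * R = u a" if "a \<in> A" for a
  proof -
    have "R * Z a * R = (R * W) * u a * (W * R)" by (simp add: Z_def mult.assoc)
    then show ?thesis using R u_supp[OF that] by simp
  qed
  have pZ: "p * Z a = Z a" "Z a * p = Z a" for a
    using R(14,15) by (simp_all add: Z_def mult.assoc) (simp add: mult.assoc[symmetric])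
  have carZ: "car d (Z a)" for a
  proof -
    have "idn d * Z a = Z a" "Z a * idn d = Z a"
      using rectD[OF R(5)] by (simp_all add: Z_def mult.assoc)
    then show ?thesis by (simp add: rect_def)
  qed
  \<comment> \<open>Scaled by \<open>1 / k\<close>, the operator \<open>Z a\<close> is an effect,
    and an effect dominates its square.\<close>
  have ZZ: "Z a * Z a \<le> k *\<^sub>R Z a" if a: "a \<in> A" for a
  proof -
    have "(1/k) *\<^sub>R Z a \<le> (1/k) *\<^sub>R (k *\<^sub>R p)" using Z(2)[OF a] k by (intro scaleR_left_mono) auto
    also have "\<dots> \<le> idn d" using R(11) k by simp
    finally have "((1/k) *\<^sub>R Z a) * ((1/k) *\<^sub>R Z a) \<le> (1/k) *\<^sub>R Z a"
      using Z(1)[OF a] carZ k by (intro sq_le_self[of _ d]) auto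
    then have "(k * k) *\<^sub>R (((1/k) *\<^sub>R Z a) * ((1/k) *\<^sub>R Z a)) \<le> (k * k) *\<^sub>R ((1/k) *\<^sub>R Z a)"
      using k by (intro scaleR_left_mono) auto
    then show ?thesis using k by simp
  qed
  have sumZ: "(\<Sum>a\<in>A. w a *\<^sub>R Z a) = p"
  proof -
    have "(\<Sum>a\<in>A. w a *\<^sub>R Z a) = W * (\<Sum>a\<in>A. w a *\<^sub>R u a) * W"
      by (simp add: Z_def sum_distrib_left sum_distrib_right)
    also have "(\<Sum>a\<in>A. w a *\<^sub>R u a) = R * R" using v(3) R(7) by (simp add: wu)
    also have "W * (R * R) * W = (W * R) * (R * W)" by (simp add: mult.assoc)
    finally show ?thesis using R by simp
  qed
  define \<xi> where "\<xi> a = Z a - p" for a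
  have dZ: "dag (Z a) = Z a" if "a \<in> A" for a using Z(1)[OF that] pos_dag by blast
  define Y where "Y c = (1 / N) *\<^sub>R (\<Sum>i\<in>J. \<xi> (c i))" for c :: "'i \<Rightarrow> 'a"
  have sum\<xi>: "(\<Sum>a\<in>A. w a *\<^sub>R \<xi> a) = 0"
    using w sumZ by (simp add: \<xi>_def scaleR_diff_right sum_subtractf pdf_def flip: scaleR_sum_left)
  have pt: "tn ((1 / N) *\<^sub>R (\<Sum>i\<in>J. u (c i)) - \<sigma>) \<le> norm (Y c * R)" if c: "c \<in> PiE I (\<lambda>_. A)" for c
  proof -
    have cA: "c i \<in> A" if "i \<in> J" for i using c that I(2) by auto
    define X where "X = (1 / N) *\<^sub>R (\<Sum>i\<in>J. u (c i)) - \<sigma>"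
    have "R * Y c * R = (1 / N) *\<^sub>R (\<Sum>i\<in>J. R * Z (c i) * R - R * p * R)"
      by (simp add: Y_def \<xi>_def sum_distrib_left sum_distrib_right algebra_simps)
    also have "\<dots> = (1 / N) *\<^sub>R (\<Sum>i\<in>J. u (c i) - \<sigma>)"
      using RZR cA R by simp
    also have "\<dots> = X" using N
      by (simp add: X_def sum_subtractf scaleR_diff_right N_def sum_constant_scaleR)
    finally have X: "X = R * Y c * R" by simp
    have "dag (Y c) = Y c" using dZ cA dg by (simp add: Y_def \<xi>_def)
    then have "dag X = X" by (simp add: X dg mult.assoc)
    moreover have "car d (Y c)" using carZ cA R by (auto simp: Y_def \<xi>_def intro!: rect_sum)
    then have "car d X" using R by (simp add: X)
    ultimately obtain H where H: "dag H = H" "car d H" "H * H \<le> idn d" "tn X = tr (H * X)"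
      using tn_sign by blast
    have "tr (H * X) = inner (R * H) (Y c * R)"
      unfolding X inner_fop_def by (simp add: H(1) dg mult.assoc)
    then have "tn X = inner (R * H) (Y c * R)" using H(4) by simp
    also have "\<dots> \<le> norm (R * H) * norm (Y c * R)" by (rule norm_cauchy_schwarz)
    \<comment> \<open>The squared norm of \<open>R * H\<close> is
      \<open>tr (\<sigma> * (H * H))\<close>, at most the trace of \<sigma>.\<close>
    also have "\<dots> \<le> 1 * norm (Y c * R)"
    proof (intro mult_right_mono)
      have "(norm (R * H))\<^sup>2 = tr (\<sigma> * (H * H))"
        unfolding norm_sq_fop using tr_comm[of H "R * R * H"] by (simp add: H dg mult.assoc flip: R(7))
      also have "\<dots> \<le> tr (\<sigma> * idn d)" using \<sigma>(1) H(3) by (rule tr_mult_mono)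
      also have "\<dots> \<le> 1" using \<sigma> by (simp add: rect_def)
      finally show "norm (R * H) \<le> 1" by (simp add: power2_le_imp_le)
    qed simp
    finally show ?thesis by (simp add: X_def)
  qed
  have sq: "(norm (Y c * R))\<^sup>2 = (1 / N\<^sup>2) * (\<Sum>i\<in>J. \<Sum>j\<in>J. tr (\<sigma> * (\<xi> (c i) * \<xi> (c j))))" if c: "c \<in> PiE I (\<lambda>_. A)" for c
  proof -
    have cA: "c i \<in> A" if "i \<in> J" for i using c that I(2) by auto
    have "dag (Y c) = Y c" using dZ cA dg by (simp add: Y_def \<xi>_def)
    then have "(norm (Y c * R))\<^sup>2 = tr (\<sigma> * (Y c * Y c))"
      unfolding norm_sq_fop R(7)[symmetric] by (simp add: dg mult.assoc tr_comm[of R])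
    also have "\<dots> = (1 / N\<^sup>2) * (\<Sum>i\<in>J. \<Sum>j\<in>J. tr (\<sigma> * (\<xi> (c i) * \<xi> (c j))))"
      by (simp add: Y_def tr_mult_sums power2_eq_square)
    finally show ?thesis .
  qed
  \<comment> \<open>Distinct codewords are independent, and \<xi> has mean zero because the
    \<open>Z a\<close> average to \<open>p\<close>.\<close>
  have offdiag: "expect I A w (\<lambda>c. tr (\<sigma> * (\<xi> (c i) * \<xi> (c j)))) = 0" if "i \<in> I" "j \<in> I" "i \<noteq> j" for i j
  proof -
    have "expect I A w (\<lambda>c. tr (\<sigma> * (\<xi> (c i) * \<xi> (c j)))) = (\<Sum>a\<in>A. \<Sum>b\<in>A. w a * w b * tr (\<sigma> * (\<xi> a * \<xi> b)))"
      using expect_pair[OF I(1) w that, of "\<lambda>a b. tr (\<sigma> * (\<xi> a * \<xi> b))"] .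
    also have "\<dots> = tr (\<sigma> * ((\<Sum>a\<in>A. w a *\<^sub>R \<xi> a) * (\<Sum>b\<in>A. w b *\<^sub>R \<xi> b)))"
      unfolding tr_mult_sums by (simp add: mult.left_commute mult.assoc)
    finally show ?thesis by (simp add: sum\<xi>)
  qed
  have diag: "expect I A w (\<lambda>c. tr (\<sigma> * (\<xi> (c i) * \<xi> (c i)))) \<le> k" if i: "i \<in> I" for i
  proof -
    have "expect I A w (\<lambda>c. tr (\<sigma> * (\<xi> (c i) * \<xi> (c i)))) = (\<Sum>a\<in>A. w a * tr (\<sigma> * (\<xi> a * \<xi> a)))"
      using expect_single[OF I(1) w i, of "\<lambda>a. tr (\<sigma> * (\<xi> a * \<xi> a))"] .
    also have "\<dots> \<le> (\<Sum>a\<in>A. w a * (k * tr (\<sigma> * Z a) - 2 * tr (\<sigma> * Z a) + tr (\<sigma> * p)))"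
    proof (intro sum_mono mult_left_mono w0)
      fix a assume a: "a \<in> A"
      have "\<xi> a * \<xi> a = Z a * Z a - Z a - Z a + p" using pZ R by (simp add: \<xi>_def algebra_simps)
      then have "tr (\<sigma> * (\<xi> a * \<xi> a)) = tr (\<sigma> * (Z a * Z a)) - 2 * tr (\<sigma> * Z a) + tr (\<sigma> * p)"
        by (simp add: right_diff_distrib distrib_left)
      moreover have "tr (\<sigma> * (Z a * Z a)) \<le> tr (\<sigma> * (k *\<^sub>R Z a))"
        using \<sigma>(1) ZZ[OF a] by (rule tr_mult_mono)
      ultimately show "tr (\<sigma> * (\<xi> a * \<xi> a)) \<le> k * tr (\<sigma> * Z a) - 2 * tr (\<sigma> * Z a) + tr (\<sigma> * p)" by simp
    qed
    also have "\<dots> = (k - 2) * tr (\<sigma> * (\<Sum>a\<in>A. w a *\<^sub>R Z a)) + (\<Sum>a\<in>A. w a) * tr (\<sigma> * p)"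
      by (simp add: sum_distrib_left sum_distrib_right sum.distrib sum_subtractf algebra_simps)
    also have "\<dots> = (k - 1) * tr (\<sigma> * p)" using w by (simp add: sumZ pdf_def algebra_simps)
    also have "\<sigma> * p = \<sigma>" using R by (metis mult.assoc)
    also have "(k - 1) * tr \<sigma> \<le> k"
    proof -
      have "k * tr \<sigma> \<le> k * 1" using \<sigma> k by (intro mult_left_mono) auto
      then show ?thesis using tr_pos[OF \<sigma>(1)] by (simp add: algebra_simps)
    qed
    finally show ?thesis .
  qed
  have "expect I A w (\<lambda>c. tn ((1 / N) *\<^sub>R (\<Sum>i\<in>J. u (c i)) - \<sigma>)) \<le> expect I A w (\<lambda>c. norm (Y c * R))"
    using pt by (rule expect_mono[OF w])
  also have "\<dots> \<le> sqrt (expect I A w (\<lambda>c. (norm (Y c * R))\<^sup>2))" by (rule expect_le_sqrt[OF I(1) w])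
  also have "expect I A w (\<lambda>c. (norm (Y c * R))\<^sup>2) = (1 / N\<^sup>2) * (\<Sum>i\<in>J. \<Sum>j\<in>J. expect I A w (\<lambda>c. tr (\<sigma> * (\<xi> (c i) * \<xi> (c j)))))"
  proof -
    have "expect I A w (\<lambda>c. (norm (Y c * R))\<^sup>2) = expect I A w (\<lambda>c. (1 / N\<^sup>2) * (\<Sum>i\<in>J. \<Sum>j\<in>J. tr (\<sigma> * (\<xi> (c i) * \<xi> (c j)))))"
      by (rule expect_cong) (rule sq)
    then show ?thesis unfolding expect_cmult expect_sum .
  qed
  also have "\<dots> \<le> (1 / N\<^sup>2) * (N * k)"
  proof (rule mult_left_mono)
    have "(\<Sum>j\<in>J. expect I A w (\<lambda>c. tr (\<sigma> * (\<xi> (c i) * \<xi> (c j))))) \<le> k" if i: "i \<in> J" for i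
    proof -
      have "(\<Sum>j\<in>J. expect I A w (\<lambda>c. tr (\<sigma> * (\<xi> (c i) * \<xi> (c j))))) = expect I A w (\<lambda>c. tr (\<sigma> * (\<xi> (c i) * \<xi> (c i))))"
        unfolding sum.remove[OF J i] using i offdiag I(2) by (simp, intro sum.neutral) auto
      then show ?thesis using diag[of i] i I(2) by auto
    qed
    then show "(\<Sum>i\<in>J. \<Sum>j\<in>J. expect I A w (\<lambda>c. tr (\<sigma> * (\<xi> (c i) * \<xi> (c j))))) \<le> N * k"
      unfolding N_def by (intro sum_bounded_above)
  qed simp
  also have "(1 / N\<^sup>2) * (N * k) = k / N" using N by (simp add: power2_eq_square)
  finally show ?thesis by (simp add: u_def N_def)
qed

subsection \<open>Matrices as finitary operators\<close>

definition emb :: "complex mat \<Rightarrow> fop" where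
  "emb M = mko (dim_row M) (dim_col M) (\<lambda>i j. M $$ (i,j))"

definition mt :: "nat \<Rightarrow> fop \<Rightarrow> complex mat" where
  "mt n A = mat n n (\<lambda>(i,j). ent A i j)"

lemma ent_emb: "ent (emb M) i j = (if i < dim_row M \<and> j < dim_col M then M $$ (i,j) else 0)"
  by (simp add: emb_def)

lemma rect_emb: "M \<in> carrier_mat n m \<Longrightarrow> rect n m (emb M)"
  by (auto simp: emb_def)

lemma mt_carrier [simp]: "mt n A \<in> carrier_mat n n" "dim_row (mt n A) = n" "dim_col (mt n A) = n"
  by (simp_all add: mt_def)

lemma emb_mt: "car n A \<Longrightarrow> emb (mt n A) = A"
  by (rule fop_eqI) (auto simp: ent_emb mt_def rect_iff)

lemma emb_inj: "A \<in> carrier_mat n m \<Longrightarrow> B \<in> carrier_mat n m \<Longrightarrow> emb A = emb B \<Longrightarrow> A = B"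
proof (rule eq_matI)
  fix i j assume *: "A \<in> carrier_mat n m" "B \<in> carrier_mat n m" "emb A = emb B" "i < dim_row B" "j < dim_col B"
  then have "ent (emb A) i j = ent (emb B) i j" by simp
  then show "A $$ (i,j) = B $$ (i,j)" using *(1,2,4,5) by (simp add: ent_emb)
qed auto

lemma emb_diff: "A \<in> carrier_mat n m \<Longrightarrow> B \<in> carrier_mat n m \<Longrightarrow> emb (A - B) = emb A - emb B"
  by (rule fop_eqI) (auto simp: ent_emb)

lemma emb_mult:
  assumes "A \<in> carrier_mat n k" "B \<in> carrier_mat k m" shows "emb (A * B) = emb A * emb B"
proof (rule fop_eqI)
  fix i j
  have "ent (emb A * emb B) i j = (\<Sum>l<k. ent (emb A) i l * ent (emb B) l j)"
    by (rule ent_times_rect[OF rect_emb[OF assms(1)]])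
  also have "\<dots> = ent (emb (A * B)) i j"
    using assms by (auto simp: ent_emb scalar_prod_def lessThan_atLeast0)
  finally show "ent (emb (A * B)) i j = ent (emb A * emb B) i j" by simp
qed

lemma emb_one: "emb (1\<^sub>m n) = idn n"
  by (rule fop_eqI) (auto simp: ent_emb)

lemma emb_zero: "emb (0\<^sub>m n m) = 0"
  by (rule fop_eqI) (auto simp: ent_emb)

lemma emb_adj: "emb (adj A) = dag (emb A)"
  by (rule fop_eqI) (auto simp: ent_emb adj_def)

lemma adj_carrier: "A \<in> carrier_mat n m \<Longrightarrow> adj A \<in> carrier_mat m n"
  by (auto simp: adj_def)

lemma emb_rsmult: "emb (rsmult c A) = c *\<^sub>R emb A"
  by (rule fop_eqI) (auto simp: ent_emb rsmult_def)

lemma rsmult_carrier: "A \<in> carrier_mat n m \<Longrightarrow> rsmult c A \<in> carrier_mat n m"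
  by (auto simp: rsmult_def)

lemma emb_msum: "(\<And>a. a \<in> S \<Longrightarrow> f a \<in> carrier_mat n m) \<Longrightarrow> emb (msum n m S f) = (\<Sum>a\<in>S. emb (f a))"
proof (rule fop_eqI)
  fix i j assume f: "\<And>a. a \<in> S \<Longrightarrow> f a \<in> carrier_mat n m"
  have "ent (\<Sum>a\<in>S. emb (f a)) i j = (\<Sum>a\<in>S. if i < n \<and> j < m then f a $$ (i,j) else 0)"
    unfolding ent_sum by (intro sum.cong refl) (use f in \<open>fastforce simp: ent_emb\<close>)
  then show "ent (emb (msum n m S f)) i j = ent (\<Sum>a\<in>S. emb (f a)) i j"
    by (auto simp: ent_emb msum_def)
qed

lemma msum_carrier: "msum n m S f \<in> carrier_mat n m"
  by (simp add: msum_def)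

lemma Re_mtrace: "M \<in> carrier_mat n n \<Longrightarrow> Re (mtrace M) = tr (emb M)"
  by (simp add: tr_car[OF rect_emb] mtrace_def ent_emb)

text \<open>States are normalized by a complex trace while \<open>tr\<close> takes a real part; for
  positive operators the two agree.\<close>

lemma pos_trace_complex:
  assumes "pos A" "car n A" shows "(\<Sum>k<n. ent A k k) = complex_of_real (tr A)"
proof -
  have "ent A k k = complex_of_real (Re (ent A k k))" for k
  proof -
    have "ent A k k = cnj (ent A k k)" using pos_dag[OF assms(1)] by (metis ent_dag)
    then show ?thesis by (simp add: complex_eq_iff)
  qed
  then show ?thesis by (simp add: tr_car[OF assms(2)])
qed

lemma quadratic_form_emb:
  assumes "M \<in> carrier_mat n n"
  shows "ent (dag V * (emb M * V)) c c =
    (\<Sum>i<n. cnj (vec n (\<lambda>i. ent V i c) $ i) * (M *\<^sub>v vec n (\<lambda>i. ent V i c)) $ i)"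
proof -
  have *: "ent (emb M * V) i c = (M *\<^sub>v vec n (\<lambda>i. ent V i c)) $ i" if "i < n" for i
    using assms that
    by (simp add: ent_times_rect[OF rect_emb] ent_emb scalar_prod_def lessThan_atLeast0)
  have "rect n k (emb M * V)" if "rect k k V" for k
    using assms that by (intro rect_mult rect_emb)
  then have z: "ent (emb M * V) i c = 0" if "n \<le> i" for i
    using ex_car[of V] that by (auto simp: rect_iff)
  have "ent (dag V * (emb M * V)) c c = (\<Sum>i<n. cnj (ent V i c) * ent (emb M * V) i c)"
    by (subst ent_times[of n]) (simp_all add: z)
  then show ?thesis using * by simp
qed

text \<open>The matrix notion demands real nonnegative forms on vectors but no symmetry.
  Self-adjointness follows by polarization on combinations of two basis vectors; afterwards the
  operator form is a sum over columns.\<close>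

lemma emb_pos_iff:
  assumes M: "M \<in> carrier_mat n n"
  shows "psd M \<longleftrightarrow> pos (emb M)"
proof
  assume psd: "psd M"
  have q: "\<exists>r\<ge>0. ent (dag V * (emb M * V)) c c = complex_of_real r" for V c
  proof -
    have "\<forall>v\<in>carrier_vec n. \<exists>r\<ge>0. (\<Sum>i<n. cnj (v $ i) * (M *\<^sub>v v) $ i) = complex_of_real r"
      using psd M unfolding psd_def by auto
    then show ?thesis unfolding quadratic_form_emb[OF M] by (rule bspec) (rule vec_carrier)
  qed
  have herm: "ent (emb M) i j = cnj (ent (emb M) j i)" for i j
  proof -
    define col where "col k z = mko (Suc k) 1 (\<lambda>r c. if r = k then z else 0)" for k :: nat and z :: complex
    have col: "ent (dag (col k z) * (emb M * col l y)) 0 0 = cnj z * ent (emb M) k l * y" for k l z y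
    proof -
      have r: "rect (Suc k) 1 (col k z)" "rect (Suc l) 1 (col l y)" by (simp_all add: col_def)
      have "ent (emb M * col l y) r 0 = ent (emb M) r l * y" for r
        by (subst ent_times_rect2[OF r(2)]) (simp add: col_def)
      then show ?thesis
        by (subst ent_times_rect[OF rect_intros(6)[OF r(1)]]) (simp, simp add: col_def)
    qed
    have im: "Im (ent (dag V * (emb M * V)) 0 0) = 0" for V using q[of V 0] by auto
    have 1: "Im (cnj z * ent (emb M) j i + z * ent (emb M) i j) = 0" for z
    proof -
      have "dag (col i 1 + col j z) * (emb M * (col i 1 + col j z)) =
         dag (col i 1) * (emb M * col i 1) + dag (col j z) * (emb M * col j z) +
         (dag (col j z) * (emb M * col i 1) + dag (col i 1) * (emb M * col j z))"
        by (simp add: algebra_simps)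
      then have "Im (ent (dag (col j z) * (emb M * col i 1)) 0 0 + ent (dag (col i 1) * (emb M * col j z)) 0 0) = 0"
        using im[of "col i 1 + col j z"] im[of "col i 1"] im[of "col j z"] by simp
      then show ?thesis by (simp add: col mult.commute)
    qed
    \<comment> \<open>Coefficient 1 compares the imaginary parts of the two entries, coefficient
      \<i> the real parts.\<close>
    show ?thesis using 1[of 1] 1[of \<i>] by (simp add: complex_eq_iff)
  qed
  show "pos (emb M)"
    unfolding pos_def
  proof (intro conjI allI)
    show "dag (emb M) = emb M" by (rule fop_eqI) (metis ent_dag herm)
    fix V
    have "0 \<le> Re (ent (dag V * (emb M * V)) c c)" for c using q[of V c] by auto
    then show "0 \<le> inner V (emb M * V)" unfolding inner_fop_def tr_def by (intro sum_nonneg)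
  qed
next
  assume pos: "pos (emb M)"
  show "psd M"
    unfolding psd_def
  proof (intro conjI ballI)
    show "square_mat M" using M by simp
    fix v :: "complex Matrix.vec" assume v: "v \<in> carrier_vec (dim_row M)"
    define V where "V = mko n 1 (\<lambda>i j. v $ i)"
    have V: "rect n 1 V" by (simp add: V_def)
    have eq: "vec n (\<lambda>i. ent V i 0) = v" using v M by (intro eq_vecI) (auto simp: V_def)
    have "car 1 (dag V * (emb M * V))" using V M by (intro rect_mult[of _ n _ n] rect_intros rect_mult[of n n _ n] rect_emb)
    moreover have "dag (dag V * (emb M * V)) = dag V * (emb M * V)"
      using pos_dag[OF pos] by (simp add: mult.assoc)
    ultimately have "dag V * (emb M * V) = tr (dag V * (emb M * V)) *\<^sub>R idn 1" by (rule herm_one_dim)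
    then have "ent (dag V * (emb M * V)) 0 0 = ent (tr (dag V * (emb M * V)) *\<^sub>R idn 1) 0 0" by simp
    also have "\<dots> = complex_of_real (inner V (emb M * V))" by (simp add: inner_fop_def)
    finally show "\<exists>r\<ge>0. (\<Sum>i<dim_row M. cnj (v $ i) * (M *\<^sub>v v) $ i) = complex_of_real r"
      unfolding quadratic_form_emb[OF M] eq using pos_inner[OF pos, of V] M by auto
  qed
qed

lemma mle_iff:
  assumes "A \<in> carrier_mat n n" "B \<in> carrier_mat n n"
  shows "mle A B \<longleftrightarrow> emb A \<le> emb B"
  using assms emb_pos_iff[OF minus_carrier_mat[OF assms(1)], of B] by (auto simp: mle_def less_eq_fop_def emb_diff)

section \<open>Square roots, trace norm and purified distance of matrices\<close>

lemma psd_carrier: "psd M \<Longrightarrow> M \<in> carrier_mat (dim_row M) (dim_row M)"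
  by (auto simp: psd_def square_mat.simps)

text \<open>Existence from the spectral theorem and uniqueness from \<open>sqrt_unique\<close> show
  that the definite description denotes the intended root.\<close>

lemma msqrt:
  assumes A: "A \<in> carrier_mat n n" "psd A"
  shows "psd (msqrt A)" "msqrt A \<in> carrier_mat n n" "msqrt A * msqrt A = A"
proof -
  obtain B where B: "pos B" "car n B" "B * B = emb A"
    using ex_sqrt[of "emb A" n] assms emb_pos_iff rect_emb by blast
  have "\<exists>!B. psd B \<and> dim_row B = dim_row A \<and> B * B = A"
  proof (rule ex1I[of _ "mt n B"])
    have "mt n B * mt n B = A"
      by (rule emb_inj[of _ n n]) (use A B in \<open>auto simp: emb_mult[of _ n n _ n] emb_mt\<close>)
    then show "psd (mt n B) \<and> dim_row (mt n B) = dim_row A \<and> mt n B * mt n B = A"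
      using A B emb_pos_iff[of "mt n B" n] by (simp add: emb_mt)
    fix C assume C: "psd C \<and> dim_row C = dim_row A \<and> C * C = A"
    then have Cc: "C \<in> carrier_mat n n" using psd_carrier[of C] A by simp
    have "emb C = B"
    proof (rule sqrt_unique)
      show "pos (emb C)" using C Cc emb_pos_iff by blast
      show "emb C * emb C = B * B" using C Cc B by (simp flip: emb_mult)
    qed (fact B)
    then show "C = mt n B" using B Cc by (intro emb_inj[of _ n n]) (auto simp: emb_mt)
  qed
  from theI'[OF this] have *: "psd (msqrt A)" "dim_row (msqrt A) = dim_row A" "msqrt A * msqrt A = A"
    unfolding msqrt_def by auto
  then show "psd (msqrt A)" "msqrt A * msqrt A = A" by auto
  show "msqrt A \<in> carrier_mat n n" using psd_carrier[OF *(1)] *(2) A by simp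
qed

lemma emb_msqrt:
  assumes A: "A \<in> carrier_mat n n" "psd A"
  shows "pos (emb (msqrt A))" "car n (emb (msqrt A))" "emb (msqrt A) * emb (msqrt A) = emb A"
  using msqrt[OF A] emb_pos_iff rect_emb emb_mult[of "msqrt A" n n "msqrt A" n] by auto

lemma tnorm_eq: assumes M: "M \<in> carrier_mat n n" shows "tnorm M = tn (emb M)"
proof -
  have c: "adj M * M \<in> carrier_mat n n" using adj_carrier[OF M] M by (rule mult_carrier_mat)
  have e: "emb (adj M * M) = dag (emb M) * emb M"
    using M emb_mult[of "adj M" n n M n] by (simp add: emb_adj adj_carrier)
  have p: "psd (adj M * M)" using c e emb_pos_iff pos_dag_mult by metis
  have "tnorm M = tr (emb (msqrt (adj M * M)))"
    unfolding tnorm_def by (rule Re_mtrace) (rule msqrt[OF c p])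
  also have "\<dots> = tn (emb M)"
    by (rule tn_eq[symmetric]) (use emb_msqrt[OF c p] e in auto)
  finally show ?thesis .
qed

lemma is_state_iff:
  "is_state d \<rho> \<longleftrightarrow> \<rho> \<in> carrier_mat d d \<and> pos (emb \<rho>) \<and> tr (emb \<rho>) = 1"
proof (cases "\<rho> \<in> carrier_mat d d \<and> psd \<rho>")
  case True
  then have "pos (emb \<rho>)" using emb_pos_iff by blast
  moreover have "mtrace \<rho> = (\<Sum>k<d. ent (emb \<rho>) k k)" using True by (auto simp: mtrace_def ent_emb)
  ultimately have "mtrace \<rho> = complex_of_real (tr (emb \<rho>))"
    using pos_trace_complex[of "emb \<rho>" d] rect_emb True by auto
  then show ?thesis using True \<open>pos (emb \<rho>)\<close> by (simp add: is_state_def)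
next
  case False
  then show ?thesis using emb_pos_iff by (auto simp: is_state_def)
qed

text \<open>Stated for a test \<open>H\<close> instead of the trace norm because the privacy
  argument applies it to a block-diagonal sign operator.\<close>

lemma pdist_tr_bound:
  assumes "is_state d \<rho>'" "is_state d \<rho>" "pdist \<rho>' \<rho> \<le> \<eta>"
    and H: "dag H = H" "- idn d \<le> H" "H * H \<le> idn d"
  shows "tr (H * (emb \<rho>' - emb \<rho>)) \<le> 2 * \<eta>"
proof -
  have c: "\<rho>' \<in> carrier_mat d d" "psd \<rho>'" "\<rho> \<in> carrier_mat d d" "psd \<rho>" using assms by (auto simp: is_state_def)
  define A B where "A = emb (msqrt \<rho>')" and "B = emb (msqrt \<rho>)"
  note mA = emb_msqrt[OF c(1,2)] and mB = emb_msqrt[OF c(3,4)]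
  have "car d (dag (A * B) * (A * B))" using mA mB unfolding A_def B_def by (intro car_mult rect_intros)
  then obtain R where R: "pos R" "R * R = dag (A * B) * (A * B)" using ex_sqrt[OF pos_dag_mult] by blast
  have "fidelity \<rho>' \<rho> = tn (A * B)"
    unfolding fidelity_def A_def B_def
    using msqrt[OF c(1,2)] msqrt[OF c(3,4)] by (simp add: tnorm_eq[of _ d] emb_mult[of _ d d _ d])
  also have "\<dots> = tr R" using R by (rule tn_eq)
  finally have F: "pdist \<rho>' \<rho> = sqrt (1 - (tr R)\<^sup>2)" by (simp add: pdist_def)
  have "tr (H * (A * A - B * B)) \<le> 2 * sqrt (1 - (tr R)\<^sup>2)"
    by (rule fuchs_van_de_graaf[of A d B])
      (use mA mB assms R H in \<open>auto simp: A_def B_def pos_dag is_state_iff\<close>)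
  then show ?thesis using F assms mA mB by (simp add: A_def B_def)
qed

text \<open>Makes diagonal matrices an instance of the functional calculus, so that classical
  fidelities reduce to sums.\<close>

lemma pvm_unit: "pvm n (\<lambda>x. mko n n (\<lambda>i j. if i = x \<and> j = x then 1 else 0))"
  unfolding pvm_def
proof (intro conjI allI impI)
  fix x assume x: "x < n"
  let ?E = "\<lambda>x. mko n n (\<lambda>i j. if i = x \<and> j = x then 1 else 0)"
  show "dag (?E x) = ?E x" by (rule fop_eqI) auto
  show "car n (?E x)" by simp
  have "ent (?E x) x x = 1" using x by simp
  then show "?E x \<noteq> 0" by (metis ent_simps(1) zero_neq_one)
  have "?E x * ?E y = (if x = y then ?E x else 0)" for y
    using x by (intro fop_eqI) (subst ent_times_rect[OF rect_mko], auto simp: if_distrib[of "\<lambda>x. x * _"] cong: if_cong)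
  then show "?E x * ?E x = ?E x" "\<And>y. x \<noteq> y \<Longrightarrow> ?E x * ?E y = 0" by simp_all
next
  show "(\<Sum>x<n. mko n n (\<lambda>i j. if i = x \<and> j = x then 1 else 0)) = idn n"
  proof (rule fop_eqI)
    fix i j
    have "ent (\<Sum>x<n. mko n n (\<lambda>i j. if i = x \<and> j = x then 1 else 0)) i j
        = (\<Sum>x<n. if x = i then (if i = j \<and> i < n then 1 else 0) else 0)"
      unfolding ent_sum by (intro sum.cong) auto
    then show "ent (\<Sum>x<n. mko n n (\<lambda>i j. if i = x \<and> j = x then 1 else 0)) i j = ent (idn n) i j" by simp
  qed
qed

lemma emb_diagm: "emb (diagm n f) = fc n (\<lambda>x. mko n n (\<lambda>i j. if i = x \<and> j = x then 1 else 0)) f"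
  by (rule fop_eqI) (auto simp: ent_emb diagm_def fc_def if_distrib[of "\<lambda>x. _ * x"] cong: if_cong)

lemma diagm_carrier [simp]: "diagm n f \<in> carrier_mat n n" "dim_row (diagm n f) = n" "dim_col (diagm n f) = n"
  by (simp_all add: diagm_def)

lemma tr_diagm: "tr (emb (diagm n f)) = (\<Sum>i<n. f i)"
  by (simp add: tr_car[OF rect_emb[OF diagm_carrier(1)]] ent_emb) (simp add: diagm_def)

lemma emb_msqrt_diagm:
  assumes "\<And>i. i < n \<Longrightarrow> 0 \<le> f i" shows "emb (msqrt (diagm n f)) = emb (diagm n (\<lambda>i. sqrt (f i)))"
proof (rule sqrt_unique)
  have "psd (diagm n f)"
    using emb_pos_iff[OF diagm_carrier(1)] fc_pos[OF pvm_unit assms] by (simp add: emb_diagm)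
  note m = emb_msqrt[OF diagm_carrier(1) this]
  show "pos (emb (msqrt (diagm n f)))" by (fact m)
  show "pos (emb (diagm n (\<lambda>i. sqrt (f i))))" using fc_pos[OF pvm_unit] assms by (simp add: emb_diagm)
  show "emb (msqrt (diagm n f)) * emb (msqrt (diagm n f)) = emb (diagm n (\<lambda>i. sqrt (f i))) * emb (diagm n (\<lambda>i. sqrt (f i)))"
    unfolding m emb_diagm fc_mult[OF pvm_unit] using assms by (intro fc_cong) simp
qed

lemma fidelity_diagm:
  assumes "\<And>i. i < n \<Longrightarrow> 0 \<le> f i" "\<And>i. i < n \<Longrightarrow> 0 \<le> g i"
  shows "fidelity (diagm n f) (diagm n g) = (\<Sum>i<n. sqrt (f i) * sqrt (g i))"
proof -
  have psd: "psd (diagm n h)" if "\<And>i. i < n \<Longrightarrow> 0 \<le> h i" for h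
    using emb_pos_iff[OF diagm_carrier(1)] fc_pos[OF pvm_unit that] by (simp add: emb_diagm)
  have p: "psd (diagm n f)" "psd (diagm n g)" by (rule psd, rule assms, assumption)+
  have "fidelity (diagm n f) (diagm n g) = tn (emb (diagm n (\<lambda>i. sqrt (f i))) * emb (diagm n (\<lambda>i. sqrt (g i))))"
    unfolding fidelity_def
    using msqrt[OF diagm_carrier(1) p(1)] msqrt[OF diagm_carrier(1) p(2)]
    by (simp add: tnorm_eq[of _ n] emb_mult[of _ n n _ n] emb_msqrt_diagm assms)
  also have "\<dots> = tn (emb (diagm n (\<lambda>i. sqrt (f i) * sqrt (g i))))"
    unfolding emb_diagm fc_mult[OF pvm_unit] ..
  also have "\<dots> = tr (emb (diagm n (\<lambda>i. sqrt (f i) * sqrt (g i))))"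
    unfolding emb_diagm by (rule tn_eq) (use assms in \<open>auto intro!: fc_pos[OF pvm_unit] simp: fc_dag[OF pvm_unit]\<close>)
  finally show ?thesis by (simp add: tr_diagm)
qed

text \<open>The fidelity only sees the support \<open>S\<close> of \<open>q\<close>. By
  Cauchy-Schwarz its square is at most the \<open>p\<close>-mass of \<open>S\<close>, so the mass
  outside is at most \<open>1 - F\<^sup>2\<close>.\<close>

lemma pdist_diagm_support:
  assumes q: "is_dist n q" and p: "\<And>i. i < n \<Longrightarrow> 0 \<le> p i" "(\<Sum>i<n. p i) = 1"
    and d: "pdist (diagm n q) (diagm n p) \<le> \<eta>" and "0 \<le> \<eta>"
  shows "(\<Sum>i | i < n \<and> \<not> 0 < q i. p i) \<le> \<eta>\<^sup>2"
proof -
  have q0: "0 \<le> q i" if "i < n" for i using q that by (simp add: is_dist_def)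
  define S where "S = {i. i < n \<and> 0 < q i}"
  define F where "F = fidelity (diagm n q) (diagm n p)"
  have "F = (\<Sum>i<n. sqrt (q i) * sqrt (p i))"
    unfolding F_def by (rule fidelity_diagm) (use q0 p in auto)
  also have "\<dots> = (\<Sum>i\<in>S. sqrt (q i) * sqrt (p i))"
    by (rule sum.mono_neutral_right) (use q0 in \<open>force simp: S_def\<close>)+
  finally have "F\<^sup>2 = (\<Sum>i\<in>S. sqrt (q i) * sqrt (p i))\<^sup>2" by simp
  also have "\<dots> \<le> (\<Sum>i\<in>S. (sqrt (q i))\<^sup>2) * (\<Sum>i\<in>S. (sqrt (p i))\<^sup>2)"
    by (rule Cauchy_Schwarz_ineq_sum)
  also have "(\<Sum>i\<in>S. (sqrt (q i))\<^sup>2) = (\<Sum>i\<in>S. q i)"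
    by (intro sum.cong) (auto simp: S_def)
  also have "(\<Sum>i\<in>S. (sqrt (p i))\<^sup>2) = (\<Sum>i\<in>S. p i)"
    by (intro sum.cong) (use p in \<open>auto simp: S_def\<close>)
  also have "(\<Sum>i\<in>S. q i) = (\<Sum>i<n. q i)"
    by (rule sum.mono_neutral_left) (use q0 in \<open>force simp: S_def\<close>)+
  also have "\<dots> = 1" using q by (simp add: is_dist_def)
  finally have 1: "F\<^sup>2 \<le> (\<Sum>i\<in>S. p i)" by simp
  have "1 - F\<^sup>2 \<le> \<eta>\<^sup>2"
    using d unfolding pdist_def F_def[symmetric] by (rule sqrt_le_D)
  moreover have "(\<Sum>i<n. p i) = (\<Sum>i\<in>S. p i) + (\<Sum>i | i < n \<and> \<not> 0 < q i. p i)"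
    by (subst sum.union_disjoint[symmetric]) (auto simp: S_def intro: sum.cong)
  ultimately show ?thesis using 1 p by simp
qed

lemma pdist_diagm_refl: "is_dist n p \<Longrightarrow> pdist (diagm n p) (diagm n p) = 0"
  by (simp add: pdist_def fidelity_diagm is_dist_def)

subsection \<open>Block structure of classical-quantum operators\<close>

text \<open>\<open>slot d y\<close> and \<open>cslot n d k\<close> are the isometries fixing the first, respectively second, tensor factor to a basis vector,
  for the index convention \<open>(i1, i2) \<mapsto> i1 * d + i2\<close> of \<open>kron\<close>.\<close>
definition slot :: "nat \<Rightarrow> nat \<Rightarrow> fop" where
  "slot d y = mko (Suc y * d) d (\<lambda>i j. if i = y * d + j then 1 else 0)"

lemma ent_slot: "ent (slot d y) i j = (if j < d \<and> i = y * d + j then 1 else 0)"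
  by (auto simp: slot_def)

lemma rect_slot: assumes "y < n" shows "rect (n * d) d (slot d y)"
proof -
  have "y * d + j < n * d" if "j < d" for j
  proof -
    have "y * d + j < Suc y * d" using that by simp
    also have "\<dots> \<le> n * d" using assms by (intro mult_le_mono1) simp
    finally show ?thesis .
  qed
  then show ?thesis by (force simp: rect_iff ent_slot)
qed

lemma ent_mult_slot: "ent (M * slot d y) i j = (if j < d then ent M i (y * d + j) else 0)"
proof -
  have "ent (M * slot d y) i j = (\<Sum>k<Suc y * d. ent M i k * ent (slot d y) k j)"
    by (rule ent_times) (auto simp: ent_slot)
  also have "\<dots> = (\<Sum>k<Suc y * d. if k = y * d + j then (if j < d then ent M i (y * d + j) else 0) else 0)"
    by (intro sum.cong) (auto simp: ent_slot)
  finally show ?thesis by (simp only: sum.delta finite_lessThan) auto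
qed

lemma ent_dag_slot_mult: "ent (dag (slot d y) * M) i j = (if i < d then ent M (y * d + i) j else 0)"
  using ent_mult_slot[of "dag M" d y j i] by (metis complex_cnj_cnj complex_cnj_zero dag_mult dag_simps(1) ent_dag)

lemma ent_slot_mult:
  assumes "rect d m X"
  shows "ent (slot d y * X) i j = (if 0 < d \<and> i div d = y then ent X (i mod d) j else 0)"
proof -
  have *: "(k < d \<and> i = y * d + k) \<longleftrightarrow> (0 < d \<and> i div d = y \<and> k = i mod d)" for k by auto
  have "ent (slot d y * X) i j = (\<Sum>k<d. ent (slot d y) i k * ent X k j)"
    using assms by (rule ent_times_rect2)
  also have "\<dots> = (\<Sum>k<d. if k = i mod d then (if 0 < d \<and> i div d = y then ent X (i mod d) j else 0) else 0)"
    by (intro sum.cong) (auto simp: ent_slot * )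
  finally show ?thesis by simp
qed

lemma ent_slot_conj:
  assumes "car d X"
  shows "ent (slot d y * X * dag (slot d z)) i j = (if 0 < d \<and> i div d = y \<and> j div d = z then ent X (i mod d) (j mod d) else 0)"
proof -
  have r: "rect d (Suc z * d) (X * dag (slot d z))" by (rule rect_mult[OF assms rect_intros(6)[OF rect_slot[OF lessI]]])
  have "ent (X * dag (slot d z)) k j = cnj (ent (slot d z * dag X) j k)" for k by (metis dag_mult dag_simps(1) ent_dag)
  then show ?thesis
    using assms by (simp add: mult.assoc ent_slot_mult[OF r] ent_slot_mult[of d d])
qed

lemma slot_slot: "dag (slot d y) * slot d z = (if y = z then idn d else 0)"
proof (rule fop_eqI)
  fix i j
  have "z * d + j = y * d + i \<longleftrightarrow> z = y \<and> j = i" if "i < d" "j < d"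
  proof
    assume *: "z * d + j = y * d + i"
    have "(z * d + j) div d = z" "(y * d + i) div d = y" using that by auto
    then show "z = y \<and> j = i" using * by auto
  qed simp
  then show "ent (dag (slot d y) * slot d z) i j = ent (if y = z then idn d else 0) i j"
    by (auto simp: ent_mult_slot ent_slot)
qed

lemma slot_slot_left: "dag (slot d y) * (slot d z * X) = (if y = z then idn d * X else 0)"
  by (simp add: slot_slot flip: mult.assoc)

lemma sum_slot: "(\<Sum>y<n. slot d y * dag (slot d y)) = idn (n * d)"
proof (cases "d = 0")
  case True
  then show ?thesis by (intro fop_eqI) (simp add: ent_mult_slot ent_slot_mult[of 0 "Suc y * 0" "dag (slot 0 y)" for y] rect_iff ent_slot)
next
  case False
  show ?thesis
  proof (rule fop_eqI)
    fix i j
    have "ent (\<Sum>y<n. slot d y * dag (slot d y)) i j = (\<Sum>y<n. ent (slot d y * idn d * dag (slot d y)) i j)"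
      by (simp add: rectD[OF rect_slot[OF lessI]])
    also have "\<dots> = (\<Sum>y<n. if y = i div d then (if i = j then 1 else 0) else 0)"
    proof (intro sum.cong refl)
      fix y
      have "i = j" if "i div d = j div d" "i mod d = j mod d" using that by (metis div_mult_mod_eq)
      then show "ent (slot d y * idn d * dag (slot d y)) i j = (if y = i div d then (if i = j then 1 else 0) else 0)"
        using False by (simp add: ent_slot_conj)
    qed
    also have "\<dots> = ent (idn (n * d)) i j"
      using False by (simp add: div_less_iff_less_mult)
    finally show "ent (\<Sum>y<n. slot d y * dag (slot d y)) i j = ent (idn (n * d)) i j" .
  qed
qed

definition cslot :: "nat \<Rightarrow> nat \<Rightarrow> nat \<Rightarrow> fop" where
  "cslot n d k = mko (n * d) n (\<lambda>i j. if i = j * d + k then 1 else 0)"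

lemma mult_add_less: "j < n \<Longrightarrow> k < d \<Longrightarrow> j * d + k < n * (d::nat)"
proof -
  assume "j < n" "k < d"
  then have "j * d + k < Suc j * d" by simp
  also have "\<dots> \<le> n * d" using \<open>j < n\<close> by (intro mult_le_mono1) simp
  finally show ?thesis .
qed

lemma ent_cslot: "k < d \<Longrightarrow> ent (cslot n d k) i j = (if j < n \<and> i = j * d + k then 1 else 0)"
  using mult_add_less by (auto simp: cslot_def)

lemma rect_cslot: "rect (n * d) n (cslot n d k)"
  by (simp add: cslot_def)

lemma ent_mult_cslot: assumes k: "k < d" shows "ent (M * cslot n d k) i j = (if j < n then ent M i (j * d + k) else 0)"
proof -
  have "ent (M * cslot n d k) i j = (\<Sum>l<n * d. ent M i l * ent (cslot n d k) l j)"
    by (rule ent_times_rect2[OF rect_cslot])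
  also have "\<dots> = (\<Sum>l<n * d. if l = j * d + k then (if j < n then ent M i (j * d + k) else 0) else 0)"
    by (intro sum.cong) (auto simp: ent_cslot k)
  finally show ?thesis using mult_add_less[OF _ k] by simp
qed

lemma sum_cslot: "(\<Sum>k<d. cslot n d k * dag (cslot n d k)) = idn (n * d)"
proof (rule fop_eqI)
  fix i j
  have e: "ent (cslot n d k * dag (cslot n d k)) i j = (if i mod d = k then (if i = j \<and> i < n * d then 1 else 0) else 0)"
    if k: "k < d" for k
  proof -
    have "ent (cslot n d k * dag (cslot n d k)) i j = (\<Sum>l<n. ent (cslot n d k) i l * ent (dag (cslot n d k)) l j)"
      by (rule ent_times_rect[OF rect_cslot])
    also have "\<dots> = (\<Sum>l<n. if l = i div d then (if i mod d = k \<and> i = j then 1 else 0) else 0)"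
      by (intro sum.cong) (use k in \<open>auto simp: ent_cslot\<close>)
    also have "\<dots> = (if i mod d = k then (if i = j \<and> i < n * d then 1 else 0) else 0)"
      using k by (auto simp: div_less_iff_less_mult)
    finally show ?thesis .
  qed
  have "ent (\<Sum>k<d. cslot n d k * dag (cslot n d k)) i j = (\<Sum>k<d. if k = i mod d then (if i = j \<and> i < n * d then 1 else 0) else 0)"
    unfolding ent_sum by (intro sum.cong) (auto simp: e)
  also have "\<dots> = ent (idn (n * d)) i j"
    by (cases "d = 0") auto
  finally show "ent (\<Sum>k<d. cslot n d k * dag (cslot n d k)) i j = ent (idn (n * d)) i j" .
qed

lemma ptr_carrier [simp]: "ptr1 n d M \<in> carrier_mat d d" "ptr2 n d M \<in> carrier_mat n n"
  by (simp_all add: ptr1_def ptr2_def)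

lemma emb_ptr1: assumes "M \<in> carrier_mat (n * d) (n * d)"
  shows "emb (ptr1 n d M) = (\<Sum>k<n. dag (slot d k) * emb M * slot d k)"
  by (rule fop_eqI) (use assms mult_add_less in \<open>auto simp: ent_emb ptr1_def ent_mult_slot ent_dag_slot_mult intro!: sum.cong\<close>)

lemma emb_ptr2: assumes "M \<in> carrier_mat (n * d) (n * d)"
  shows "emb (ptr2 n d M) = (\<Sum>k<d. dag (cslot n d k) * emb M * cslot n d k)"
proof (rule fop_eqI)
  fix i j
  have "ent (dag (cslot n d k) * X) i j = (if i < n then ent X (i * d + k) j else 0)" if "k < d" for k X i j
    using ent_mult_cslot[OF that, of "dag X" n j i] by (metis complex_cnj_cnj complex_cnj_zero dag_mult dag_simps(1) ent_dag)
  then have "ent (\<Sum>k<d. dag (cslot n d k) * emb M * cslot n d k) i j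
      = (\<Sum>k<d. if i < n \<and> j < n then ent (emb M) (i * d + k) (j * d + k) else 0)"
    unfolding ent_sum by (intro sum.cong) (auto simp: ent_mult_cslot)
  then show "ent (emb (ptr2 n d M)) i j = ent (\<Sum>k<d. dag (cslot n d k) * emb M * cslot n d k) i j"
    using assms mult_add_less by (auto simp: ent_emb ptr2_def intro!: sum.cong)
qed

lemma kron_carrier: "A \<in> carrier_mat n n \<Longrightarrow> B \<in> carrier_mat d d \<Longrightarrow> kron A B \<in> carrier_mat (n * d) (n * d)"
  by (simp add: kron_def)

lemma ent_kron:
  assumes "A \<in> carrier_mat n n" "B \<in> carrier_mat d d"
  shows "ent (emb (kron A B)) i j = (if 0 < d then ent (emb A) (i div d) (j div d) * ent (emb B) (i mod d) (j mod d) else 0)"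
  using assms by (auto simp: ent_emb kron_def div_less_iff_less_mult)

lemma emb_kron_proj:
  assumes "\<omega> \<in> carrier_mat d d" "x < n"
  shows "emb (kron (proj n x) \<omega>) = slot d x * emb \<omega> * dag (slot d x)"
proof (rule fop_eqI)
  have p: "proj n x \<in> carrier_mat n n" by (simp add: proj_def)
  have e: "ent (emb (proj n x)) a b = (if a = x \<and> b = x then 1 else 0)" for a b
    using assms(2) by (auto simp: ent_emb proj_def)
  fix i j
  show "ent (emb (kron (proj n x) \<omega>)) i j = ent (slot d x * emb \<omega> * dag (slot d x)) i j"
    unfolding ent_kron[OF p assms(1)] ent_slot_conj[OF rect_emb[OF assms(1)]]
    by (auto simp: e)
qed

text \<open>The block-diagonal operator of a classical-quantum state. Weights and blocks are
  unrestricted, so it also describes tests, with all weights 1.\<close>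

definition cqs :: "nat \<Rightarrow> nat \<Rightarrow> (nat \<Rightarrow> real) \<Rightarrow> (nat \<Rightarrow> fop) \<Rightarrow> fop" where
  "cqs d n w \<omega> = (\<Sum>x<n. w x *\<^sub>R (slot d x * \<omega> x * dag (slot d x)))"

lemma emb_kron_diagm:
  assumes "\<sigma> \<in> carrier_mat d d"
  shows "emb (kron (diagm n w) \<sigma>) = cqs d n w (\<lambda>_. emb \<sigma>)"
proof (rule fop_eqI)
  have e: "ent (emb (diagm n w)) a b = (if a = b \<and> a < n then complex_of_real (w a) else 0)" for a b
    by (auto simp: ent_emb diagm_def)
  fix i j
  have "ent (cqs d n w (\<lambda>_. emb \<sigma>)) i j = (\<Sum>x<n. if x = i div d then (if 0 < d \<and> i div d = j div d then complex_of_real (w (i div d)) * ent (emb \<sigma>) (i mod d) (j mod d) else 0) else 0)"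
    unfolding cqs_def ent_sum
    by (intro sum.cong refl) (auto simp: ent_slot_conj[OF rect_emb[OF assms]])
  also have "\<dots> = ent (emb (kron (diagm n w) \<sigma>)) i j"
    unfolding ent_kron[OF diagm_carrier(1) assms] by (auto simp: e)
  finally show "ent (emb (kron (diagm n w) \<sigma>)) i j = ent (cqs d n w (\<lambda>_. emb \<sigma>)) i j" by simp
qed

lemma cqs_block:
  assumes "\<And>x. x < n \<Longrightarrow> car d (\<omega> x)" "y < n" "z < n"
  shows "dag (slot d y) * cqs d n w \<omega> * slot d z = (if y = z then w y *\<^sub>R \<omega> y else 0)"
proof -
  have "dag (slot d y) * cqs d n w \<omega> * slot d z = (\<Sum>x<n. if x = y then (if y = z then w y *\<^sub>R \<omega> y else 0) else 0)"
    unfolding cqs_def sum_distrib_left sum_distrib_right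
  proof (intro sum.cong refl)
    fix x assume "x \<in> {..<n}"
    then have "idn d * \<omega> x = \<omega> x" "\<omega> x * idn d = \<omega> x" using assms(1)[of x] by (simp_all add: rect_def)
    then show "dag (slot d y) * (w x *\<^sub>R (slot d x * \<omega> x * dag (slot d x))) * slot d z
        = (if x = y then (if y = z then w y *\<^sub>R \<omega> y else 0) else 0)"
      by (auto simp: mult.assoc slot_slot slot_slot_left)
  qed
  then show ?thesis using assms(2) by simp
qed

text \<open>Only the diagonal blocks of \<open>T\<close> matter, so a joint test amounts to one test
  for each classical letter.\<close>

lemma tr_cqs: "tr (T * cqs d n w \<omega>) = (\<Sum>x<n. w x * tr ((dag (slot d x) * T * slot d x) * \<omega> x))"
proof -
  have "tr (T * (slot d x * \<omega> x * dag (slot d x))) = tr ((dag (slot d x) * T * slot d x) * \<omega> x)" for x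
    by (metis mult.assoc tr_comm)
  then show ?thesis by (simp add: cqs_def sum_distrib_left)
qed

lemma ptr1_cqs:
  assumes "\<rho> \<in> carrier_mat (n * d) (n * d)" "emb \<rho> = cqs d n w \<omega>" "\<And>x. x < n \<Longrightarrow> car d (\<omega> x)"
  shows "emb (ptr1 n d \<rho>) = (\<Sum>x<n. w x *\<^sub>R \<omega> x)"
  unfolding emb_ptr1[OF assms(1)] assms(2) using cqs_block[of n d \<omega>] assms(3) by simp

lemma ptr2_cqs:
  assumes "\<rho> \<in> carrier_mat (n * d) (n * d)" "emb \<rho> = cqs d n w \<omega>"
    and "\<And>x. x < n \<Longrightarrow> car d (\<omega> x)" "\<And>x. x < n \<Longrightarrow> pos (\<omega> x)" "\<And>x. x < n \<Longrightarrow> tr (\<omega> x) = 1"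
  shows "ptr2 n d \<rho> = diagm n w"
proof (rule eq_matI)
  fix x y assume "x < dim_row (diagm n w)" "y < dim_col (diagm n w)"
  then have xy: "x < n" "y < n" by simp_all
  have "ptr2 n d \<rho> $$ (x, y) = (\<Sum>k<d. ent (dag (slot d x) * emb \<rho> * slot d y) k k)"
    using xy assms(1) mult_add_less by (auto simp: ptr2_def ent_mult_slot ent_dag_slot_mult ent_emb intro!: sum.cong)
  also have "\<dots> = (if x = y then complex_of_real (w x) * (\<Sum>k<d. ent (\<omega> x) k k) else 0)"
    using cqs_block[of n d \<omega> x y w] assms(2,3) xy by (simp add: sum_distrib_left)
  also have "\<dots> = diagm n w $$ (x, y)"
    using xy assms(5)[OF xy(1)] pos_trace_complex[OF assms(4,3)[OF xy(1)]] by (cases "x = y") (auto simp: diagm_def)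
  finally show "ptr2 n d \<rho> $$ (x, y) = diagm n w $$ (x, y)" .
qed (simp_all add: ptr2_def)

lemma slot_conj_effect:
  assumes "T \<le> idn (n * d)" "y < n" shows "dag (slot d y) * T * slot d y \<le> idn d"
proof -
  have "dag (slot d y) * T * slot d y \<le> dag (slot d y) * idn (n * d) * slot d y"
    using assms(1) by (rule conj_mono)
  also have "\<dots> = idn d" by (simp add: mult.assoc rectD(1)[OF rect_slot[OF assms(2)]] slot_slot)
  finally show ?thesis .
qed

lemma car_slot_conj: "car d (dag (slot d y) * T * slot d y)"
  by (auto simp: rect_iff ent_mult_slot) (simp add: ent_dag_slot_mult mult.assoc)

subsection \<open>Random coding from the hypothesis-testing divergence\<close>

text \<open>\<open>IH\<close> positive excludes the junk case in which the infimum is 0 and \<open>log 2 0 = 0\<close>. The infimum need not be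
  attained, whence the slack \<open>\<kappa>\<close>.\<close>
lemma IH_test:
  assumes \<rho>: "\<rho> \<in> carrier_mat (n * d) (n * d)" "emb \<rho> = cqs d n w \<omega>"
    and \<omega>: "\<And>x. x < n \<Longrightarrow> car d (\<omega> x)" "\<And>x. x < n \<Longrightarrow> pos (\<omega> x)" "\<And>x. x < n \<Longrightarrow> tr (\<omega> x) = 1"
    and w: "pdf {..<n} w" and \<eta>: "0 \<le> \<eta>"
    and IH: "0 < IH \<eta> n d \<rho>" and \<kappa>: "0 < \<kappa>"
  shows "\<exists>T. (\<forall>x<n. pos (T x) \<and> T x \<le> idn d \<and> car d (T x)) \<and>
    (\<Sum>x<n. w x * tr ((idn d - T x) * \<omega> x)) \<le> \<eta> \<and>
    (\<Sum>x<n. w x * tr (T x * (\<Sum>y<n. w y *\<^sub>R \<omega> y))) \<le> 2 powr (- IH \<eta> n d \<rho>) + \<kappa>"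
proof -
  define \<sigma> where "\<sigma> = kron (ptr2 n d \<rho>) (ptr1 n d \<rho>)"
  define \<tau> where "\<tau> = (\<Sum>y<n. w y *\<^sub>R \<omega> y)"
  have w0: "0 \<le> w x" if "x < n" for x using w that by (simp add: pdf_def)
  have \<sigma>c: "\<sigma> \<in> carrier_mat (n * d) (n * d)" unfolding \<sigma>_def by (rule kron_carrier) simp_all
  have \<sigma>e: "emb \<sigma> = cqs d n w (\<lambda>_. \<tau>)"
  proof -
    have "ptr2 n d \<rho> = diagm n w" by (rule ptr2_cqs[OF \<rho>]) (use \<omega> in auto)
    moreover have "emb (ptr1 n d \<rho>) = \<tau>" unfolding \<tau>_def by (rule ptr1_cqs[OF \<rho>]) (use \<omega> in auto)
    ultimately show ?thesis by (simp add: \<sigma>_def emb_kron_diagm[OF ptr_carrier(1)])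
  qed
  have \<tau>p: "pos \<tau>" unfolding \<tau>_def using w0 \<omega> by (auto intro!: pos_sum pos_scaleR)
  have \<sigma>p: "pos (emb \<sigma>)" unfolding \<sigma>e cqs_def
    using w0 pos_conj[OF \<tau>p, of "dag (slot d x)" for x] by (auto intro!: pos_sum pos_scaleR)
  define S where "S = {Re (mtrace (T * \<sigma>)) | T.
      T \<in> carrier_mat (n * d) (n * d) \<and> mle (0\<^sub>m (n * d) (n * d)) T \<and> mle T (1\<^sub>m (n * d)) \<and>
      Re (mtrace ((1\<^sub>m (n * d) - T) * \<rho>)) \<le> \<eta>}"
  have IHS: "IH \<eta> n d \<rho> = - log 2 (Inf S)"
    using \<rho> unfolding IH_def DH_def S_def \<sigma>_def by (auto simp: carrier_matD)
  have trT: "Re (mtrace (T * M)) = tr (emb T * emb M)" if "T \<in> carrier_mat (n*d) (n*d)" "M \<in> carrier_mat (n*d) (n*d)" for T M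
    using Re_mtrace[of "T * M" "n * d"] that by (simp add: emb_mult[OF that])
  have S0: "0 \<le> s" if "s \<in> S" for s
    using that \<sigma>c \<sigma>p by (auto simp: S_def trT mle_iff[of _ "n * d"] emb_zero intro!: tr_mult_pos)
  have md: "Re (mtrace ((1\<^sub>m (n * d) - T) * \<rho>)) = tr ((idn (n * d) - emb T) * emb \<rho>)"
    if "T \<in> carrier_mat (n*d) (n*d)" for T
    unfolding trT[OF minus_carrier_mat[OF that] \<rho>(1)] emb_diff[OF one_carrier_mat that] emb_one ..
  \<comment> \<open>The trivial test is feasible since \<open>0 \<le> \<eta>\<close>, so the infimum
    ranges over a nonempty set.\<close>
  have "Re (mtrace (1\<^sub>m (n * d) * \<sigma>)) \<in> S" unfolding S_def
    using \<eta> by (auto simp: mle_iff[of _ "n * d"] emb_zero emb_one md intro!: exI[of _ "1\<^sub>m (n * d)"])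
  then have ne: "S \<noteq> {}" by auto
  have "0 \<le> Inf S" using S0 ne by (intro cInf_greatest) auto
  moreover have "Inf S \<noteq> 0" using IH unfolding IHS by (auto simp: log_def)
  ultimately have pos: "0 < Inf S" by simp
  have "2 powr (- IH \<eta> n d \<rho>) = Inf S" unfolding IHS using pos by simp
  moreover have "\<exists>s\<in>S. s < Inf S + \<kappa>" using \<kappa> ne by (intro cInf_lessD) auto
  ultimately obtain s where s: "s \<in> S" "s \<le> 2 powr (- IH \<eta> n d \<rho>) + \<kappa>" by force
  then obtain T where T: "T \<in> carrier_mat (n * d) (n * d)" "pos (emb T)" "emb T \<le> idn (n * d)"
    "tr ((idn (n * d) - emb T) * emb \<rho>) \<le> \<eta>" "s = tr (emb T * emb \<sigma>)"
    using \<sigma>c by (auto simp: S_def mle_iff[of _ "n * d"] emb_zero emb_one trT md)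
  define Tx where "Tx x = dag (slot d x) * emb T * slot d x" for x
  have "pos (Tx x)" for x unfolding Tx_def using T(2) by (rule pos_conj)
  moreover have "Tx x \<le> idn d" if "x < n" for x unfolding Tx_def using T(3) that by (rule slot_conj_effect)
  moreover have "car d (Tx x)" for x unfolding Tx_def by (rule car_slot_conj)
  moreover have "(\<Sum>x<n. w x * tr ((idn d - Tx x) * \<omega> x)) \<le> \<eta>"
  proof -
    have "idn d - Tx x = dag (slot d x) * (idn (n * d) - emb T) * slot d x" if "x < n" for x
      using rect_slot[OF that, of d] by (simp add: Tx_def algebra_simps rectD slot_slot)
    then have "(\<Sum>x<n. w x * tr ((idn d - Tx x) * \<omega> x)) = tr ((idn (n * d) - emb T) * emb \<rho>)"
      unfolding \<rho>(2) tr_cqs by simp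
    then show ?thesis using T by simp
  qed
  moreover have "(\<Sum>x<n. w x * tr (Tx x * \<tau>)) = s"
    unfolding T(5) \<sigma>e tr_cqs Tx_def ..
  ultimately show ?thesis using s(2) unfolding \<tau>_def by blast
qed

text \<open>The parameter \<open>k = \<delta> / (2 \<epsilon> - \<delta>)\<close> makes the Hayashi--Nagaoka bound equal to \<open>\<epsilon>\<close>, and \<open>(N - 1) (1 + 1 / N) \<le> N\<close> leaves room
  for an almost optimal test.\<close>
lemma random_coding_IH:
  fixes I :: "'i set"
  assumes \<rho>: "\<rho> \<in> carrier_mat (n * d) (n * d)" "emb \<rho> = cqs d n w \<omega>"
    and \<omega>: "\<And>x. x < n \<Longrightarrow> car d (\<omega> x)" "\<And>x. x < n \<Longrightarrow> pos (\<omega> x)" "\<And>x. x < n \<Longrightarrow> tr (\<omega> x) = 1"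
    and w: "pdf {..<n} w" and \<delta>: "0 < \<delta>" "\<delta> < \<epsilon>" "\<epsilon> < 1"
    and I: "finite I" "I \<noteq> {}"
    and N: "log 2 (real (card I)) \<le> IH (\<epsilon> - \<delta>) n d \<rho> - log 2 (4 * \<epsilon> / \<delta>\<^sup>2)"
  shows "\<exists>D. (\<forall>c\<in>PiE I (\<lambda>_. {..<n}). subpovm d I (D c)) \<and>
     (\<forall>i\<in>I. expect I {..<n} w (\<lambda>c. tr ((idn d - D c i) * \<omega> (c i))) \<le> \<epsilon>)"
proof -
  define N where "N = real (card I)"
  have N1: "1 \<le> N" using I by (simp add: N_def Suc_le_eq card_gt_0_iff)
  define g where "g = IH (\<epsilon> - \<delta>) n d \<rho>"
  \<comment> \<open>Hence the penalty \<open>log 2 (4 * \<epsilon> / \<delta>\<^sup>2)\<close> is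
    positive, and the rate bound with at least one message forces the divergence to be positive, as
    \<open>IH_test\<close> requires.\<close>
  have "\<delta> * \<delta> < 1 * \<epsilon>" using \<delta> by (intro mult_strict_mono) auto
  then have a1: "1 < 4 * \<epsilon> / \<delta>\<^sup>2" using \<delta> by (simp add: power2_eq_square)
  have "0 \<le> log 2 N" "0 < log 2 (4 * \<epsilon> / \<delta>\<^sup>2)" using N1 a1 by auto
  then have g: "0 < g" using N by (simp add: g_def N_def)
  \<comment> \<open>The rate bound says that the ideal type-two error is at most \<beta>; a slack of
    \<open>\<beta> / N\<close> is granted to the actual test.\<close>
  define \<beta> where "\<beta> = \<delta>\<^sup>2 / (4 * \<epsilon> * N)"
  have \<beta>: "0 < \<beta>" using \<delta> N1 by (simp add: \<beta>_def)
  define y where "y = 4 * \<epsilon> / \<delta>\<^sup>2"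
  have y: "0 < y" "0 < N" using a1 N1 by (simp_all add: y_def)
  have "log 2 (N * y) \<le> g"
  proof -
    have "log 2 (N * y) = log 2 N + log 2 y" using y by (simp add: log_def ln_mult add_divide_distrib)
    then show ?thesis using N by (simp add: g_def N_def y_def)
  qed
  then have "2 powr log 2 (N * y) \<le> 2 powr g" by simp
  then have "N * y \<le> 2 powr g" using y by simp
  then have "inverse (2 powr g) \<le> inverse (N * y)"
    using y by (intro le_imp_inverse_le) auto
  then have pg: "2 powr (- g) \<le> \<beta>" using \<delta> by (simp add: powr_minus \<beta>_def y_def mult.commute)
  obtain T where T: "\<forall>x<n. pos (T x) \<and> T x \<le> idn d \<and> car d (T x)"
    "(\<Sum>x<n. w x * tr ((idn d - T x) * \<omega> x)) \<le> \<epsilon> - \<delta>"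
    "(\<Sum>x<n. w x * tr (T x * (\<Sum>y<n. w y *\<^sub>R \<omega> y))) \<le> 2 powr (- g) + \<beta> / N"
    using IH_test[OF \<rho> \<omega> w, of "\<epsilon> - \<delta>" "\<beta> / N"] \<delta> g \<beta> N1 unfolding g_def by auto
  define k where "k = \<delta> / (2 * \<epsilon> - \<delta>)"
  have k: "0 < k" using \<delta> by (simp add: k_def)
  obtain D where D: "\<forall>c\<in>PiE I (\<lambda>_. {..<n}). subpovm d I (D c)"
    "\<forall>i\<in>I. expect I {..<n} w (\<lambda>c. tr ((idn d - D c i) * \<omega> (c i)))
       \<le> (1 + k) * (\<epsilon> - \<delta>) + (2 + k + 1 / k) * (real (card I - 1) * (\<beta> + \<beta> / N))"
    using random_coding[OF I(1) w, of T d \<omega> "\<epsilon> - \<delta>" "\<beta> + \<beta> / N" k] T pg k \<omega> by force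
  have "real (card I - 1) * (\<beta> + \<beta> / N) = (N - 1) * (\<beta> + \<beta> / N)"
    using N1 by (simp add: N_def of_nat_diff)
  also have "\<dots> = N * \<beta> - \<beta> / N" using N1 by (simp add: field_simps)
  also have "\<dots> \<le> \<delta>\<^sup>2 / (4 * \<epsilon>)" using N1 \<beta> \<delta> by (simp add: \<beta>_def)
  finally have 1: "real (card I - 1) * (\<beta> + \<beta> / N) \<le> \<delta>\<^sup>2 / (4 * \<epsilon>)" .
  have "(1 + k) * (\<epsilon> - \<delta>) + (2 + k + 1 / k) * (real (card I - 1) * (\<beta> + \<beta> / N))
      \<le> (1 + k) * (\<epsilon> - \<delta>) + (2 + k + 1 / k) * (\<delta>\<^sup>2 / (4 * \<epsilon>))"
    using 1 k by (intro add_left_mono mult_left_mono) auto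
  also have "\<dots> = \<epsilon>"
  proof -
    define e where "e = 2 * \<epsilon> - \<delta>"
    have e: "0 < e" "\<epsilon> = (e + \<delta>) / 2" "k = \<delta> / e" using \<delta> by (simp_all add: e_def k_def)
    have k1: "1 + k = 2 * \<epsilon> / e" using e by (simp add: field_simps)
    have "2 + k + 1 / k = (1 + k)\<^sup>2 / k" using k by (simp add: field_simps power2_eq_square)
    also have "\<dots> = 4 * \<epsilon>\<^sup>2 / (e * \<delta>)" unfolding k1 unfolding e(3) using e(1) \<delta> by (simp add: field_simps power2_eq_square)
    finally have k2: "2 + k + 1 / k = 4 * \<epsilon>\<^sup>2 / (e * \<delta>)" .
    have "(1 + k) * (\<epsilon> - \<delta>) + (2 + k + 1 / k) * (\<delta>\<^sup>2 / (4 * \<epsilon>)) = (2 * \<epsilon> * (\<epsilon> - \<delta>) + \<epsilon> * \<delta>) / e"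
      unfolding k1 k2 using e(1) \<delta> by (simp add: field_simps power2_eq_square)
    also have "2 * \<epsilon> * (\<epsilon> - \<delta>) + \<epsilon> * \<delta> = \<epsilon> * e" by (simp add: e_def algebra_simps)
    finally show ?thesis using e(1) by simp
  qed
  finally have le: "(1 + k) * (\<epsilon> - \<delta>) + (2 + k + 1 / k) * (real (card I - 1) * (\<beta> + \<beta> / N)) \<le> \<epsilon>" .
  have "\<forall>i\<in>I. expect I {..<n} w (\<lambda>c. tr ((idn d - D c i) * \<omega> (c i))) \<le> \<epsilon>"
    using D(2) le by force
  then show ?thesis using D(1) by (intro exI[of _ D] conjI)
qed

subsection \<open>Privacy from the max-relative entropy\<close>

lemma tn_minus: "tn (- A) = tn A"
  by (simp add: tn_def)

text \<open>Conjugation by an isometry commutes with taking the absolute value and preserves the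
  trace.\<close>

lemma tn_slot_conj:
  assumes "car d Y" shows "tn (slot d l * Y * dag (slot d l)) = tn Y"
proof -
  have "car d (dag Y * Y)" using assms by simp
  then obtain R where R: "pos R" "car d R" "R * R = dag Y * Y" using ex_sqrt[OF pos_dag_mult] by blast
  have Y: "idn d * Y = Y" and R': "idn d * R = R" "R * idn d = R" using assms R by (simp_all add: rect_def)
  have "tn (slot d l * Y * dag (slot d l)) = tr (slot d l * R * dag (slot d l))"
  proof (rule tn_eq)
    show "pos (slot d l * R * dag (slot d l))" using pos_conj[OF R(1), of "dag (slot d l)"] by simp
    have "slot d l * R * dag (slot d l) * (slot d l * R * dag (slot d l)) = slot d l * (R * R) * dag (slot d l)"
      using rectD(3)[OF R(2)] by (simp add: mult.assoc slot_slot_left)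
    moreover have "dag (slot d l * Y * dag (slot d l)) * (slot d l * Y * dag (slot d l)) = slot d l * (dag Y * Y) * dag (slot d l)"
      using rectD(3)[OF assms] by (simp add: mult.assoc slot_slot_left)
    ultimately show "slot d l * R * dag (slot d l) * (slot d l * R * dag (slot d l)) =
      dag (slot d l * Y * dag (slot d l)) * (slot d l * Y * dag (slot d l))" by (simp only: R(3))
  qed
  also have "\<dots> = tr (R * (dag (slot d l) * slot d l))" using tr_comm[of "slot d l" "R * dag (slot d l)"] by (simp add: mult.assoc)
  also have "\<dots> = tr R" by (simp add: slot_slot R')
  finally show ?thesis using tn_eq[OF R(1,3)] by simp
qed

text \<open>Smoothing changes the second marginal only. The first stays that of \<rho>, so the block
  weights remain the sampling weights of the codebook.\<close>

abbreviation dominated :: "nat \<Rightarrow> nat \<Rightarrow> complex mat \<Rightarrow> complex mat \<Rightarrow> real \<Rightarrow> bool" where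
  "dominated n d \<rho> \<rho>' t \<equiv> mle \<rho>' (rsmult (2 powr t) (kron (ptr2 n d \<rho>) (ptr1 n d \<rho>')))"

text \<open>The smoothed state need not be classical-quantum, but its diagonal blocks
  \<open>v x\<close> add up to \<sigma>, and domination bounds \<open>v x\<close> by
  \<open>(2 powr t * w x) *\<^sub>R \<sigma>\<close>, which is the hypothesis of convex splitting.
  The normalized blocks are on average within 2 \<eta> of the true outputs, which accounts for the
  other term.\<close>

lemma privacy:
  fixes I J :: "'i set"
  assumes \<rho>: "is_state (n * d) \<rho>" "emb \<rho> = cqs d n w \<omega>"
    and \<omega>: "\<And>x. x < n \<Longrightarrow> car d (\<omega> x)" "\<And>x. x < n \<Longrightarrow> pos (\<omega> x)" "\<And>x. x < n \<Longrightarrow> tr (\<omega> x) = 1"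
    and w: "pdf {..<n} w" and \<rho>': "\<rho>' \<in> pball (n * d) \<eta> \<rho>"
    and le: "dominated n d \<rho> \<rho>' t"
  defines "\<sigma> \<equiv> emb (ptr1 n d \<rho>')"
  shows privacy_nonneg: "0 \<le> t"
    and "pos \<sigma>" "car d \<sigma>" "tr \<sigma> = 1"
    and privacy_bound: "finite I \<Longrightarrow> J \<subseteq> I \<Longrightarrow> J \<noteq> {} \<Longrightarrow>
      expect I {..<n} w (\<lambda>c. tn ((1 / real (card J)) *\<^sub>R (\<Sum>i\<in>J. \<omega> (c i)) - \<sigma>)) \<le> 2 * \<eta> + sqrt (2 powr t / real (card J))"
proof -
  have w0: "0 \<le> w x" if "x < n" for x using w that by (simp add: pdf_def)
  have st: "is_state (n * d) \<rho>'" "pdist \<rho>' \<rho> \<le> \<eta>" using \<rho>' by (auto simp: pball_def)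
  have c: "\<rho> \<in> carrier_mat (n * d) (n * d)" "\<rho>' \<in> carrier_mat (n * d) (n * d)"
    and p': "pos (emb \<rho>')" "tr (emb \<rho>') = 1" using \<rho> st by (auto simp: is_state_iff)
  define v where "v x = dag (slot d x) * emb \<rho>' * slot d x" for x
  have v: "pos (v x)" "car d (v x)" for x
    unfolding v_def using pos_conj[OF p'(1)] car_slot_conj by auto
  have \<sigma>v: "\<sigma> = (\<Sum>x<n. v x)" unfolding \<sigma>_def emb_ptr1[OF c(2)] v_def ..
  show \<sigma>p: "pos \<sigma>" and \<sigma>c: "car d \<sigma>" unfolding \<sigma>v using v by (auto intro!: pos_sum rect_sum)
  have "tr \<sigma> = (\<Sum>x<n. tr (emb \<rho>' * (slot d x * dag (slot d x))))"
    unfolding \<sigma>v v_def tr_sum by (intro sum.cong refl) (metis mult.assoc tr_comm)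
  also have "\<dots> = tr (emb \<rho>' * idn (n * d))" by (simp add: sum_slot flip: tr_sum sum_distrib_left)
  finally show \<sigma>t: "tr \<sigma> = 1" using rect_emb[OF c(2)] p'(2) by (simp add: rect_def)
  have pt: "ptr2 n d \<rho> = diagm n w" by (rule ptr2_cqs[OF c(1) \<rho>(2)]) (use \<omega> in auto)
  have kc: "rsmult (2 powr t) (kron (ptr2 n d \<rho>) (ptr1 n d \<rho>')) \<in> carrier_mat (n * d) (n * d)"
    by (intro rsmult_carrier kron_carrier) simp_all
  have le': "emb \<rho>' \<le> (2 powr t) *\<^sub>R cqs d n w (\<lambda>_. \<sigma>)"
    using le unfolding mle_iff[OF c(2) kc] unfolding emb_rsmult pt emb_kron_diagm[OF ptr_carrier(1)] \<sigma>_def .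
  have "tr (cqs d n w (\<lambda>_. \<sigma>)) = (\<Sum>x<n. w x * tr (\<sigma> * (dag (slot d x) * slot d x)))"
    unfolding cqs_def tr_sum tr_scaleR by (intro sum.cong refl arg_cong[where f = "(*) _"]) (metis mult.assoc tr_comm)
  also have "\<dots> = 1" using w \<sigma>c \<sigma>t by (simp add: slot_slot rect_def pdf_def)
  \<comment> \<open>Both sides of the domination are compared by trace: a state against
    \<open>2 powr t\<close> times an operator of trace one.\<close>
  finally have "2 powr 0 \<le> 2 powr t" using tr_mono[OF le'] p' by simp
  then show "0 \<le> t" by (simp only: powr_le_cancel_iff)
  have vle: "v x \<le> (2 powr t * w x) *\<^sub>R \<sigma>" if x: "x < n" for x
  proof -
    have "v x \<le> dag (slot d x) * ((2 powr t) *\<^sub>R cqs d n w (\<lambda>_. \<sigma>)) * slot d x"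
      unfolding v_def using le' by (rule conj_mono)
    also have "\<dots> = (2 powr t) *\<^sub>R (dag (slot d x) * cqs d n w (\<lambda>_. \<sigma>) * slot d x)" by simp
    finally show ?thesis using cqs_block[of n d "\<lambda>_. \<sigma>" x x w] x \<sigma>c by simp
  qed
  define u where "u x = (1 / w x) *\<^sub>R v x" for x
  have wu: "w x *\<^sub>R u x = v x" if "x < n" for x
  proof (cases "w x = 0")
    case True
    then have "v x = 0" using vle[OF that] v(1)[of x] by (intro antisym) auto
    then show ?thesis by (simp add: u_def)
  qed (simp add: u_def)
  have du: "dag (u x) = u x" "car d (u x)" for x using v pos_dag by (simp_all add: u_def)
  have d\<omega>: "dag (\<omega> x) = \<omega> x" if "x < n" for x using \<omega>(2)[OF that] pos_dag by blast
  have "\<exists>H. dag H = H \<and> car d H \<and> H \<le> idn d \<and> - idn d \<le> H \<and> H * H \<le> idn d \<and> tn (u x - \<omega> x) = tr (H * (u x - \<omega> x))" if "x < n" for x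
    by (rule tn_sign) (use du \<omega> d\<omega> that in auto)
  then obtain h where h: "\<And>x. x < n \<Longrightarrow> dag (h x) = h x" "\<And>x. x < n \<Longrightarrow> car d (h x)" "\<And>x. x < n \<Longrightarrow> - idn d \<le> h x"
     "\<And>x. x < n \<Longrightarrow> h x * h x \<le> idn d" "\<And>x. x < n \<Longrightarrow> tn (u x - \<omega> x) = tr (h x * (u x - \<omega> x))" by metis
  \<comment> \<open>One test assembled from the sign operators of all blocks: its value on the
    difference of the two states is the average of the blockwise trace distances, so a single
    application of the purified-distance bound suffices.\<close>
  define H where "H = cqs d n (\<lambda>_. 1) h"
  have blockH: "dag (slot d x) * H * slot d x = h x" if "x < n" for x
    unfolding H_def using cqs_block[of n d h x x "\<lambda>_. 1"] h(2) that by simp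
  have one: "idn (n * d) = cqs d n (\<lambda>_. 1) (\<lambda>_. idn d)"
    unfolding cqs_def sum_slot[symmetric] by (intro sum.cong refl) (simp add: rectD[OF rect_slot[OF lessI]])
  have cqs_mono: "cqs d n (\<lambda>_. 1) f \<le> cqs d n (\<lambda>_. 1) g" if "\<And>x. x < n \<Longrightarrow> f x \<le> g x" for f g
    unfolding cqs_def using conj_mono[OF that, of _ "dag (slot d x)" for x] by (intro sum_mono) simp
  have dH: "dag H = H" unfolding H_def cqs_def by (simp add: mult.assoc h)
  have mH: "- idn (n * d) \<le> H"
  proof -
    have "- idn (n * d) = cqs d n (\<lambda>_. 1) (\<lambda>_. - idn d)" unfolding one by (simp add: cqs_def sum_negf)
    then show ?thesis unfolding H_def using cqs_mono h(3) by simp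
  qed
  have HH: "H * H \<le> idn (n * d)"
  proof -
    have "H * H = (\<Sum>x<n. \<Sum>y<n. if y = x then slot d x * (h x * h x) * dag (slot d x) else 0)"
      unfolding H_def cqs_def sum_product
    proof (intro sum.cong refl)
      fix x y assume "x \<in> {..<n}" "y \<in> {..<n}"
      then have "idn d * (h y * X) = h y * X" for X using rectD(3)[OF h(2)] by simp
      then show "1 *\<^sub>R (slot d x * h x * dag (slot d x)) * 1 *\<^sub>R (slot d y * h y * dag (slot d y))
          = (if y = x then slot d x * (h x * h x) * dag (slot d x) else 0)"
        by (cases "y = x") (simp_all add: mult.assoc slot_slot_left)
    qed
    also have "\<dots> = cqs d n (\<lambda>_. 1) (\<lambda>x. h x * h x)" by (simp add: cqs_def)
    also have "\<dots> \<le> idn (n * d)" unfolding one using cqs_mono h(4) by simp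
    finally show ?thesis .
  qed
  have "(\<Sum>x<n. w x * tn (u x - \<omega> x)) = (\<Sum>x<n. tr (h x * v x) - w x * tr (h x * \<omega> x))"
  proof (intro sum.cong refl)
    fix x assume "x \<in> {..<n}"
    then have x: "x < n" by simp
    have "tr (h x * v x) = w x * tr (h x * u x)" using wu[OF x] by (metis mult_scaleR_right tr_scaleR)
    then show "w x * tn (u x - \<omega> x) = tr (h x * v x) - w x * tr (h x * \<omega> x)"
      unfolding h(5)[OF x] by (simp add: right_diff_distrib)
  qed
  also have "\<dots> = tr (H * emb \<rho>') - tr (H * emb \<rho>)"
  proof -
    have "tr (H * emb \<rho>') = (\<Sum>x<n. tr (h x * v x))"
    proof -
      have "tr (H * emb \<rho>') = (\<Sum>x<n. tr (slot d x * h x * dag (slot d x) * emb \<rho>'))"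
        by (simp add: H_def cqs_def sum_distrib_right)
      also have "\<dots> = (\<Sum>x<n. tr (h x * v x))"
        unfolding v_def by (intro sum.cong refl) (metis mult.assoc tr_comm)
      finally show ?thesis .
    qed
    moreover have "tr (H * emb \<rho>) = (\<Sum>x<n. w x * tr (h x * \<omega> x))"
      unfolding \<rho>(2) tr_cqs by (intro sum.cong refl) (simp add: blockH)
    ultimately show ?thesis by (simp add: sum_subtractf)
  qed
  also have "\<dots> \<le> 2 * \<eta>"
    using pdist_tr_bound[OF st(1) \<rho>(1) st(2) dH mH HH] by (simp add: right_diff_distrib)
  finally have approx: "(\<Sum>x<n. w x * tn (u x - \<omega> x)) \<le> 2 * \<eta>" .
  assume I: "finite I" "J \<subseteq> I" "J \<noteq> {}"
  have J: "finite J" using I by (blast intro: finite_subset)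
  define N where "N = real (card J)"
  have N: "0 < N" using J I by (simp add: N_def card_gt_0_iff)
  \<comment> \<open>Triangle inequality through the normalized blocks \<open>u\<close>, for which
    convex splitting holds exactly.\<close>
  have pt: "tn ((1 / N) *\<^sub>R (\<Sum>i\<in>J. \<omega> (c i)) - \<sigma>) \<le>
      (1 / N) * (\<Sum>i\<in>J. tn (u (c i) - \<omega> (c i))) + tn ((1 / N) *\<^sub>R (\<Sum>i\<in>J. u (c i)) - \<sigma>)" if c: "c \<in> PiE I (\<lambda>_. {..<n})" for c
  proof -
    have cn: "c i < n" if "i \<in> J" for i using c that I by (auto dest: PiE_mem)
    have d\<sigma>: "dag \<sigma> = \<sigma>" using \<sigma>p pos_dag by blast
    have "(1 / N) *\<^sub>R (\<Sum>i\<in>J. \<omega> (c i)) - \<sigma> = (1 / N) *\<^sub>R (\<Sum>i\<in>J. - (u (c i) - \<omega> (c i))) + ((1 / N) *\<^sub>R (\<Sum>i\<in>J. u (c i)) - \<sigma>)"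
      by (simp add: sum_subtractf algebra_simps)
    also have "tn \<dots> \<le> tn ((1 / N) *\<^sub>R (\<Sum>i\<in>J. - (u (c i) - \<omega> (c i)))) + tn ((1 / N) *\<^sub>R (\<Sum>i\<in>J. u (c i)) - \<sigma>)"
      by (rule tn_triangle) (use du d\<omega> cn d\<sigma> in \<open>auto intro!: sum.cong\<close>)
    also have "tn ((1 / N) *\<^sub>R (\<Sum>i\<in>J. - (u (c i) - \<omega> (c i)))) = (1 / N) * tn (\<Sum>i\<in>J. - (u (c i) - \<omega> (c i)))"
      using N by (intro tn_scaleR) simp
    also have "tn (\<Sum>i\<in>J. - (u (c i) - \<omega> (c i))) \<le> (\<Sum>i\<in>J. tn (- (u (c i) - \<omega> (c i))))"
      by (rule tn_sum) (use du d\<omega> cn in auto)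
    finally show ?thesis using N by (simp add: tn_minus mult_left_mono divide_right_mono del: minus_diff_eq)
  qed
  have "expect I {..<n} w (\<lambda>c. tn ((1 / N) *\<^sub>R (\<Sum>i\<in>J. \<omega> (c i)) - \<sigma>)) \<le>
     expect I {..<n} w (\<lambda>c. (1 / N) * (\<Sum>i\<in>J. tn (u (c i) - \<omega> (c i))) + tn ((1 / N) *\<^sub>R (\<Sum>i\<in>J. u (c i)) - \<sigma>))"
    using pt by (rule expect_mono[OF w])
  also have "\<dots> = (1 / N) * (\<Sum>i\<in>J. expect I {..<n} w (\<lambda>c. tn (u (c i) - \<omega> (c i)))) +
      expect I {..<n} w (\<lambda>c. tn ((1 / N) *\<^sub>R (\<Sum>i\<in>J. u (c i)) - \<sigma>))"
    unfolding expect_add expect_cmult expect_sum ..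
  also have "\<dots> \<le> (1 / N) * (N * (2 * \<eta>)) + sqrt (2 powr t / N)"
  proof (intro add_mono mult_left_mono)
    have "expect I {..<n} w (\<lambda>c. tn (u (c i) - \<omega> (c i))) \<le> 2 * \<eta>" if "i \<in> J" for i
      using expect_single[OF I(1) w, of i "\<lambda>x. tn (u x - \<omega> x)"] that I(2) approx by auto
    then show "(\<Sum>i\<in>J. expect I {..<n} w (\<lambda>c. tn (u (c i) - \<omega> (c i)))) \<le> N * (2 * \<eta>)"
      unfolding N_def by (intro sum_bounded_above)
    show "expect I {..<n} w (\<lambda>c. tn ((1 / N) *\<^sub>R (\<Sum>i\<in>J. u (c i)) - \<sigma>)) \<le> sqrt (2 powr t / N)"
      unfolding u_def N_def
      by (rule convex_split[OF I w \<sigma>p \<sigma>c]) (use \<sigma>t v vle \<sigma>v in auto)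
  qed (use N in auto)
  also have "(1 / N) * (N * (2 * \<eta>)) = 2 * \<eta>" using N by simp
  finally show "expect I {..<n} w (\<lambda>c. tn ((1 / real (card J)) *\<^sub>R (\<Sum>i\<in>J. \<omega> (c i)) - \<sigma>)) \<le> 2 * \<eta> + sqrt (2 powr t / real (card J))"
    by (simp add: N_def)
qed

text \<open>Choose a codebook for which \<open>a * g c + t * f c\<close> is at most its mean bound
  \<open>a * (s + t)\<close>; dropping either nonnegative summand gives one claim. These are the
  thresholds at which the Markov bounds \<open>s / (s + t)\<close> and \<open>t / (s + t)\<close>
  just add up to one.\<close>

lemma expect_exists2:
  assumes I: "finite I" and w: "pdf A w" and g: "expect I A w g \<le> s" and f: "expect I A w f \<le> a"
    and nonneg: "\<And>c. c \<in> PiE I (\<lambda>_. A) \<Longrightarrow> 0 \<le> f c" "\<And>c. c \<in> PiE I (\<lambda>_. A) \<Longrightarrow> 0 \<le> g c"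
    and a: "0 < a" and t: "0 < t"
  shows "\<exists>c\<in>PiE I (\<lambda>_. A). g c \<le> s + t \<and> f c \<le> (s + t) / t * a"
proof -
  have "expect I A w (\<lambda>c. a * g c + t * f c) \<le> a * s + t * a"
    unfolding expect_add expect_cmult using a t f g by (intro add_mono mult_left_mono) auto
  then obtain c where c: "c \<in> PiE I (\<lambda>_. A)" "a * g c + t * f c \<le> a * s + t * a"
    using expect_exists[OF I w] by blast
  have "0 \<le> t * f c" "0 \<le> a * g c" using nonneg c a t by simp_all
  moreover have "t * ((s + t) / t * a) = a * s + t * a" "a * (s + t) = a * s + t * a"
    using t by (simp_all add: field_simps)
  ultimately have "a * g c \<le> a * (s + t)" "t * f c \<le> t * ((s + t) / t * a)"
    using c(2) by linarith+
  then show ?thesis using a t c(1) by (intro bexI[of _ c]) (simp_all add: pos_le_divide_eq mult.commute)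
qed

text \<open>A channel with Kraus operators \<open>dag (A k) * v\<close>: apply the isometry
  \<open>v\<close>, then trace out a factor. \<open>cslot\<close> traces out the second factor,
  \<open>slot\<close> the first.\<close>

definition chn :: "fop \<Rightarrow> (nat \<Rightarrow> fop) \<Rightarrow> nat \<Rightarrow> fop \<Rightarrow> fop" where
  "chn v A n X = (\<Sum>k<n. dag (A k) * (v * X * dag v) * A k)"

lemma chn_pos: assumes "pos X" shows "pos (chn v A n X)"
proof -
  have "pos (v * X * dag v)" using pos_conj[OF assms, of "dag v"] by simp
  then show ?thesis unfolding chn_def by (intro pos_sum pos_conj)
qed

lemma chn_car: "(\<And>k. k < n \<Longrightarrow> rect N d (A k)) \<Longrightarrow> rect N m v \<Longrightarrow> car d (chn v A n X)"
  unfolding chn_def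
proof (intro rect_sum)
  fix k assume "\<And>k. k < n \<Longrightarrow> rect N d (A k)" "rect N m v" "k \<in> {..<n}"
  then have "rect N d (A k)" by simp
  then show "car d (dag (A k) * (v * X * dag v) * A k)"
    unfolding rect_def by (metis dag_idn dag_mult mult.assoc)
qed

lemma chn_tr:
  assumes "(\<Sum>k<n. A k * dag (A k)) = idn N" "rect N m v" "dag v * v = idn m" "car m X"
  shows "tr (chn v A n X) = tr X"
proof -
  have "tr (chn v A n X) = (\<Sum>k<n. tr (v * X * dag v * (A k * dag (A k))))"
    unfolding chn_def tr_sum by (intro sum.cong refl) (metis mult.assoc tr_comm)
  also have "\<dots> = tr (v * X * (dag v * idn N))" by (simp add: mult.assoc flip: tr_sum sum_distrib_left assms(1))
  also have "dag v * idn N = dag v" using assms(2) by (metis dag_idn dag_mult rect_def)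
  also have "tr (v * X * dag v) = tr (X * (dag v * v))" using tr_comm[of v "X * dag v"] by (simp add: mult.assoc)
  finally show ?thesis using assms by (simp add: rect_def)
qed

lemma chn_sum: "chn v A n (\<Sum>i\<in>I. X i) = (\<Sum>i\<in>I. chn v A n (X i))"
  unfolding chn_def by (subst sum.swap) (simp add: sum_distrib_left sum_distrib_right)

lemma chn_scaleR: "chn v A n (c *\<^sub>R X) = c *\<^sub>R chn v A n X"
  unfolding chn_def by (simp add: scaleR_sum_right)

definition outputB :: "complex mat \<Rightarrow> nat \<Rightarrow> nat \<Rightarrow> fop \<Rightarrow> fop" where
  "outputB V dB dE = chn (emb V) (cslot dB dE) dE"

definition outputE :: "complex mat \<Rightarrow> nat \<Rightarrow> nat \<Rightarrow> fop \<Rightarrow> fop" where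
  "outputE V dB dE = chn (emb V) (slot dE) dB"

lemma output_density:
  assumes "isometry dA (dB * dE) V" "qstate dA X"
  shows "qstate dB (outputB V dB dE X)" "qstate dE (outputE V dB dE X)"
proof -
  have Vc: "V \<in> carrier_mat (dB * dE) dA" and VV: "adj V * V = 1\<^sub>m dA" using assms(1) by (auto simp: isometry_def)
  have v: "rect (dB * dE) dA (emb V)" "dag (emb V) * emb V = idn dA"
    using rect_emb[OF Vc] emb_mult[OF adj_carrier[OF Vc] Vc] VV by (simp_all add: emb_adj emb_one)
  show "qstate dB (outputB V dB dE X)"
    unfolding outputB_def using assms(2) chn_pos chn_car[OF rect_cslot v(1)] chn_tr[OF sum_cslot v] by auto
  show "qstate dE (outputE V dB dE X)"
    unfolding outputE_def using assms(2) chn_pos chn_car[OF rect_slot v(1)] chn_tr[OF sum_slot v] by auto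
qed

lemma emb_chan:
  assumes "V \<in> carrier_mat N m" "\<rho> \<in> carrier_mat m m"
  shows "chan V \<rho> \<in> carrier_mat N N" "emb (chan V \<rho>) = emb V * emb \<rho> * dag (emb V)"
proof -
  have 1: "V * \<rho> \<in> carrier_mat N m" using assms by (rule mult_carrier_mat)
  show "chan V \<rho> \<in> carrier_mat N N"
    unfolding chan_def using 1 adj_carrier[OF assms(1)] by (rule mult_carrier_mat)
  show "emb (chan V \<rho>) = emb V * emb \<rho> * dag (emb V)"
    unfolding chan_def emb_mult[OF 1 adj_carrier[OF assms(1)]] emb_mult[OF assms] emb_adj ..
qed

lemma emb_output:
  assumes "isometry dA (dB * dE) V" "\<rho> \<in> carrier_mat dA dA"
  shows "emb (ptr2 dB dE (chan V \<rho>)) = outputB V dB dE (emb \<rho>)" "emb (ptr1 dB dE (chan V \<rho>)) = outputE V dB dE (emb \<rho>)"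
  using emb_chan[of V "dB * dE" dA \<rho>] assms by (simp_all add: isometry_def emb_ptr1 emb_ptr2 outputB_def outputE_def chn_def)

subsection \<open>Code construction\<close>

lemma pos_member_le_sum:
  assumes "finite I" "i \<in> I" "\<And>j. j \<in> I \<Longrightarrow> pos (f j)" shows "f i \<le> (\<Sum>j\<in>I. f j)"
proof -
  have "pos (\<Sum>j\<in>I - {i}. f j)" using assms(3) by (intro pos_sum) auto
  then show ?thesis unfolding sum.remove[OF assms(1,2), of f] by (simp add: less_eq_fop_def)
qed

text \<open>One codebook must satisfy a fixed privacy threshold while only its expected leakage is known. Weighting the two
  expectations (\<open>expect_exists2\<close>) costs the decoding error no more than the factor \<open>(s + t) / t\<close>; the error bound is linear in
  \<open>e1\<close>, so this factor survives the later average over the public codebook.\<close>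
lemma private_code:
  fixes u :: "nat \<Rightarrow> real" and X0 B0 E0 :: "nat \<Rightarrow> fop"
  assumes X0: "\<And>y. y < n \<Longrightarrow> pos (X0 y)" "\<And>y. y < n \<Longrightarrow> car a (X0 y)" "\<And>y. y < n \<Longrightarrow> tr (X0 y) = 1"
    and B: "\<And>y. y < n \<Longrightarrow> car d (outB (X0 y))" "\<And>y. y < n \<Longrightarrow> pos (outB (X0 y))" "\<And>y. y < n \<Longrightarrow> tr (outB (X0 y)) = 1"
    and lin: "\<And>(S :: nat set) f c. outB (c *\<^sub>R (\<Sum>i\<in>S. f i)) = c *\<^sub>R (\<Sum>i\<in>S. outB (f i))"
      "\<And>(S :: nat set) f c. outE (c *\<^sub>R (\<Sum>i\<in>S. f i)) = c *\<^sub>R (\<Sum>i\<in>S. outE (f i))"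
    and u: "pdf {..<n} u"
    and \<rho>: "\<rho> \<in> carrier_mat (n * d) (n * d)" "emb \<rho> = cqs d n u (\<lambda>y. outB (X0 y))"
    and \<delta>: "0 < \<delta>" "\<delta> < \<epsilon>" "\<epsilon> < 1" and nL: "0 < nL" and K: "0 < K"
    and N: "log 2 (real (nL * K)) \<le> IH (\<epsilon> - \<delta>) n d \<rho> - log 2 (4 * \<epsilon> / \<delta>\<^sup>2)"
    and priv: "\<And>l. l < nL \<Longrightarrow> expect ({..<nL} \<times> {..<K}) {..<n} u
         (\<lambda>c. tn ((1 / real K) *\<^sub>R (\<Sum>k<K. outE (X0 (c (l, k)))) - \<sigma>)) \<le> 2 * s"
    and E: "pos E" "E \<le> idn d" "car d E" and t: "0 < t"
    and e1: "tr ((idn d - E) * (\<Sum>y<n. u y *\<^sub>R outB (X0 y))) \<le> e1" "0 \<le> e1"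
  shows "\<exists>X L. (\<forall>l<nL. qstate a (X l)) \<and> (\<forall>l<nL. pos (L l) \<and> car d (L l)) \<and>
    (\<Sum>l<nL. L l) \<le> E \<and> (\<Sum>l<nL. tn (outE (X l) - \<sigma>)) \<le> 2 * real nL * (s + t) \<and>
    (\<Sum>l<nL. tr ((idn d - L l) * outB (X l))) \<le> real nL * ((s + t) / t * (3 * e1 + 2 * \<epsilon>))"
proof -
  define I where "I = {..<nL} \<times> {..<K}"
  have I: "finite I" "I \<noteq> {}" "card I = nL * K" using nL K by (auto simp: I_def)
  have N': "log 2 (real (card I)) \<le> IH (\<epsilon> - \<delta>) n d \<rho> - log 2 (4 * \<epsilon> / \<delta>\<^sup>2)" using N by (simp add: I(3))
  have "\<exists>D. (\<forall>c\<in>PiE I (\<lambda>_. {..<n}). subpovm d I (D c)) \<and>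
     (\<forall>i\<in>I. expect I {..<n} u (\<lambda>c. tr ((idn d - D c i) * outB (X0 (c i)))) \<le> \<epsilon>)"
    by (rule random_coding_IH[OF \<rho> _ _ _ u \<delta> I(1,2) N']) (use B in auto)
  then obtain D where D0: "\<forall>c\<in>PiE I (\<lambda>_. {..<n}). subpovm d I (D c)"
     "\<forall>i\<in>I. expect I {..<n} u (\<lambda>c. tr ((idn d - D c i) * outB (X0 (c i)))) \<le> \<epsilon>" by blast
  have D: "\<And>c i. c \<in> PiE I (\<lambda>_. {..<n}) \<Longrightarrow> i \<in> I \<Longrightarrow> pos (D c i) \<and> car d (D c i)"
    "\<And>c. c \<in> PiE I (\<lambda>_. {..<n}) \<Longrightarrow> (\<Sum>i\<in>I. D c i) \<le> idn d"
    "\<And>i. i \<in> I \<Longrightarrow> expect I {..<n} u (\<lambda>c. tr ((idn d - D c i) * outB (X0 (c i)))) \<le> \<epsilon>"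
    using D0 by auto
  obtain R where R: "pos R" "car d R" "R * R = E" "R \<le> idn d" "E \<le> R" using ex_sqrt_effect[OF E] by blast
  have dR: "dag R = R" using R pos_dag by blast
  \<comment> \<open>The encoder draws the randomizer \<open>k\<close> uniformly; correspondingly
    \<open>D'\<close> accepts every \<open>k\<close> belonging to the message
    \<open>l\<close>.\<close>
  define X where "X c l = (1 / real K) *\<^sub>R (\<Sum>k<K. X0 (c (l, k)))" for c :: "nat \<times> nat \<Rightarrow> nat" and l
  define D' where "D' c l = (\<Sum>k<K. D c (l, k))" for c l
  \<comment> \<open>The coefficients 3 and 2 are those of \<open>sequential_effect_ineq\<close>.
    Every summand depends on one codeword or one decoder effect, so its expectation is
    known.\<close>
  define f where "f c = (1 / real nL) * (\<Sum>l<nL. (1 / real K) * (\<Sum>k<K. 3 * tr ((idn d - E) * outB (X0 (c (l, k)))) +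
     2 * tr ((idn d - D c (l, k)) * outB (X0 (c (l, k))))))" for c
  define g where "g c = (1 / (2 * real nL)) * (\<Sum>l<nL. tn (outE (X c l) - \<sigma>))" for c
  have outX: "outB (X c l) = (1 / real K) *\<^sub>R (\<Sum>k<K. outB (X0 (c (l, k))))"
    "outE (X c l) = (1 / real K) *\<^sub>R (\<Sum>k<K. outE (X0 (c (l, k))))" for c l
    unfolding X_def lin by simp_all
  have cn: "c (l, k) < n" if "c \<in> PiE I (\<lambda>_. {..<n})" "l < nL" "k < K" for c l k
  proof -
    have "(l, k) \<in> I" using that by (simp add: I_def)
    then show ?thesis using that(1) by (auto dest: PiE_mem)
  qed
  have inI: "(l, k) \<in> I" if "l < nL" "k < K" for l k using that by (simp add: I_def)
  have Dle: "D c i \<le> idn d" if c: "c \<in> PiE I (\<lambda>_. {..<n})" and i: "i \<in> I" for c i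
  proof -
    have "D c i \<le> (\<Sum>j\<in>I. D c j)" using I(1) i D(1)[OF c] by (intro pos_member_le_sum) auto
    then show ?thesis using D(2)[OF c] by (rule order_trans)
  qed
  have D'sum: "(\<Sum>l<nL. D' c l) = (\<Sum>i\<in>I. D c i)" for c
    unfolding D'_def I_def by (simp add: sum.cartesian_product)
  have D'p: "pos (D' c l)" "car d (D' c l)" if "c \<in> PiE I (\<lambda>_. {..<n})" "l < nL" for c l
    unfolding D'_def using D(1)[OF that(1)] inI[OF that(2)] by (auto intro!: pos_sum rect_sum)
  have D'le: "D' c l \<le> idn d" if c: "c \<in> PiE I (\<lambda>_. {..<n})" and l: "l < nL" for c l
  proof -
    have "D' c l \<le> (\<Sum>j<nL. D' c j)" using l D'p[OF c] by (intro pos_member_le_sum) auto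
    then show ?thesis using D(2)[OF c] unfolding D'sum by (rule order_trans)
  qed
  have terms: "0 \<le> tr ((idn d - E) * outB (X0 (c (l, k))))" "0 \<le> tr ((idn d - D c (l, k)) * outB (X0 (c (l, k))))"
    if "c \<in> PiE I (\<lambda>_. {..<n})" "l < nL" "k < K" for c l k
    using E Dle[OF that(1) inI[OF that(2,3)]] B(2)[OF cn[OF that]]
    by (auto intro!: tr_mult_pos simp: less_eq_fop_def)
  have f0: "0 \<le> f c" if "c \<in> PiE I (\<lambda>_. {..<n})" for c
    unfolding f_def using terms[OF that] by (intro mult_nonneg_nonneg sum_nonneg add_nonneg_nonneg) auto
  have g0: "0 \<le> g c" for c unfolding g_def by (intro mult_nonneg_nonneg sum_nonneg tn_nonneg) auto
  have single: "expect I {..<n} u (\<lambda>c. tr ((idn d - E) * outB (X0 (c i)))) \<le> e1" if "i \<in> I" for i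
  proof -
    have "expect I {..<n} u (\<lambda>c. tr ((idn d - E) * outB (X0 (c i)))) = (\<Sum>y<n. u y * tr ((idn d - E) * outB (X0 y)))"
      using expect_single[OF I(1) u that, of "\<lambda>y. tr ((idn d - E) * outB (X0 y))"] .
    also have "\<dots> = tr ((idn d - E) * (\<Sum>y<n. u y *\<^sub>R outB (X0 y)))" by (simp add: sum_distrib_left)
    finally show ?thesis using e1 by simp
  qed
  have fexp: "expect I {..<n} u f \<le> 3 * e1 + 2 * \<epsilon>"
  proof -
    have "expect I {..<n} u f = (1 / real nL) * (\<Sum>l<nL. (1 / real K) * (\<Sum>k<K.
        3 * expect I {..<n} u (\<lambda>c. tr ((idn d - E) * outB (X0 (c (l, k))))) +
        2 * expect I {..<n} u (\<lambda>c. tr ((idn d - D c (l, k)) * outB (X0 (c (l, k)))))))"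
      unfolding f_def expect_cmult expect_sum expect_add ..
    also have "\<dots> \<le> (1 / real nL) * (\<Sum>l<nL. (1 / real K) * (\<Sum>k<K. 3 * e1 + 2 * \<epsilon>))"
      using single D(3) inI by (intro mult_left_mono sum_mono add_mono) auto
    also have "\<dots> = 3 * e1 + 2 * \<epsilon>" using nL K by simp
    finally show ?thesis .
  qed
  have gexp: "expect I {..<n} u g \<le> s"
  proof -
    have "expect I {..<n} u g = (1 / (2 * real nL)) * (\<Sum>l<nL. expect I {..<n} u (\<lambda>c. tn ((1 / real K) *\<^sub>R (\<Sum>k<K. outE (X0 (c (l, k)))) - \<sigma>)))"
      unfolding g_def outX expect_cmult expect_sum ..
    also have "\<dots> \<le> (1 / (2 * real nL)) * (\<Sum>l<nL. 2 * s)"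
      using priv by (intro mult_left_mono sum_mono) (auto simp: I_def)
    also have "\<dots> = s" using nL by simp
    finally show ?thesis .
  qed
  have "\<exists>c\<in>PiE I (\<lambda>_. {..<n}). g c \<le> s + t \<and> f c \<le> (s + t) / t * (3 * e1 + 2 * \<epsilon>)"
    by (rule expect_exists2[OF I(1) u gexp fexp f0 g0 _ t]) (use e1 \<delta> in auto)
  then obtain c where c: "c \<in> PiE I (\<lambda>_. {..<n})" and gc: "g c \<le> s + t" and fc: "f c \<le> (s + t) / t * (3 * e1 + 2 * \<epsilon>)"
    by blast
  \<comment> \<open>The private measurement conditioned on the public outcome, with \<open>R\<close>
    the square root of \<open>E\<close>. The effects sum to at most \<open>E\<close>, so those of
    different public messages still form a sub-POVM.\<close>
  define L where "L l = R * D' c l * R" for l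
  have "\<forall>l<nL. qstate a (X c l)"
    unfolding X_def using X0 cn[OF c] K by (auto intro!: pos_scaleR pos_sum rect_sum)
  moreover have "\<forall>l<nL. pos (L l) \<and> car d (L l)"
    unfolding L_def using D'p[OF c] R dR by (auto intro!: pos_conj')
  moreover have "(\<Sum>l<nL. L l) \<le> E"
  proof -
    have "(\<Sum>l<nL. L l) = R * (\<Sum>i\<in>I. D c i) * R"
      by (simp add: L_def sum_distrib_left sum_distrib_right flip: D'sum)
    also have "\<dots> \<le> R * idn d * R" using D(2)[OF c] dR by (rule conj_mono')
    also have "\<dots> = E" using R by (simp add: rectD(2))
    finally show ?thesis .
  qed
  moreover have "(\<Sum>l<nL. tn (outE (X c l) - \<sigma>)) \<le> 2 * real nL * (s + t)"
    using gc nL by (simp add: g_def field_simps)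
  moreover have "(\<Sum>l<nL. tr ((idn d - L l) * outB (X c l))) \<le> real nL * ((s + t) / t * (3 * e1 + 2 * \<epsilon>))"
  proof -
    have "tr ((idn d - L l) * outB (X c l)) \<le> (1 / real K) * (\<Sum>k<K. 3 * tr ((idn d - E) * outB (X0 (c (l, k)))) +
     2 * tr ((idn d - D c (l, k)) * outB (X0 (c (l, k)))))" if l: "l < nL" for l
    proof -
      have "tr ((idn d - L l) * outB (X0 (c (l, k)))) \<le> 3 * tr ((idn d - E) * outB (X0 (c (l, k)))) +
          2 * tr ((idn d - D c (l, k)) * outB (X0 (c (l, k))))" if k: "k < K" for k
      proof -
        have p: "pos (outB (X0 (c (l, k))))" using B(2)[OF cn[OF c l k]] .
        have "tr ((idn d - L l) * outB (X0 (c (l, k)))) \<le> tr ((3 *\<^sub>R (idn d - E) + 2 *\<^sub>R (idn d - D' c l)) * outB (X0 (c (l, k))))"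
          unfolding L_def using R D'le[OF c l] D'p[OF c l]
          by (intro tr_mult_mono2 p sequential_effect_ineq) auto
        \<comment> \<open>A wrong randomizer together with the right message counts as success, so
          the coarser effect fails no more often.\<close>
        moreover have "tr ((idn d - D' c l) * outB (X0 (c (l, k)))) \<le> tr ((idn d - D c (l, k)) * outB (X0 (c (l, k))))"
        proof (rule tr_mult_mono2[OF p diff_left_mono])
          show "D c (l, k) \<le> D' c l"
            unfolding D'_def using k l D(1)[OF c inI[OF l]] by (intro pos_member_le_sum) auto
        qed
        ultimately show ?thesis by (simp add: distrib_right)
      qed
      then have "(1 / real K) * (\<Sum>k<K. tr ((idn d - L l) * outB (X0 (c (l, k))))) \<le> (1 / real K) * (\<Sum>k<K. 3 * tr ((idn d - E) * outB (X0 (c (l, k)))) +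
          2 * tr ((idn d - D c (l, k)) * outB (X0 (c (l, k)))))"
        by (intro mult_left_mono sum_mono) auto
      then show ?thesis unfolding outX by (simp add: sum_distrib_left)
    qed
    then have "(\<Sum>l<nL. tr ((idn d - L l) * outB (X c l))) \<le> (\<Sum>l<nL. (1 / real K) * (\<Sum>k<K. 3 * tr ((idn d - E) * outB (X0 (c (l, k)))) +
     2 * tr ((idn d - D c (l, k)) * outB (X0 (c (l, k))))))" by (intro sum_mono) auto
    also have "\<dots> = real nL * f c" using nL by (simp add: f_def)
    also have "\<dots> \<le> real nL * ((s + t) / t * (3 * e1 + 2 * \<epsilon>))" using fc by (intro mult_left_mono) auto
    finally show ?thesis .
  qed
  ultimately show ?thesis by - (rule exI[of _ "X c"], rule exI[of _ L], intro conjI; assumption)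
qed

text \<open>The missing part of the sub-POVM is added to one outcome, which can only raise the
  success probability. The leakage operator is block diagonal in the message register, so its trace
  norm is at most the average of the blockwise ones.\<close>

lemma code_from_operators:
  fixes X L :: "nat \<Rightarrow> nat \<Rightarrow> fop"
  assumes V: "isometry dA (dB * dE) V" and n: "0 < nM" "0 < nL"
    and X: "\<And>m l. m < nM \<Longrightarrow> l < nL \<Longrightarrow> qstate dA (X m l)"
    and L: "\<And>m l. m < nM \<Longrightarrow> l < nL \<Longrightarrow> pos (L m l) \<and> car dB (L m l)" "(\<Sum>m<nM. \<Sum>l<nL. L m l) \<le> idn dB"
    and err: "(\<Sum>m<nM. \<Sum>l<nL. tr ((idn dB - L m l) * outputB V dB dE (X m l))) \<le> real nM * real nL * \<epsilon>1"
    and priv: "\<And>m. m < nM \<Longrightarrow> \<exists>\<sigma>. qstate dE \<sigma> \<and>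
       (\<Sum>l<nL. tn (outputE V dB dE (X m l) - \<sigma>)) \<le> 2 * real nL * \<epsilon>2"
  shows "\<exists>enc dec. sim_pub_priv_code dA dB dE V nM nL \<epsilon>1 \<epsilon>2 enc dec"
proof -
  define enc where "enc m l = mt dA (X m l)" for m l
  have enc: "is_state dA (enc m l)" "emb (enc m l) = X m l" "enc m l \<in> carrier_mat dA dA" if "m < nM" "l < nL" for m l
    using X[OF that] by (simp_all add: enc_def is_state_iff emb_mt)
  have eB: "emb (ptr2 dB dE (chan V (enc m l))) = outputB V dB dE (X m l)"
    and eE: "emb (ptr1 dB dE (chan V (enc m l))) = outputE V dB dE (X m l)"
    if "m < nM" "l < nL" for m l
    using emb_output[OF V enc(3)[OF that]] enc(2)[OF that] by simp_all
  have outB: "qstate dB (outputB V dB dE (X m l))" and outE: "qstate dE (outputE V dB dE (X m l))" if "m < nM" "l < nL" for m l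
    using output_density[OF V X[OF that]] by auto
  define rest where "rest = idn dB - (\<Sum>m<nM. \<Sum>l<nL. L m l)"
  have rest: "pos rest" "car dB rest" using L by (auto simp: rest_def less_eq_fop_def intro!: rect_sum)
  \<comment> \<open>The outcome \<open>(0, 0)\<close> exists because both message sets are
    nonempty.\<close>
  define G where "G m l = L m l + (if m = 0 \<and> l = 0 then rest else 0)" for m l
  have G: "pos (G m l)" "car dB (G m l)" if "m < nM" "l < nL" for m l
    using L(1)[OF that] rest by (auto simp: G_def)
  define dec where "dec m l = mt dB (G m l)" for m l
  have dec: "dec m l \<in> carrier_mat dB dB" "psd (dec m l)" "emb (dec m l) = G m l" if "m < nM" "l < nL" for m l
    using G[OF that] emb_pos_iff[of "dec m l" dB] by (simp_all add: dec_def emb_mt)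
  have sumG: "(\<Sum>m<nM. \<Sum>l<nL. G m l) = idn dB"
  proof -
    have "(\<Sum>m<nM. \<Sum>l<nL. (if m = 0 \<and> l = 0 then rest else 0)) = (\<Sum>m<nM. if m = 0 then rest else 0)"
      using n by (intro sum.cong refl) auto
    also have "\<dots> = rest" using n by simp
    finally show ?thesis by (simp add: G_def sum.distrib rest_def)
  qed
  have "msum dB dB ({..<nM} \<times> {..<nL}) (\<lambda>(m,l). dec m l) = 1\<^sub>m dB"
  proof (rule emb_inj[OF msum_carrier one_carrier_mat])
    have "emb (msum dB dB ({..<nM} \<times> {..<nL}) (\<lambda>(m,l). dec m l)) = (\<Sum>x\<in>{..<nM} \<times> {..<nL}. emb (case x of (m,l) \<Rightarrow> dec m l))"
      by (rule emb_msum) (auto simp: dec_def)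
    also have "\<dots> = (\<Sum>m<nM. \<Sum>l<nL. G m l)"
      unfolding sum.cartesian_product by (intro sum.cong refl) (auto simp: dec)
    finally show "emb (msum dB dB ({..<nM} \<times> {..<nL}) (\<lambda>(m,l). dec m l)) = emb (1\<^sub>m dB)"
      by (simp add: sumG emb_one)
  qed
  moreover have "1 - (\<Sum>(m,l)\<in>{..<nM} \<times> {..<nL}.
            Re (mtrace (dec m l * ptr2 dB dE (chan V (enc m l))))) / (real nM * real nL) \<le> \<epsilon>1"
  proof -
    have N: "0 < real nM * real nL" using n by simp
    have "Re (mtrace (dec m l * ptr2 dB dE (chan V (enc m l)))) = tr (G m l * outputB V dB dE (X m l))" if "m < nM" "l < nL" for m l
    proof -
      have "dec m l * ptr2 dB dE (chan V (enc m l)) \<in> carrier_mat dB dB"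
        by (rule mult_carrier_mat[OF dec(1)[OF that] ptr_carrier(2)])
      then show ?thesis
        using emb_mult[OF dec(1)[OF that] ptr_carrier(2)] by (simp add: Re_mtrace dec(3)[OF that] eB[OF that])
    qed
    moreover have "1 - tr ((idn dB - L m l) * outputB V dB dE (X m l)) \<le> tr (G m l * outputB V dB dE (X m l))" if "m < nM" "l < nL" for m l
    proof -
      have "L m l \<le> G m l" using rest by (simp add: G_def less_eq_fop_def)
      then have "tr (L m l * outputB V dB dE (X m l)) \<le> tr (G m l * outputB V dB dE (X m l))" using outB[OF that] by (intro tr_mult_mono2) auto
      then show ?thesis using outB[OF that] by (simp add: left_diff_distrib rect_def)
    qed
    ultimately have "(\<Sum>m<nM. \<Sum>l<nL. 1 - tr ((idn dB - L m l) * outputB V dB dE (X m l)))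
        \<le> (\<Sum>m<nM. \<Sum>l<nL. Re (mtrace (dec m l * ptr2 dB dE (chan V (enc m l)))))"
      by (intro sum_mono) auto
    then have "real nM * real nL - real nM * real nL * \<epsilon>1 \<le> (\<Sum>m<nM. \<Sum>l<nL. Re (mtrace (dec m l * ptr2 dB dE (chan V (enc m l)))))"
      using err by (simp add: sum_subtractf)
    then have "(real nM * real nL) * (1 - \<epsilon>1) \<le> (\<Sum>(m,l)\<in>{..<nM} \<times> {..<nL}. Re (mtrace (dec m l * ptr2 dB dE (chan V (enc m l)))))"
      by (simp add: sum.cartesian_product right_diff_distrib)
    then have "1 - \<epsilon>1 \<le> (\<Sum>(m,l)\<in>{..<nM} \<times> {..<nL}. Re (mtrace (dec m l * ptr2 dB dE (chan V (enc m l))))) / (real nM * real nL)"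
      using N by (simp only: pos_le_divide_eq mult.commute)
    then show ?thesis by simp
  qed
  moreover have "\<forall>m<nM. \<exists>\<sigma>. is_state dE \<sigma> \<and>
        tnorm (msum (nL*dE) (nL*dE) {..<nL}
                  (\<lambda>l. rsmult (1 / real nL) (kron (proj nL l) (ptr1 dB dE (chan V (enc m l)))))
               - kron (rsmult (1 / real nL) (1\<^sub>m nL)) \<sigma>) / 2 \<le> \<epsilon>2"
  proof (intro allI impI)
    fix m assume m: "m < nM"
    obtain \<sigma> where \<sigma>: "pos \<sigma>" "car dE \<sigma>" "tr \<sigma> = 1" "(\<Sum>l<nL. tn (outputE V dB dE (X m l) - \<sigma>)) \<le> 2 * real nL * \<epsilon>2"
      using priv[OF m] by blast
    define M1 where "M1 = msum (nL*dE) (nL*dE) {..<nL} (\<lambda>l. rsmult (1 / real nL) (kron (proj nL l) (ptr1 dB dE (chan V (enc m l)))))"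
    define M2 where "M2 = kron (rsmult (1 / real nL) (1\<^sub>m nL)) (mt dE \<sigma>)"
    have pc: "proj nL l \<in> carrier_mat nL nL" for l by (simp add: proj_def)
    have c1: "M1 \<in> carrier_mat (nL*dE) (nL*dE)" by (simp add: M1_def msum_carrier)
    have dm: "rsmult (1 / real nL) (1\<^sub>m nL) = diagm nL (\<lambda>_. 1 / real nL)"
      by (rule eq_matI) (auto simp: rsmult_def diagm_def)
    have c2: "M2 \<in> carrier_mat (nL*dE) (nL*dE)" unfolding M2_def dm by (intro kron_carrier) simp_all
    have "emb M1 = (\<Sum>l<nL. (1 / real nL) *\<^sub>R emb (kron (proj nL l) (ptr1 dB dE (chan V (enc m l)))))"
      unfolding M1_def using kron_carrier[OF pc ptr_carrier(1)]
      by (subst emb_msum) (auto simp: emb_rsmult intro!: rsmult_carrier)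
    then have e1: "emb M1 = (\<Sum>l<nL. (1 / real nL) *\<^sub>R (slot dE l * outputE V dB dE (X m l) * dag (slot dE l)))"
      using eE[OF m] by (simp add: emb_kron_proj[OF ptr_carrier(1)])
    have e2: "emb M2 = (\<Sum>l<nL. (1 / real nL) *\<^sub>R (slot dE l * \<sigma> * dag (slot dE l)))"
      unfolding M2_def dm emb_kron_diagm[OF mt_carrier(1)] emb_mt[OF \<sigma>(2)] cqs_def ..
    have "tnorm (M1 - M2) = tn (\<Sum>l<nL. (1 / real nL) *\<^sub>R (slot dE l * (outputE V dB dE (X m l) - \<sigma>) * dag (slot dE l)))"
      unfolding tnorm_eq[OF minus_carrier_mat[OF c2]] emb_diff[OF c1 c2] e1 e2
      by (simp add: sum_subtractf right_diff_distrib left_diff_distrib scaleR_diff_right)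
    also have "\<dots> \<le> (\<Sum>l<nL. tn ((1 / real nL) *\<^sub>R (slot dE l * (outputE V dB dE (X m l) - \<sigma>) * dag (slot dE l))))"
      by (rule tn_sum) (use outE[OF m] \<sigma>(1) pos_dag in \<open>simp add: mult.assoc\<close>)
    also have "\<dots> = (\<Sum>l<nL. (1 / real nL) * tn (outputE V dB dE (X m l) - \<sigma>))"
      using outE[OF m] \<sigma>(2) by (intro sum.cong refl) (simp add: tn_scaleR tn_slot_conj)
    also have "\<dots> = (1 / real nL) * (\<Sum>l<nL. tn (outputE V dB dE (X m l) - \<sigma>))" by (simp add: sum_distrib_left)
    also have "\<dots> \<le> (1 / real nL) * (2 * real nL * \<epsilon>2)" using \<sigma>(4) by (intro mult_left_mono) auto
    also have "\<dots> = 2 * \<epsilon>2" using n by simp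
    finally have "tnorm (M1 - M2) / 2 \<le> \<epsilon>2" by simp
    moreover have "is_state dE (mt dE \<sigma>)" using \<sigma> by (simp add: is_state_iff emb_mt)
    ultimately show "\<exists>\<sigma>. is_state dE \<sigma> \<and> tnorm (msum (nL*dE) (nL*dE) {..<nL}
                  (\<lambda>l. rsmult (1 / real nL) (kron (proj nL l) (ptr1 dB dE (chan V (enc m l)))))
               - kron (rsmult (1 / real nL) (1\<^sub>m nL)) \<sigma>) / 2 \<le> \<epsilon>2"
      unfolding M1_def M2_def by blast
  qed
  ultimately show ?thesis using enc(1) dec(1,2) unfolding sim_pub_priv_code_def by blast
qed

section \<open>States and conditional informations of the theorem\<close>

lemma emb_cq_msum:
  assumes "\<And>y. y < n \<Longrightarrow> \<omega> y \<in> carrier_mat d d"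
  shows "emb (msum (n * d) (n * d) {..<n} (\<lambda>y. rsmult (w y) (kron (proj n y) (\<omega> y)))) = cqs d n w (\<lambda>y. emb (\<omega> y))"
proof -
  have p: "proj n y \<in> carrier_mat n n" for y by (simp add: proj_def)
  have "emb (msum (n * d) (n * d) {..<n} (\<lambda>y. rsmult (w y) (kron (proj n y) (\<omega> y))))
      = (\<Sum>y<n. emb (rsmult (w y) (kron (proj n y) (\<omega> y))))"
    by (rule emb_msum) (use assms p in \<open>auto intro!: rsmult_carrier kron_carrier\<close>)
  then show ?thesis using assms by (simp add: cqs_def emb_rsmult emb_kron_proj[of _ d])
qed

lemma emb_stXB:
  assumes B: "\<And>x y. x < nX \<Longrightarrow> y < nY \<Longrightarrow> emb (ptr2 dB dE (chan V (\<rho>in x y))) = B x y"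
    and p: "\<And>x. x < nX \<Longrightarrow> 0 < margX nY p x"
  shows "emb (stXB nX nY dB dE p V \<rho>in) = cqs dB nX (margX nY p) (\<lambda>x. \<Sum>y<nY. (p x y / margX nY p x) *\<^sub>R B x y)"
proof -
  have c: "proj n x \<in> carrier_mat n n" for n x by (simp add: proj_def)
  have "emb (stXB nX nY dB dE p V \<rho>in) = (\<Sum>z\<in>{..<nX} \<times> {..<nY}.
      emb (case z of (x, y) \<Rightarrow> rsmult (p x y) (kron (proj nX x) (ptr2 dB dE (chan V (\<rho>in x y))))))"
    unfolding stXB_def
    by (rule emb_msum) (auto intro!: rsmult_carrier kron_carrier c)
  also have "\<dots> = (\<Sum>x<nX. \<Sum>y<nY. p x y *\<^sub>R (slot dB x * B x y * dag (slot dB x)))"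
    unfolding sum.cartesian_product
    by (intro sum.cong refl) (auto simp: emb_rsmult emb_kron_proj[OF ptr_carrier(2)] B)
  also have "\<dots> = cqs dB nX (margX nY p) (\<lambda>x. \<Sum>y<nY. (p x y / margX nY p x) *\<^sub>R B x y)"
    unfolding cqs_def
  proof (intro sum.cong refl)
    fix x assume "x \<in> {..<nX}"
    then have "margX nY p x \<noteq> 0" using p[of x] by simp
    then show "(\<Sum>y<nY. p x y *\<^sub>R (slot dB x * B x y * dag (slot dB x))) =
        margX nY p x *\<^sub>R (slot dB x * (\<Sum>y<nY. (p x y / margX nY p x) *\<^sub>R B x y) * dag (slot dB x))"
      by (simp add: sum_distrib_left sum_distrib_right scaleR_sum_right)
  qed
  finally show ?thesis .
qed

lemma is_dist_ex_pos: "is_dist n q \<Longrightarrow> \<exists>x<n. 0 < q x"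
proof (rule ccontr)
  assume q: "is_dist n q" and "\<not> (\<exists>x<n. 0 < q x)"
  then have "(\<Sum>x<n. q x) = 0" by (intro sum.neutral) (force simp: is_dist_def)
  then show False using q by (simp add: is_dist_def)
qed

text \<open>Each minimum is one of the finitely many values \<open>f x\<close>, so the supremum over
  distributions is a maximum. The candidate set is nonempty because the marginal itself has distance
  0.\<close>

lemma IH_cond_attained:
  assumes "is_dist nX (margX nY p)" "0 \<le> \<eta>"
  shows "\<exists>q. is_dist nX q \<and> pdist (diagm nX q) (diagm nX (margX nY p)) \<le> \<eta> \<and>
    (\<forall>x<nX. 0 < q x \<longrightarrow> IH_cond \<eta> nX nY dB dE p V \<rho>in \<le> IH \<eta> nY dB (stYB nY dB dE p V \<rho>in x))"
proof -
  define f where "f x = IH \<eta> nY dB (stYB nY dB dE p V \<rho>in x)" for x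
  define Q where "Q = {q. is_dist nX q \<and> pdist (diagm nX q) (diagm nX (margX nY p)) \<le> \<eta>}"
  define F where "F q = {f x | x. x < nX \<and> q x > 0}" for q :: "nat \<Rightarrow> real"
  define Z where "Z = (\<lambda>q. Min (F q)) ` Q"
  have fin: "finite (F q)" for q unfolding F_def by simp
  have ne: "F q \<noteq> {}" if "q \<in> Q" for q using is_dist_ex_pos[of nX q] that by (auto simp: F_def Q_def)
  have "Z \<subseteq> f ` {..<nX}"
  proof
    fix z assume "z \<in> Z"
    then obtain q where "q \<in> Q" "z = Min (F q)" by (auto simp: Z_def)
    then have "z \<in> F q" using Min_in[OF fin ne] by simp
    then show "z \<in> f ` {..<nX}" by (auto simp: F_def)
  qed
  then have finZ: "finite Z" by (rule finite_subset) simp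
  have "margX nY p \<in> Q" using assms by (simp add: Q_def pdist_diagm_refl)
  then have neZ: "Z \<noteq> {}" by (auto simp: Z_def)
  have "IH_cond \<eta> nX nY dB dE p V \<rho>in = Sup Z"
    unfolding IH_cond_def Z_def Q_def F_def f_def by (rule arg_cong[of _ _ Sup]) auto
  also have "Sup Z = Max Z" using finZ neZ by (rule cSup_eq_Max)
  also have "\<dots> \<in> Z" using finZ neZ by (rule Max_in)
  finally obtain q where q: "q \<in> Q" "IH_cond \<eta> nX nY dB dE p V \<rho>in = Min (F q)" by (auto simp: Z_def)
  have "IH_cond \<eta> nX nY dB dE p V \<rho>in \<le> f x" if "x < nX" "0 < q x" for x
    unfolding q(2) using fin that by (intro Min_le) (auto simp: F_def)
  then show ?thesis using q(1) by (auto simp: Q_def f_def)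
qed

text \<open>Attainment is not established, but a strict upper bound passes through each of the
  nested infima.\<close>

lemma Imax_cond_less:
  assumes "Imax_cond \<eta> nX nY dB dE p V \<rho>in < ereal b"
  shows "\<exists>q. is_dist nX q \<and> pdist (diagm nX q) (diagm nX (margX nY p)) \<le> \<eta> \<and>
    (\<forall>x<nX. 0 < q x \<longrightarrow> (\<exists>\<rho>'\<in>pball (nY * dE) \<eta> (stYE nY dB dE p V \<rho>in x). \<exists>t<b.
       dominated nY dE (stYE nY dB dE p V \<rho>in x) \<rho>' t))"
proof -
  define f where "f x = Inf {Dmax \<rho>' (kron (ptr2 nY dE (stYE nY dB dE p V \<rho>in x)) (ptr1 nY dE \<rho>')) | \<rho>'.
                      \<rho>' \<in> pball (nY*dE) \<eta> (stYE nY dB dE p V \<rho>in x)}" for x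
  obtain q where q: "is_dist nX q" "pdist (diagm nX q) (diagm nX (margX nY p)) \<le> \<eta>"
    "Max {f x | x. x < nX \<and> q x > 0} < ereal b"
    using assms unfolding Imax_cond_def f_def Inf_less_iff by blast
  have "\<exists>\<rho>'\<in>pball (nY * dE) \<eta> (stYE nY dB dE p V \<rho>in x). \<exists>t<b.
       dominated nY dE (stYE nY dB dE p V \<rho>in x) \<rho>' t"
    if x: "x < nX" "0 < q x" for x
  proof -
    have "f x \<le> Max {f x | x. x < nX \<and> q x > 0}" using x by (intro Max_ge) auto
    then have "f x < ereal b" using q(3) by (rule order_le_less_trans)
    then obtain \<rho>' where \<rho>': "\<rho>' \<in> pball (nY*dE) \<eta> (stYE nY dB dE p V \<rho>in x)"
      "Dmax \<rho>' (kron (ptr2 nY dE (stYE nY dB dE p V \<rho>in x)) (ptr1 nY dE \<rho>')) < ereal b"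
      unfolding f_def Inf_less_iff by blast
    then obtain t where "dominated nY dE (stYE nY dB dE p V \<rho>in x) \<rho>' t" "t < b"
      unfolding Dmax_def Inf_less_iff by auto
    then show ?thesis using \<rho>'(1) by blast
  qed
  then show ?thesis using q by blast
qed

text \<open>Excludes the value minus infinity; plus infinity is excluded by the rate bound, so the
  leakage term becomes a real number.\<close>

lemma Imax_cond_nonneg:
  assumes "\<And>x \<rho>' t. x < nX \<Longrightarrow> \<rho>' \<in> pball (nY*dE) \<eta> (stYE nY dB dE p V \<rho>in x) \<Longrightarrow>
     dominated nY dE (stYE nY dB dE p V \<rho>in x) \<rho>' t \<Longrightarrow> 0 \<le> t"
  shows "0 \<le> Imax_cond \<eta> nX nY dB dE p V \<rho>in"
proof -
  define f where "f x = Inf {Dmax \<rho>' (kron (ptr2 nY dE (stYE nY dB dE p V \<rho>in x)) (ptr1 nY dE \<rho>')) | \<rho>'.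
                      \<rho>' \<in> pball (nY*dE) \<eta> (stYE nY dB dE p V \<rho>in x)}" for x
  have f: "0 \<le> f x" if "x < nX" for x
    unfolding f_def Dmax_def using assms[OF that] by (auto intro!: Inf_greatest)
  have "0 \<le> Max {f x | x. x < nX \<and> q x > 0}" if "is_dist nX q" for q
  proof -
    obtain x where x: "x < nX" "0 < q x" using is_dist_ex_pos[OF \<open>is_dist nX q\<close>] by blast
    then have "f x \<le> Max {f x | x. x < nX \<and> q x > 0}" by (intro Max_ge) auto
    then show ?thesis using f[OF x(1)] by (rule order_trans[rotated])
  qed
  then show ?thesis unfolding Imax_cond_def f_def[symmetric] by (auto intro!: Inf_greatest)
qed

text \<open>Here \<open>u\<close> is the square root of \<epsilon>, and 5 is the sum of the
  coefficients 3 and 2. Beyond \<open>3 * u\<^sup>2 + s\<close> the terms amount to at most (1/27 +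
  2/3 + 1/2) u, below the available 2 u: the inflation contributes 5/2 s u, of which 2 s u is
  absorbed by \<open>s\<^sup>2 \<le> s * (1 - 2 * u)\<close>.\<close>

lemma error_budget:
  fixes s u \<delta> \<delta>' :: real
  assumes u: "0 < u" and s: "0 < s" and \<delta>: "0 < \<delta>" "\<delta> < u\<^sup>2" "0 < \<delta>'" "\<delta>' < s"
    and small: "3 * u\<^sup>2 + 2 * u + s < 1"
  shows "(u\<^sup>2 - \<delta>)\<^sup>2 + (s - \<delta>')\<^sup>2 + (s + 2 * (u\<^sup>2 + u)) / (2 * (u\<^sup>2 + u)) * (5 * u\<^sup>2) \<le> 3 * u\<^sup>2 + 2 * u + s"
proof -
  \<comment> \<open>The product is \<open>1 - 2 * u - 3 * u\<^sup>2\<close>, which exceeds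
    \<open>s\<close>.\<close>
  have "0 < (1 - 3 * u) * (1 + u)" using small s by (simp add: power2_eq_square algebra_simps)
  then have u3: "u < 1 / 3" using u by (simp add: zero_less_mult_iff)
  have uu: "u\<^sup>2 \<le> u / 3" using u u3 by (simp add: power2_eq_square)
  have "(u\<^sup>2 - \<delta>)\<^sup>2 \<le> (u\<^sup>2)\<^sup>2" using \<delta> by (intro power_mono) auto
  also have "\<dots> \<le> (u / 3)\<^sup>2" using uu by (intro power_mono) auto
  also have "\<dots> \<le> u / 27" using uu by (simp add: power2_eq_square)
  finally have 1: "(u\<^sup>2 - \<delta>)\<^sup>2 \<le> u / 27" .
  have "(s - \<delta>')\<^sup>2 \<le> s\<^sup>2" using \<delta> by (intro power_mono) auto
  also have "s\<^sup>2 \<le> s * (1 - 2 * u)"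
  proof -
    have "0 \<le> u\<^sup>2" by simp
    then have "s \<le> 1 - 2 * u" using small by linarith
    then show ?thesis unfolding power2_eq_square using s by (intro mult_left_mono) auto
  qed
  finally have 2: "(s - \<delta>')\<^sup>2 \<le> s - 2 * (s * u)" by (simp add: algebra_simps)
  have "(s + 2 * (u\<^sup>2 + u)) / (2 * (u\<^sup>2 + u)) = 1 + s / (2 * (u\<^sup>2 + u))"
    using u by (simp add: add_divide_distrib add_pos_pos less_imp_neq[THEN not_sym])
  then have "(s + 2 * (u\<^sup>2 + u)) / (2 * (u\<^sup>2 + u)) * (5 * u\<^sup>2) = 5 * u\<^sup>2 + 5 / 2 * (s * (u\<^sup>2 / (u\<^sup>2 + u)))"
    by (simp add: algebra_simps)
  also have "u\<^sup>2 / (u\<^sup>2 + u) \<le> u"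
    using u by (simp add: pos_divide_le_eq add_pos_pos) (simp add: power2_eq_square algebra_simps)
  finally have 3: "(s + 2 * (u\<^sup>2 + u)) / (2 * (u\<^sup>2 + u)) * (5 * u\<^sup>2) \<le> 5 * u\<^sup>2 + 5 / 2 * (s * u)"
    using s by (simp add: mult_left_mono)
  have "s * u \<le> 1 * u"
  proof (rule mult_right_mono)
    have "0 \<le> u\<^sup>2" by simp
    then show "s \<le> 1" using small u by linarith
  qed (use u in simp)
  then show ?thesis using 1 2 3 uu u by linarith
qed

theorem theorem2:
  fixes dA dB dE nX nY nM nL :: nat
    and V :: "complex mat"
    and p :: "nat \<Rightarrow> nat \<Rightarrow> real"
    and \<rho>in :: "nat \<Rightarrow> nat \<Rightarrow> complex mat"
    and \<epsilon> \<epsilon>' \<delta> \<delta>' :: real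
  assumes V: "isometry dA (dB * dE) V"
    and eps: "0 < \<epsilon>" "\<epsilon> < 1" "0 < \<epsilon>'" "\<epsilon>' < 1"
    and del: "0 < \<delta>" "\<delta> < \<epsilon>" "0 < \<delta>'" "\<delta>' < \<epsilon>'"
    and msg: "0 < nM" "0 < nL"
    and pnn: "\<forall>x<nX. \<forall>y<nY. p x y \<ge> 0"
    and psum: "(\<Sum>(x,y)\<in>{..<nX} \<times> {..<nY}. p x y) = 1"
    and psupp: "\<forall>x<nX. margX nY p x > 0"
    and inp: "\<forall>x<nX. \<forall>y<nY. is_state dA (\<rho>in x y)"
    and r_bound: "log 2 (real nM) \<le> IH (\<epsilon> - \<delta>) nX dB (stXB nX nY dB dE p V \<rho>in)
                                     - log 2 (4 * \<epsilon> / \<delta>\<^sup>2)"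
    and R_bound: "ereal (log 2 (real nL)) \<le>
                    ereal (IH_cond (\<epsilon> - \<delta>) nX nY dB dE p V \<rho>in)
                    - Imax_cond (sqrt \<epsilon>' - \<delta>') nX nY dB dE p V \<rho>in
                    - ereal (log 2 (4 * \<epsilon> / \<delta>\<^sup>2)) - ereal (2 * log 2 (1 / \<delta>'))"
  shows "\<exists>enc dec. sim_pub_priv_code dA dB dE V nM nL
            (3 * \<epsilon> + 2 * sqrt \<epsilon> + sqrt \<epsilon>') (2 * (\<epsilon> + sqrt \<epsilon>) + sqrt \<epsilon>') enc dec"
proof -
  define outB where "outB = outputB V dB dE"
  define outE where "outE = outputE V dB dE"
  have lin: "outB (c *\<^sub>R (\<Sum>i\<in>S. f i)) = c *\<^sub>R (\<Sum>i\<in>S. outB (f i))"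
    "outE (c *\<^sub>R (\<Sum>i\<in>S. f i)) = c *\<^sub>R (\<Sum>i\<in>S. outE (f i))" for S :: "nat set" and f c
    unfolding outB_def outE_def outputB_def outputE_def chn_scaleR chn_sum by simp_all
  define X0 where "X0 x y = emb (\<rho>in x y)" for x y
  have X0: "pos (X0 x y)" "car dA (X0 x y)" "tr (X0 x y) = 1" "\<rho>in x y \<in> carrier_mat dA dA" if "x < nX" "y < nY" for x y
    using inp that rect_emb by (auto simp: X0_def is_state_iff)
  have eB: "emb (ptr2 dB dE (chan V (\<rho>in x y))) = outB (X0 x y)" and eE: "emb (ptr1 dB dE (chan V (\<rho>in x y))) = outE (X0 x y)"
    if "x < nX" "y < nY" for x y
    using emb_output[OF V X0(4)[OF that]] by (simp_all add: outB_def outE_def X0_def)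
  have oE: "y < nY \<Longrightarrow> car dE (outE (X0 x y))" "y < nY \<Longrightarrow> pos (outE (X0 x y))" "y < nY \<Longrightarrow> tr (outE (X0 x y)) = 1"
    and oB: "y < nY \<Longrightarrow> car dB (outB (X0 x y))" "y < nY \<Longrightarrow> pos (outB (X0 x y))" "y < nY \<Longrightarrow> tr (outB (X0 x y)) = 1"
    if "x < nX" for x y
    using output_density[OF V] X0[OF that] by (simp_all add: outB_def outE_def)
  have "nX \<noteq> 0 \<and> nY \<noteq> 0" using psum by (cases "nX = 0"; cases "nY = 0") auto
  then have nX: "0 < nX" and nY: "0 < nY" by auto
  define w where "w = margX nY p"
  define u where "u x y = p x y / w x" for x y
  have w0: "0 < w x" if "x < nX" for x using psupp that by (simp add: w_def)
  have wsum: "(\<Sum>x<nX. w x) = 1" using psum by (simp add: w_def margX_def sum.cartesian_product)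
  have w: "pdf {..<nX} w" using w0 wsum less_imp_le by (auto simp: pdf_def)
  have wdist: "is_dist nX w" using w0 wsum less_imp_le by (auto simp: is_dist_def)
  have u: "pdf {..<nY} (u x)" if "x < nX" for x
    using pnn w0[OF that] that by (auto simp: pdf_def u_def w_def margX_def simp flip: sum_divide_distrib)
  define \<epsilon>1 where "\<epsilon>1 = 3 * \<epsilon> + 2 * sqrt \<epsilon> + sqrt \<epsilon>'"
  define s where "s = sqrt \<epsilon>'"
  define t where "t = 2 * (\<epsilon> + sqrt \<epsilon>)"
  have s: "0 < s" "0 < t" using eps by (auto simp: s_def t_def intro: add_pos_pos)
  \<comment> \<open>Since \<epsilon>' < 1 it lies below its square root; this turns the bound on
    \<delta>' into a nonnegative smoothing radius \<open>s - \<delta>'\<close>.\<close>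
  have "\<epsilon>' < s"
  proof -
    have "sqrt \<epsilon>' < sqrt 1" using eps by (intro real_sqrt_less_mono) simp
    then have "s * s < s * 1" using s by (intro mult_strict_left_mono) (simp_all add: s_def)
    then show ?thesis using eps by (simp add: s_def)
  qed
  then have ds: "\<delta>' < s" "\<delta>' < 1" using del eps by auto
  have "\<exists>enc dec. sim_pub_priv_code dA dB dE V nM nL \<epsilon>1 (s + t) enc dec"
  proof (cases "1 \<le> \<epsilon>1")
    \<comment> \<open>An error of at least 1 is met by a constant encoder with zero effects, which
      leaks nothing.\<close>
    case True
    show ?thesis
    proof (rule code_from_operators[OF V msg, where X = "\<lambda>_ _. X0 0 0" and L = "\<lambda>_ _. 0"])
      have "(\<Sum>m<nM. \<Sum>l<nL. tr ((idn dB - 0) * outB (X0 0 0))) = real nM * real nL"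
        using oB[OF nX nY] by (simp add: rect_def)
      also have "\<dots> \<le> real nM * real nL * \<epsilon>1" using True msg by simp
      finally show "(\<Sum>m<nM. \<Sum>l<nL. tr ((idn dB - 0) * outputB V dB dE (X0 0 0))) \<le> real nM * real nL * \<epsilon>1"
        unfolding outB_def .
      show "\<exists>\<sigma>. qstate dE \<sigma> \<and> (\<Sum>l<nL. tn (outputE V dB dE (X0 0 0) - \<sigma>)) \<le> 2 * real nL * (s + t)" for m
        using oE[OF nX nY] s by (intro exI[of _ "outE (X0 0 0)"]) (simp add: outE_def)
    qed (use X0[OF nX nY] in auto)
  next
    case False
    define \<eta>B where "\<eta>B = \<epsilon> - \<delta>"
    define \<eta>E where "\<eta>E = s - \<delta>'"
    have \<eta>: "0 \<le> \<eta>B" "0 \<le> \<eta>E" using del ds by (simp_all add: \<eta>B_def \<eta>E_def)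
    define h where "h = IH_cond \<eta>B nX nY dB dE p V \<rho>in"
    define Bx where "Bx x = (\<Sum>y<nY. u x y *\<^sub>R outB (X0 x y))" for x
    have Bx: "pos (Bx x)" "car dB (Bx x)" "tr (Bx x) = 1" if "x < nX" for x
      unfolding Bx_def using oB[OF that] u[OF that] by (auto simp: pdf_def intro!: pos_sum pos_scaleR rect_sum)
    define XB where "XB = stXB nX nY dB dE p V \<rho>in"
    define YB where "YB = stYB nY dB dE p V \<rho>in"
    define YE where "YE = stYE nY dB dE p V \<rho>in"
    have cXB: "XB \<in> carrier_mat (nX * dB) (nX * dB)" by (simp add: XB_def stXB_def msum_carrier)
    have eXB: "emb (XB) = cqs dB nX w Bx"
      unfolding XB_def w_def Bx_def[abs_def] u_def by (rule emb_stXB) (use eB psupp in auto)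
    have cYB: "YB x \<in> carrier_mat (nY * dB) (nY * dB)" for x by (simp add: YB_def stYB_def msum_carrier)
    have cYE: "YE x \<in> carrier_mat (nY * dE) (nY * dE)" for x by (simp add: YE_def stYE_def msum_carrier)
    have eYB: "emb (YB x) = cqs dB nY (u x) (\<lambda>y. outB (X0 x y))" if "x < nX" for x
      unfolding YB_def stYB_def using emb_cq_msum[of nY "\<lambda>y. ptr2 dB dE (chan V (\<rho>in x y))" dB "\<lambda>y. p x y / margX nY p x"] eB[OF that]
      by (simp add: cqs_def u_def w_def)
    have eYE: "emb (YE x) = cqs dE nY (u x) (\<lambda>y. outE (X0 x y))" if "x < nX" for x
      unfolding YE_def stYE_def using emb_cq_msum[of nY "\<lambda>y. ptr1 dB dE (chan V (\<rho>in x y))" dE "\<lambda>y. p x y / margX nY p x"] eE[OF that]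
      by (simp add: cqs_def u_def w_def)
    have stYE: "is_state (nY * dE) (YE x)" if x: "x < nX" for x
    proof -
      have "pos (slot dE y * outE (X0 x y) * dag (slot dE y))" if "y < nY" for y
        using pos_conj[OF oE(2)[OF x that], of "dag (slot dE y)"] by simp
      then have "pos (emb (YE x))"
        unfolding eYE[OF x] cqs_def using u[OF x] by (intro pos_sum pos_scaleR) (auto simp: pdf_def)
      moreover have "tr (emb (YE x)) = 1"
      proof -
        have "tr (slot dE y * outE (X0 x y) * dag (slot dE y)) = 1" if y: "y < nY" for y
        proof -
          have "tr (slot dE y * outE (X0 x y) * dag (slot dE y)) = tr (outE (X0 x y) * (dag (slot dE y) * slot dE y))"
            using tr_comm[of "slot dE y" "outE (X0 x y) * dag (slot dE y)"] by (simp add: mult.assoc)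
          then show ?thesis using oE[OF x y] by (simp add: slot_slot rect_def)
        qed
        then show ?thesis unfolding eYE[OF x] using u[OF x] by (simp add: cqs_def pdf_def)
      qed
      ultimately show ?thesis using cYE by (simp add: is_state_iff)
    qed
    have M0: "0 \<le> Imax_cond \<eta>E nX nY dB dE p V \<rho>in"
    proof (rule Imax_cond_nonneg, fold YE_def)
      fix x \<rho>' b
      assume x: "x < nX" and a: "\<rho>' \<in> pball (nY*dE) \<eta>E (YE x)"
        "dominated nY dE (YE x) \<rho>' b"
      show "0 \<le> b" by (rule privacy_nonneg[OF stYE[OF x] eYE[OF x] _ _ _ u[OF x] a]) (use oE[OF x] in auto)
    qed
    \<comment> \<open>An infinite leakage term would make the right side of the rate bound minus
      infinity, below the finite left side.\<close>
    obtain m0 where m0: "Imax_cond \<eta>E nX nY dB dE p V \<rho>in = ereal m0" "0 \<le> m0"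
      using M0 R_bound unfolding \<eta>E_def s_def by (cases "Imax_cond (sqrt \<epsilon>' - \<delta>') nX nY dB dE p V \<rho>in") auto
    define la where "la = log 2 (4 * \<epsilon> / \<delta>\<^sup>2)"
    have R: "log 2 (real nL) + m0 + 2 * log 2 (1 / \<delta>') \<le> h - la"
      using R_bound m0(1) unfolding \<eta>B_def \<eta>E_def s_def h_def la_def by simp
    obtain qB where qB: "is_dist nX qB" "pdist (diagm nX qB) (diagm nX w) \<le> \<eta>B"
      "\<And>x. x < nX \<Longrightarrow> 0 < qB x \<Longrightarrow> h \<le> IH \<eta>B nY dB (YB x)"
      using IH_cond_attained[of nX nY p \<eta>B dB dE V \<rho>in] wdist \<eta> unfolding w_def h_def YB_def by blast
    \<comment> \<open>The offset 1 gives a strict bound above the infimum; it costs a factor 2 in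
      the number of randomizers.\<close>
    obtain qE where qE: "is_dist nX qE" "pdist (diagm nX qE) (diagm nX w) \<le> \<eta>E"
      "\<And>x. x < nX \<Longrightarrow> 0 < qE x \<Longrightarrow> \<exists>\<rho>'\<in>pball (nY * dE) \<eta>E (YE x). \<exists>b<m0 + 1.
         dominated nY dE (YE x) \<rho>' b"
      using Imax_cond_less[of \<eta>E nX nY dB dE p V \<rho>in "m0 + 1"] m0 unfolding w_def YE_def by auto
    define S where "S = {x. x < nX \<and> 0 < qB x \<and> 0 < qE x}"
    have Sc: "(\<Sum>x<nX. w x * (if x \<in> S then 0 else 1)) \<le> \<eta>B\<^sup>2 + \<eta>E\<^sup>2"
    proof -
      have "(\<Sum>x<nX. w x * (if x \<in> S then 0 else 1)) = (\<Sum>x\<in>{x. x < nX \<and> x \<notin> S}. w x)"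
        by (rule sum.mono_neutral_cong_right) auto
      also have "\<dots> \<le> (\<Sum>x\<in>{x. x < nX \<and> \<not> 0 < qB x} \<union> {x. x < nX \<and> \<not> 0 < qE x}. w x)"
        using w0 by (intro sum_mono2) (auto simp: S_def less_imp_le)
      also have "\<dots> \<le> (\<Sum>x | x < nX \<and> \<not> 0 < qB x. w x) + (\<Sum>x | x < nX \<and> \<not> 0 < qE x. w x)"
        using w0 by (subst sum_Un) (auto intro!: sum_nonneg simp: less_imp_le)
      also have "\<dots> \<le> \<eta>B\<^sup>2 + \<eta>E\<^sup>2"
        using pdist_diagm_support[OF qB(1) _ wsum qB(2) \<eta>(1)] pdist_diagm_support[OF qE(1) _ wsum qE(2) \<eta>(2)] w0
        by (intro add_mono) (auto simp: less_imp_le)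
      finally show ?thesis .
    qed
    \<comment> \<open>The ideal number of randomizers: \<open>nL * r\<close> exhausts what the
      decoder can resolve, and the rate bound leaves \<open>r\<close> at least
      \<open>2 powr m0 / \<delta>'\<^sup>2\<close>.\<close>
    define r where "r = 2 powr (h - la) / real nL"
    have r: "2 powr m0 / \<delta>'\<^sup>2 \<le> r"
    proof -
      have "2 powr (log 2 (real nL) + m0 + 2 * log 2 (1 / \<delta>')) \<le> 2 powr (h - la)" using R by simp
      moreover have "2 powr (2 * log 2 (1 / \<delta>')) = (1 / \<delta>')\<^sup>2"
      proof -
        have "2 powr (2 * log 2 (1 / \<delta>')) = (2 powr log 2 (1 / \<delta>')) powr 2" by (simp add: powr_powr mult.commute)
        also have "2 powr log 2 (1 / \<delta>') = 1 / \<delta>'" using del by simp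
        finally show ?thesis using del by simp
      qed
      ultimately have "real nL * 2 powr m0 * (1 / \<delta>')\<^sup>2 \<le> 2 powr (h - la)" using msg by (simp add: powr_add)
      then show ?thesis using msg by (simp add: r_def pos_le_divide_eq power_divide mult_ac)
    qed
    have "1 \<le> 2 powr m0 / \<delta>'\<^sup>2"
    proof -
      have "\<delta>'\<^sup>2 \<le> 1" using del ds by (simp add: power_le_one)
      moreover have "1 \<le> 2 powr m0" using m0 by (simp add: ge_one_powr_ge_zero)
      ultimately show ?thesis using del by (simp add: pos_le_divide_eq)
    qed
    then have r1: "1 \<le> r" using r by linarith
    (* Rounding down can halve the number of randomizers; the trace-norm form of convex splitting has a factor 2 to spare. *)
    define K where "K = nat \<lfloor>r\<rfloor>"
    have K: "0 < K" "real K \<le> r" "r \<le> 2 * real K"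
    proof -
      have "1 \<le> \<lfloor>r\<rfloor>" using r1 by simp
      then have "real K = of_int \<lfloor>r\<rfloor>" unfolding K_def by simp
      moreover from this \<open>1 \<le> \<lfloor>r\<rfloor>\<close> have "1 \<le> K" by linarith
      ultimately have *: "real K = of_int \<lfloor>r\<rfloor>" "1 \<le> K" by auto
      then show "0 < K" "real K \<le> r" by auto
      have "r < real K + 1" using * by linarith
      then show "r \<le> 2 * real K" using *(2) by linarith
    qed
    have logK: "log 2 (real (nL * K)) \<le> h - la"
    proof -
      have "real (nL * K) \<le> real nL * r" using K(2) by (simp add: mult_left_mono)
      also have "\<dots> = 2 powr (h - la)" using msg by (simp add: r_def)
      finally have "log 2 (real (nL * K)) \<le> log 2 (2 powr (h - la))" using K(1) msg by (subst log_le_cancel_iff) auto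
      then show ?thesis by simp
    qed
    define \<kappa> where "\<kappa> = (s + t) / t"
    have \<kappa>: "0 \<le> \<kappa>" using s by (simp add: \<kappa>_def)
    \<comment> \<open>Uniform in the public effect \<open>E\<close>, and the error is affine in its
      failure on \<open>Bx x\<close>, so the bound can be averaged over public codebooks. Outside
      \<open>S\<close> the extra summand 1 makes the error claim trivial.\<close>
    have inner_code: "\<exists>X L \<sigma>. (\<forall>l<nL. qstate dA (X l)) \<and> (\<forall>l<nL. pos (L l) \<and> car dB (L l)) \<and>
        (\<Sum>l<nL. L l) \<le> E \<and> qstate dE \<sigma> \<and> (\<Sum>l<nL. tn (outE (X l) - \<sigma>)) \<le> 2 * real nL * (s + t) \<and>
        (\<Sum>l<nL. tr ((idn dB - L l) * outB (X l))) \<le> real nL * ((if x \<in> S then 0 else 1) + \<kappa> * (3 * tr ((idn dB - E) * Bx x) + 2 * \<epsilon>))"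
      if x: "x < nX" and E: "pos E" "E \<le> idn dB" "car dB E" for x E
    proof (cases "x \<in> S")
      case True
      then have xS: "0 < qB x" "0 < qE x" by (auto simp: S_def)
      obtain \<rho>' b where \<rho>': "\<rho>' \<in> pball (nY * dE) \<eta>E (YE x)" "b < m0 + 1"
        "dominated nY dE (YE x) \<rho>' b"
        using qE(3)[OF x xS(2)] by blast
      define \<sigma> where "\<sigma> = emb (ptr1 nY dE \<rho>')"
      have "pos \<sigma>" unfolding \<sigma>_def
        by (rule privacy(2)[OF stYE[OF x] eYE[OF x] _ _ _ u[OF x] \<rho>'(1,3)]) (use oE[OF x] in auto)
      moreover have "car dE \<sigma>" unfolding \<sigma>_def
        by (rule privacy(3)[OF stYE[OF x] eYE[OF x] _ _ _ u[OF x] \<rho>'(1,3)]) (use oE[OF x] in auto)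
      moreover have "tr \<sigma> = 1" unfolding \<sigma>_def
        by (rule privacy(4)[OF stYE[OF x] eYE[OF x] _ _ _ u[OF x] \<rho>'(1,3)]) (use oE[OF x] in auto)
      ultimately have \<sigma>: "pos \<sigma>" "car dE \<sigma>" "tr \<sigma> = 1" by auto
      define I where "I = {..<nL} \<times> {..<K}"
      have priv: "expect I {..<nY} (u x) (\<lambda>c. tn ((1 / real K) *\<^sub>R (\<Sum>k<K. outE (X0 x (c (l, k)))) - \<sigma>)) \<le> 2 * s"
        if l: "l < nL" for l
      proof -
        define J where "J = Pair l ` {..<K}"
        have J: "finite I" "J \<subseteq> I" "J \<noteq> {}" "card J = K"
          using l K(1) by (auto simp: I_def J_def card_image inj_on_def)
        have "expect I {..<nY} (u x) (\<lambda>c. tn ((1 / real (card J)) *\<^sub>R (\<Sum>i\<in>J. outE (X0 x (c i))) - \<sigma>))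
            \<le> 2 * \<eta>E + sqrt (2 powr b / real (card J))"
          unfolding \<sigma>_def
          by (rule privacy_bound[OF stYE[OF x] eYE[OF x] _ _ _ u[OF x] \<rho>'(1,3) J(1,2,3)]) (use oE[OF x] in auto)
        moreover have "(\<Sum>i\<in>J. outE (X0 x (c i))) = (\<Sum>k<K. outE (X0 x (c (l, k))))" for c
          unfolding J_def by (subst sum.reindex) (auto simp: inj_on_def)
        \<comment> \<open>One factor 2 comes from \<open>b < m0 + 1\<close>, another from rounding
          \<open>r\<close>; together they give \<open>(2 * \<delta>')\<^sup>2\<close>. Adding
          \<open>2 * \<eta>E\<close> yields exactly \<open>2 * s\<close>.\<close>
        moreover have "sqrt (2 powr b / real K) \<le> 2 * \<delta>'"
        proof (rule real_le_lsqrt)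
          have "2 powr b \<le> 2 powr (m0 + 1)" using \<rho>'(2) by simp
          also have "\<dots> = 2 * 2 powr m0" by (simp add: powr_add)
          also have "\<dots> \<le> 2 * (r * \<delta>'\<^sup>2)" using r del by (simp add: pos_divide_le_eq)
          also have "\<dots> \<le> 2 * ((2 * real K) * \<delta>'\<^sup>2)" using K(3) by (intro mult_left_mono mult_right_mono) auto
          finally show "2 powr b / real K \<le> (2 * \<delta>')\<^sup>2" using K(1) by (simp add: pos_divide_le_eq power_mult_distrib mult_ac)
        qed (use del in auto)
        ultimately show ?thesis by (simp add: J(4) \<eta>E_def)
      qed
      have N: "log 2 (real (nL * K)) \<le> IH (\<epsilon> - \<delta>) nY dB (YB x) - log 2 (4 * \<epsilon> / \<delta>\<^sup>2)"
        using logK qB(3)[OF x xS(1)] unfolding la_def \<eta>B_def by linarith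
      have e1: "0 \<le> tr ((idn dB - E) * Bx x)" using E Bx[OF x] by (intro tr_mult_pos) (auto simp: less_eq_fop_def)
      have "\<exists>X L. (\<forall>l<nL. qstate dA (X l)) \<and> (\<forall>l<nL. pos (L l) \<and> car dB (L l)) \<and>
        (\<Sum>l<nL. L l) \<le> E \<and> (\<Sum>l<nL. tn (outE (X l) - \<sigma>)) \<le> 2 * real nL * (s + t) \<and>
        (\<Sum>l<nL. tr ((idn dB - L l) * outB (X l))) \<le> real nL * ((s + t) / t * (3 * tr ((idn dB - E) * Bx x) + 2 * \<epsilon>))"
        by (rule private_code[where ?X0.0 = "X0 x" and n = nY and a = dA, OF _ _ _ _ _ _ lin u[OF x] cYB eYB[OF x] del(1,2) eps(2) msg(2) K(1) N _ E s(2)])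
          (use X0[OF x] oB[OF x] priv e1 in \<open>auto simp: Bx_def I_def\<close>)
      then show ?thesis using \<sigma> True unfolding \<kappa>_def by (simp only: if_True add_0_left) blast
    next
      \<comment> \<open>All private messages share one input state, whose own output serves as the
        reference state, and all effects are zero.\<close>
      case notS: False
      have e1: "0 \<le> tr ((idn dB - E) * Bx x)" using E Bx[OF x] by (intro tr_mult_pos) (auto simp: less_eq_fop_def)
      have "real nL * 1 \<le> real nL * (1 + \<kappa> * (3 * tr ((idn dB - E) * Bx x) + 2 * \<epsilon>))"
        using e1 \<kappa> eps by (intro mult_left_mono) auto
      moreover have "tr (idn dB * outB (X0 x 0)) = 1"
        using oB[OF x nY] by (simp add: rect_def)
      moreover have "(\<Sum>l<nL. tn (outE (X0 x 0) - outE (X0 x 0))) \<le> 2 * real nL * (s + t)" using s by simp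
      ultimately show ?thesis
        using X0[OF x nY] oE[OF x nY] notS E(1)
        by - (rule exI[of _ "\<lambda>_. X0 x 0"], rule exI[of _ "\<lambda>_. 0::fop"], rule exI[of _ "outE (X0 x 0)"], simp)
    qed
    define I where "I = {..<nM}"
    have I: "finite I" "I \<noteq> {}" using msg by (auto simp: I_def)
    have rb: "log 2 (real (card I)) \<le> IH (\<epsilon> - \<delta>) nX dB (XB) - log 2 (4 * \<epsilon> / \<delta>\<^sup>2)"
      using r_bound by (simp add: I_def XB_def)
    have "\<exists>D. (\<forall>c\<in>PiE I (\<lambda>_. {..<nX}). subpovm dB I (D c)) \<and>
       (\<forall>i\<in>I. expect I {..<nX} w (\<lambda>c. tr ((idn dB - D c i) * Bx (c i))) \<le> \<epsilon>)"
      by (rule random_coding_IH[OF cXB eXB _ _ _ w del(1,2) eps(2) I rb]) (use Bx in auto)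
    then obtain D where D: "\<forall>c\<in>PiE I (\<lambda>_. {..<nX}). subpovm dB I (D c)"
       "\<forall>i\<in>I. expect I {..<nX} w (\<lambda>c. tr ((idn dB - D c i) * Bx (c i))) \<le> \<epsilon>" by blast
    define F where "F c m = (if c m \<in> S then 0 else 1) + \<kappa> * (3 * tr ((idn dB - D c m) * Bx (c m)) + 2 * \<epsilon>)" for c m
    have "expect I {..<nX} w (\<lambda>c. \<Sum>m\<in>I. F c m) \<le> real nM * \<epsilon>1"
    proof -
      have "expect I {..<nX} w (\<lambda>c. F c m) \<le> \<epsilon>1" if m: "m \<in> I" for m
      proof -
        have "expect I {..<nX} w (\<lambda>c. F c m) = expect I {..<nX} w (\<lambda>c. if c m \<in> S then 0 else 1) +
            \<kappa> * (3 * expect I {..<nX} w (\<lambda>c. tr ((idn dB - D c m) * Bx (c m))) + 2 * \<epsilon>)"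
          unfolding F_def expect_add expect_cmult expect_const[OF I(1) w] ..
        also have "\<dots> \<le> (\<eta>B\<^sup>2 + \<eta>E\<^sup>2) + \<kappa> * (3 * \<epsilon> + 2 * \<epsilon>)"
        proof (rule add_mono)
          show "expect I {..<nX} w (\<lambda>c. if c m \<in> S then 0 else 1) \<le> \<eta>B\<^sup>2 + \<eta>E\<^sup>2"
            using expect_single[OF I(1) w m, of "\<lambda>x. if x \<in> S then 0 else 1"] Sc by simp
          show "\<kappa> * (3 * expect I {..<nX} w (\<lambda>c. tr ((idn dB - D c m) * Bx (c m))) + 2 * \<epsilon>) \<le> \<kappa> * (3 * \<epsilon> + 2 * \<epsilon>)"
            using D(2) m \<kappa> by (intro mult_left_mono) auto
        qed
        also have "\<dots> \<le> \<epsilon>1"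
          using error_budget[of "sqrt \<epsilon>" s \<delta> \<delta>'] eps s del ds False
          unfolding \<kappa>_def t_def \<eta>B_def \<eta>E_def \<epsilon>1_def s_def by simp
        finally show ?thesis .
      qed
      then have "(\<Sum>m\<in>I. expect I {..<nX} w (\<lambda>c. F c m)) \<le> real (card I) * \<epsilon>1" by (intro sum_bounded_above)
      then show ?thesis unfolding expect_sum by (simp add: I_def)
    qed
    then obtain c where c: "c \<in> PiE I (\<lambda>_. {..<nX})" "(\<Sum>m\<in>I. F c m) \<le> real nM * \<epsilon>1"
      using expect_exists[OF I(1) w] by blast
    have cm: "c m < nX" if "m < nM" for m using c(1) that by (auto simp: I_def dest: PiE_mem)
    have Dm: "pos (D c m)" "car dB (D c m)" "D c m \<le> idn dB" if m: "m < nM" for m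
    proof -
      have D1: "\<forall>i\<in>I. pos (D c i) \<and> car dB (D c i)" "(\<Sum>i\<in>I. D c i) \<le> idn dB" using D(1) c(1) by auto
      then show "pos (D c m)" "car dB (D c m)" using m by (auto simp: I_def)
      have "D c m \<le> (\<Sum>i\<in>I. D c i)" using D1(1) m I(1) by (intro pos_member_le_sum) (auto simp: I_def)
      then show "D c m \<le> idn dB" using D1(2) by (rule order_trans)
    qed
    \<comment> \<open>The public codebook is now fixed, so every public message can receive its own
      private code inside its effect \<open>D c m\<close>.\<close>
    have "\<forall>m\<in>{..<nM}. \<exists>X L \<sigma>. (\<forall>l<nL. qstate dA (X l)) \<and> (\<forall>l<nL. pos (L l) \<and> car dB (L l)) \<and>
        (\<Sum>l<nL. L l) \<le> D c m \<and> qstate dE \<sigma> \<and> (\<Sum>l<nL. tn (outE (X l) - \<sigma>)) \<le> 2 * real nL * (s + t) \<and>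
        (\<Sum>l<nL. tr ((idn dB - L l) * outB (X l))) \<le> real nL * F c m"
      unfolding F_def using inner_code cm Dm by simp
    then obtain X L \<sigma> where XL': "\<forall>m\<in>{..<nM}. (\<forall>l<nL. qstate dA (X m l)) \<and> (\<forall>l<nL. pos (L m l) \<and> car dB (L m l)) \<and>
        (\<Sum>l<nL. L m l) \<le> D c m \<and> qstate dE (\<sigma> m) \<and> (\<Sum>l<nL. tn (outE (X m l) - \<sigma> m)) \<le> 2 * real nL * (s + t) \<and>
        (\<Sum>l<nL. tr ((idn dB - L m l) * outB (X m l))) \<le> real nL * F c m"
      unfolding bchoice_iff by blast
    note XL = bspec[OF XL', unfolded lessThan_iff]
    show ?thesis
    proof (rule code_from_operators[OF V msg, where X = X and L = L])
      show "qstate dA (X m l)" "pos (L m l) \<and> car dB (L m l)" if "m < nM" "l < nL" for m l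
        using XL[OF that(1)] that(2) by auto
      have "(\<Sum>m<nM. \<Sum>l<nL. L m l) \<le> (\<Sum>m\<in>I. D c m)" unfolding I_def using XL by (intro sum_mono) auto
      also have "\<dots> \<le> idn dB" using D(1) c(1) by auto
      finally show "(\<Sum>m<nM. \<Sum>l<nL. L m l) \<le> idn dB" .
      have "(\<Sum>m<nM. \<Sum>l<nL. tr ((idn dB - L m l) * outB (X m l))) \<le> (\<Sum>m\<in>I. real nL * F c m)"
        unfolding I_def using XL by (intro sum_mono) auto
      also have "\<dots> = real nL * (\<Sum>m\<in>I. F c m)" by (simp add: sum_distrib_left)
      also have "\<dots> \<le> real nL * (real nM * \<epsilon>1)" using c(2) by (intro mult_left_mono) auto
      finally show "(\<Sum>m<nM. \<Sum>l<nL. tr ((idn dB - L m l) * outputB V dB dE (X m l))) \<le> real nM * real nL * \<epsilon>1"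
        by (simp add: outB_def mult_ac)
      show "\<exists>\<sigma>. qstate dE \<sigma> \<and> (\<Sum>l<nL. tn (outputE V dB dE (X m l) - \<sigma>)) \<le> 2 * real nL * (s + t)"
        if "m < nM" for m
        using XL[OF that] unfolding outE_def by blast
    qed
  qed
  then show ?thesis unfolding \<epsilon>1_def s_def t_def by (simp add: add.commute)
qed

end
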